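(* Let $Y_{n,p}$ be the size (number of nodes) of the spanning tree of $p$ randomly chosen nodes in a random binary search tree of size $n$, where $1\le p\le n$, and let $E_{n,p}=\mathbb{E}(Y_{n,p})$ and $V_{n,p}=\mathbb{V}(Y_{n,p})$ be its expectation and variance. Then for $2\le p\le n$ $$\begin{aligned}V_{n,p}={}&\frac{4(-1)^p(n+1)(2pH_n-2pH_p+2-3p^2)}{p\binom{n}{p}}\sum_{k=1}^{p-1}\frac{(-1)^k}{k}\binom{n}{k}-\frac{8(-1)^p(n+1)}{\binom{n}{p}}\sum_{k=1}^{p-1}\frac{(-1)^k}{k^2}\binom{n}{k}\\&+\frac{4(-1)^p(n+1)}{\binom{n}{p}}\left(H_n^2-H_n^{(2)}-2H_pH_n\right)+\frac{4(-1)^p(2-3p^2)(n+1)}{p\binom{n}{p}}H_n-\frac{4\Psi_3}{(n+4-p)^{\underline{4}}}(H_n-H_p)\\&+\frac{4p(n+2)(n+1)^2(np+2+p)}{(n+4-p)^{\underline{4}}}\left((H_n-H_p)^2-(H_n^{(2)}-H_p^{(2)})\right)+\frac{2\Psi_4}{(n+4-p)^{\underline{4}}}+E_{n,p}-E_{n,p}^2,\end{aligned}$$ where $$\begin{aligned}\Psi_3={}&-2p^4-6n^2p^3+16p^3-2n^3p^3-45p^2n-58p^2-4n^2p^2+2p^2n^4+7n^3p^2+56p+78np\\&+6n^3p+41pn^2-n^4p-8-20n-16n^2-4n^3,\end{aligned}$$ $$\begin{aligned}\Psi_4={}&-144-6p^5-3n^4-152p^3n+2p^4n^2+25p^4n-234n+78p+10np-5n^4p-39n^2p^3-4n^3p^3\\&+250p^2n+119n^2p^2+2p^2n^4+25n^3p^2-22n^3p-35pn^2+155p^2-173p^3+58p^4-153n^2-42n^3.\end{aligned}$$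 Further, $V_{n,1}=0$, and for fixed $p\ge 2$ and $n\to\infty$ $$V_{n,p}=2p\log n-2p(H_p-\gamma)-4p^2\left(\frac{\pi^2}{6}-H_p^{(2)}\right)+\frac{2(-2+7p-5p^2+2p^3)}{(1-p)^2}+\mathcal{O}\left(\frac{\log^2 n}{n}\right).$$
   Context: A random binary search tree of size $n$ is the binary search tree obtained by successively inserting the entries of a uniformly random permutation of $\{1,\dots,n\}$ into an initially empty tree (random permutation model). Equivalently: the key at the root is uniformly distributed on $\{1,\dots,n\}$, and, given that the root is $k$, the left subtree (on the keys $1,\dots,k-1$) and the right subtree (on the keys $k+1,\dots,n$) are independent random binary search trees of sizes $k-1$ and $n-k$. Independently of the tree, a set of $p$ nodes is chosen uniformly at random among all $\binom{n}{p}$ sets of $p$ distinct nodes. The spanning tree of the chosen nodes is the smallest connected subgraph (subtree) of the binary search tree, viewed as an undirected tree, which contains all $p$ chosen nodes; its size is its number of nodes, and $Y_{n,p}$ denotes this number. The expectation appearing in the formula has the explicit value (for $1\le p\le n$) $$E_{n,p}=\frac{2p(n+1)^2}{(n+2-p)(n+1-p)}(H_n-H_p)+\frac{2(2p-1)(n+1)}{(n+2-p)(n+1-p)}+3+2p-\frac{2pn}{n+1-p}+\frac{2p(n+1)(-1)^p}{\binom{n}{p}}H_n+\frac{2p(n+1)(-1)^p}{\binom{n}{p}}\sum_{k=1}^{p-1}\frac{(-1)^k}{k}\binom{n}{k}.$$ Notation: $H_m=\sum_{k=1}^m\frac1k$, $H_m^{(2)}=\sum_{k=1}^m\frac1{k^2}$,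 $x^{\underline{m}}=x(x-1)\cdots(x-m+1)$ denotes the falling factorial, $\gamma$ is the Euler–Mascheroni constant, $\log$ is the natural logarithm, and $\log^2 n=(\log n)^2$. The constant implied by the $\mathcal{O}$-term may depend on $p$. *)

theory Defs
  imports
    "Graph_Theory.Digraph_Component"
    "HOL-Library.Tree"
    "HOL-Library.Landau_Symbols"
    "HOL-Combinatorics.Multiset_Permutations"
    "HOL-Analysis.Harmonic_Numbers"
    "HOL-Probability.Probability"
begin

fun bst_insert :: "'a::linorder \<Rightarrow> 'a Tree.tree \<Rightarrow> 'a Tree.tree" where
  "bst_insert x \<langle>\<rangle> = \<langle>\<langle>\<rangle>, x, \<langle>\<rangle>\<rangle>"
| "bst_insert x \<langle>l, y, r\<rangle> =
     (if x < y then \<langle>bst_insert x l, y, r\<rangle>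
      else if y < x then \<langle>l, y, bst_insert x r\<rangle>
      else \<langle>l, y, r\<rangle>)"

definition bst_of_list :: "'a::linorder list \<Rightarrow> 'a Tree.tree" where
  "bst_of_list xs = fold bst_insert xs \<langle>\<rangle>"

definition random_bst :: "nat \<Rightarrow> nat Tree.tree pmf" where
  "random_bst n = map_pmf bst_of_list (pmf_of_set (permutations_of_set {1..n}))"

(* The keys of a search tree are distinct, so nodes are identified with their keys. *)

fun child_arcs :: "'a Tree.tree \<Rightarrow> ('a \<times> 'a) set" where
  "child_arcs \<langle>\<rangle> = {}"
| "child_arcs \<langle>l, x, r\<rangle> =
     {(x, value c) |c. c \<in> {l, r} \<and> c \<noteq> \<langle>\<rangle>} \<union> child_arcs l \<union> child_arcs r"

(* Each edge is stored once, directed from parent to child. This represents the undirected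
   tree, because Digraph_Component.connected refers to the underlying symmetric graph
   (weak connectivity). *)

definition bst_graph :: "'a Tree.tree \<Rightarrow> ('a, 'a \<times> 'a) pre_digraph" where
  "bst_graph t = with_proj \<lparr>pverts = set_tree t, parcs = child_arcs t\<rparr>"

definition spanning_tree_size :: "'a Tree.tree \<Rightarrow> 'a set \<Rightarrow> nat" where
  "spanning_tree_size t S =
     (LEAST m. \<exists>H. subgraph H (bst_graph t) \<and> Digraph_Component.connected H
                   \<and> S \<subseteq> verts H \<and> card (verts H) = m)"

(* A random search tree of size n has node set {1..n}; the tree and the chosen set of
   p nodes are independent. *)

definition Y :: "nat \<Rightarrow> nat \<Rightarrow> nat pmf" where
  "Y n p = map_pmf (\<lambda>(t, S). spanning_tree_size t S)
     (pair_pmf (random_bst n) (pmf_of_set {S. S \<subseteq> {1..n} \<and> card S = p}))"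

definition EY :: "nat \<Rightarrow> nat \<Rightarrow> real" where
  "EY n p = measure_pmf.expectation (Y n p) real"

definition VY :: "nat \<Rightarrow> nat \<Rightarrow> real" where
  "VY n p = measure_pmf.variance (Y n p) real"

definition harm2 :: "nat \<Rightarrow> real" where
  "harm2 m = (\<Sum>k=1..m. 1 / real k ^ 2)"

definition falling :: "real \<Rightarrow> nat \<Rightarrow> real" where
  "falling x m = (\<Prod>i<m. x - real i)"

definition Psi3 :: "real \<Rightarrow> real \<Rightarrow> real" where
  "Psi3 n p =
     - 2*p^4 - 6*n^2*p^3 + 16*p^3 - 2*n^3*p^3 - 45*p^2*n - 58*p^2 - 4*n^2*p^2
     + 2*p^2*n^4 + 7*n^3*p^2 + 56*p + 78*n*p
     + 6*n^3*p + 41*p*n^2 - n^4*p - 8 - 20*n - 16*n^2 - 4*n^3"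

definition Psi4 :: "real \<Rightarrow> real \<Rightarrow> real" where
  "Psi4 n p =
     - 144 - 6*p^5 - 3*n^4 - 152*p^3*n + 2*p^4*n^2 + 25*p^4*n - 234*n + 78*p + 10*n*p
     - 5*n^4*p - 39*n^2*p^3 - 4*n^3*p^3
     + 250*p^2*n + 119*n^2*p^2 + 2*p^2*n^4 + 25*n^3*p^2 - 22*n^3*p - 35*p*n^2 + 155*p^2
     - 173*p^3 + 58*p^4 - 153*n^2 - 42*n^3"

end

theory Submission
  imports Defs "HOL-Real_Asymp.Real_Asymp"
begin

text \<open>
  Let \<open>X(t, S)\<close> be the number of nodes on the paths from the root of \<open>t\<close> to the nodes of \<open>S\<close>
  (\<open>paths_size\<close>), and \<open>Y(t, S)\<close> the size of the spanning tree (\<open>span_size\<close>). If \<open>S\<close> is nonempty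
  and lies within one of the two subtrees of the root, then \<open>X\<close> is one more than its value in that
  subtree and \<open>Y\<close> is equal to its value there; if \<open>S\<close> lies in neither, then the root belongs to the
  spanning tree and \<open>Y = X\<close>. The proof computes the first two factorial moments of \<open>X\<close>, and then
  how much they exceed those of \<open>Y\<close>.

  For nonempty \<open>S\<close>, \<open>X\<close> is one more than the sum of its values in the two subtrees. Summing
  \<open>v ^ card S * X\<close> and \<open>v ^ card S * X * (X - 1)\<close> over all sets \<open>S\<close> of nodes therefore turns the root
  decomposition into linear differential equations for the generating functions in the tree size
  (\<open>fps_deriv_path_fps1\<close>, \<open>fps_deriv_path_fps2\<close>). With \<open>a = 1 + v\<close> they are solved by rational
  functions of \<open>1 / (1 - a * z)\<close>, \<open>1 / (1 - z)\<close> and \<open>log (1 / (1 - z))\<close>: all dilogarithms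
  that arise in the integration cancel. Since the expectations are polynomials in \<open>v\<close>, comparing
  coefficients of \<open>v ^ p\<close> isolates the sets of size \<open>p\<close>; the coefficients of
  \<open>log (1 / (1 - z)) ^ j / (1 - z) ^ (m + 1)\<close> are binomial coefficients times harmonic
  expressions (\<open>binom_harm\<close>, \<open>binom_harm2\<close>), so the moments of \<open>X\<close> come out without alternating sums.

  The sums of \<open>X - Y\<close> and of \<open>X * (X - 1) - Y * (Y - 1)\<close> over the sets of size \<open>p\<close> satisfy
  the recurrence \<open>n * e n = 2 * (\<Sum>k<n. e k + w k)\<close> known from Quicksort, with \<open>w\<close> known from the
  first moment of \<open>X\<close>. It is equivalent to a recurrence of first order in \<open>n\<close>, and its solution is
  where the alternating sums enter. It is best written with the tails
  \<open>\<Sum>k=p..n. (-1) ^ k / k ^ j * (n choose k)\<close> (\<open>alt_tail\<close>), because these vanish for \<open>n < p\<close>, so that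
  the initial conditions are trivial; the complete sums are \<open>- harm n\<close> and
  \<open>- ((harm n)\<^sup>2 + harm2 n) / 2\<close>, which converts tails into the initial segments of the theorem.

  For the asymptotics every coefficient in the exact formula is its limit plus \<open>O(1 / n)\<close>, the
  alternating terms differ from their limits by at most \<open>O((ln n)\<^sup>2 / n)\<close>, and the terms of order
  \<open>(ln n)\<^sup>2\<close> in the second factorial moment and in the squared mean cancel.
\<close>

section \<open>The spanning tree of a set of nodes of a binary tree\<close>

text \<open>
  Connectivity of the node set \<open>V\<close> under the arcs in \<open>E\<close>, expressed through cuts. In this form a
  connected set of tree nodes that contains two given nodes is seen at once to contain the nodes
  between them.
\<close>

definition cut_connected :: "('a \<times> 'a) set \<Rightarrow> 'a set \<Rightarrow> bool" where
  "cut_connected E V \<longleftrightarrow>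
     (\<forall>U. (\<forall>a b. (a, b) \<in> E \<longrightarrow> a \<in> V \<longrightarrow> b \<in> V \<longrightarrow> (a \<in> U \<longleftrightarrow> b \<in> U)) \<longrightarrow> V \<subseteq> U \<or> V \<inter> U = {})"

lemma cut_connectedD:
  assumes "cut_connected E V"
    and "\<And>a b. (a, b) \<in> E \<Longrightarrow> a \<in> V \<Longrightarrow> b \<in> V \<Longrightarrow> a \<in> U \<longleftrightarrow> b \<in> U"
  shows "V \<subseteq> U \<or> V \<inter> U = {}"
  using assms(1)[unfolded cut_connected_def, rule_format, of U] assms(2) by blast

lemma cut_connected_mono:
  assumes "cut_connected E V" "E \<subseteq> E'"
  shows "cut_connected E' V"
  unfolding cut_connected_def
proof (intro allI impI)
  fix U
  assume "\<forall>a b. (a, b) \<in> E' \<longrightarrow> a \<in> V \<longrightarrow> b \<in> V \<longrightarrow> (a \<in> U \<longleftrightarrow> b \<in> U)"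
  then show "V \<subseteq> U \<or> V \<inter> U = {}"
    using assms(2) by (intro cut_connectedD[OF assms(1)]) blast
qed

text \<open>
  A walk in \<open>H\<close> that leaves \<open>U\<close> does so along an arc of \<open>H\<close>, which is also an arc of the tree.
\<close>

lemma cut_connected_if_connected:
  assumes "subgraph H (bst_graph t)" and "Digraph_Component.connected H"
  shows "cut_connected (child_arcs t) (verts H)"
  unfolding cut_connected_def
proof (intro allI impI)
  fix U
  assume U: "\<forall>a b. (a, b) \<in> child_arcs t \<longrightarrow> a \<in> verts H \<longrightarrow> b \<in> verts H \<longrightarrow> (a \<in> U \<longleftrightarrow> b \<in> U)"
  have arcs: "arcs H \<subseteq> child_arcs t" "tail H = fst" "head H = snd"
    using assms(1) by (auto simp: subgraph_def bst_graph_def compatible_def)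
  have closed: "v \<in> U"
    if "(u, v) \<in> rtrancl_on (verts H) (parcs (mk_symmetric H))" "u \<in> U" for u v
    using that
  proof (induction rule: rtrancl_on_induct)
    case (step y z)
    then show ?case using U arcs by (auto simp: mk_symmetric_def)
  qed
  have "(u, v) \<in> rtrancl_on (verts H) (parcs (mk_symmetric H))"
    if "u \<in> verts H" "v \<in> verts H" for u v
    using assms(2) that
    by (auto simp: connected_def strongly_connected_def reachable_def mk_symmetric_def)
  with closed show "verts H \<subseteq> U \<or> verts H \<inter> U = {}" by blast
qed

lemma child_arcs_subset: "child_arcs t \<subseteq> set_tree t \<times> set_tree t"
proof (induction t)
  case (Node l x r)
  have "value c \<in> set_tree c" if "c \<noteq> \<langle>\<rangle>" for c :: "'a Tree.tree"
    using that by (cases c) auto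
  with Node show ?case by auto
qed auto

text \<open>
  In the subgraph induced on \<open>V\<close>, no arc crosses the set of nodes reachable from a given one.
\<close>

lemma connected_if_cut_connected:
  assumes "cut_connected (child_arcs t) V" "V \<noteq> {}" "V \<subseteq> set_tree t"
  shows "\<exists>H. subgraph H (bst_graph t) \<and> Digraph_Component.connected H \<and> verts H = V"
proof (intro exI conjI)
  define H where "H = with_proj \<lparr>pverts = V, parcs = child_arcs t \<inter> V \<times> V\<rparr>"
  show "verts H = V" by (simp add: H_def)
  show "subgraph H (bst_graph t)"
    using assms(3) child_arcs_subset[of t]
    by (auto simp: H_def bst_graph_def subgraph_def compatible_def wf_digraph_def)
  show "Digraph_Component.connected H"
    unfolding connected_def strongly_connected_def
  proof (intro conjI ballI)
    show "verts (mk_symmetric H) \<noteq> {}" using assms(2) by (simp add: mk_symmetric_def H_def)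
  next
    fix u v assume uv: "u \<in> verts (mk_symmetric H)" "v \<in> verts (mk_symmetric H)"
    then have uvV: "u \<in> V" "v \<in> V" by (auto simp: mk_symmetric_def H_def)
    define R where "R = {w. (u, w) \<in> rtrancl_on V (parcs (mk_symmetric H))}"
    have "V \<subseteq> R \<or> V \<inter> R = {}"
    proof (rule cut_connectedD[OF assms(1)])
      fix a b assume ab: "(a, b) \<in> child_arcs t" "a \<in> V" "b \<in> V"
      then have "(a, b) \<in> parcs (mk_symmetric H)" "(b, a) \<in> parcs (mk_symmetric H)"
        by (auto simp: mk_symmetric_def H_def intro!: bexI[of _ "(a, b)"])
      then show "a \<in> R \<longleftrightarrow> b \<in> R"
        using ab unfolding R_def by (auto intro: rtrancl_on_into_rtrancl_on)
    qed
    moreover have "u \<in> R" using uvV by (simp add: R_def)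
    ultimately have "v \<in> R" using uvV by blast
    then show "u \<rightarrow>\<^sup>*\<^bsub>with_proj (mk_symmetric H)\<^esub> v"
      by (simp add: R_def reachable_def) (simp add: mk_symmetric_def H_def)
  qed
qed

text \<open>
  The nodes on the paths from the root to the nodes of \<open>S\<close>, that is, the ancestors of nodes of \<open>S\<close>.
\<close>

fun root_paths :: "'a Tree.tree \<Rightarrow> 'a set \<Rightarrow> 'a set" where
  "root_paths \<langle>\<rangle> S = {}"
| "root_paths \<langle>l, x, r\<rangle> S =
     (if S \<inter> set_tree \<langle>l, x, r\<rangle> = {} then {} else insert x (root_paths l S \<union> root_paths r S))"

text \<open>
  The lowest node whose subtree contains \<open>S\<close> is the top of the spanning tree.
\<close>

fun span_nodes :: "'a Tree.tree \<Rightarrow> 'a set \<Rightarrow> 'a set" where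
  "span_nodes \<langle>\<rangle> S = {}"
| "span_nodes \<langle>l, x, r\<rangle> S =
     (if S \<subseteq> set_tree l then span_nodes l S
      else if S \<subseteq> set_tree r then span_nodes r S
      else insert x (root_paths l S \<union> root_paths r S))"

lemma root_paths_cong:
  "S \<inter> set_tree t = S' \<inter> set_tree t \<Longrightarrow> root_paths t S = root_paths t S'"
proof (induction t)
  case (Node l x r)
  then have "root_paths l S = root_paths l S'" "root_paths r S = root_paths r S'" by auto
  moreover have "S \<inter> set_tree \<langle>l, x, r\<rangle> = {} \<longleftrightarrow> S' \<inter> set_tree \<langle>l, x, r\<rangle> = {}" using Node by auto
  ultimately show ?case by (simp del: tree.set)
qed auto

lemma root_paths_subset: "root_paths t S \<subseteq> set_tree t"
  by (induction t) auto

lemma root_paths_empty_iff: "root_paths t S = {} \<longleftrightarrow> S \<inter> set_tree t = {}"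
  by (cases t) auto

lemma subset_root_paths: "S \<inter> set_tree t \<subseteq> root_paths t S"
  by (induction t) auto

lemma root_in_root_paths: "root_paths t S \<noteq> {} \<Longrightarrow> value t \<in> root_paths t S"
  by (cases t) (auto split: if_splits)

lemma span_nodes_subset: "span_nodes t S \<subseteq> set_tree t"
proof (induction t)
  case (Node l x r)
  then show ?case using root_paths_subset[of l S] root_paths_subset[of r S] by auto
qed auto

lemma subset_span_nodes: "S \<subseteq> set_tree t \<Longrightarrow> S \<subseteq> span_nodes t S"
proof (induction t)
  case (Node l x r)
  then show ?case using subset_root_paths[of S l] subset_root_paths[of S r] by auto
qed auto

lemma cut_connected_root_paths: "cut_connected (child_arcs t) (root_paths t S)"
proof (induction t)
  case (Node l x r)
  have side: "root_paths c S = {} \<or> (root_paths c S \<subseteq> U \<and> x \<in> U) \<or> (root_paths c S \<inter> U = {} \<and> x \<notin> U)"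
    if IH: "cut_connected (child_arcs c) (root_paths c S)" and c: "c \<in> {l, r}"
      and U: "\<And>a b. (a, b) \<in> child_arcs \<langle>l, x, r\<rangle> \<Longrightarrow> a \<in> insert x (root_paths l S \<union> root_paths r S)
              \<Longrightarrow> b \<in> insert x (root_paths l S \<union> root_paths r S) \<Longrightarrow> a \<in> U \<longleftrightarrow> b \<in> U" for U c
  proof (cases "root_paths c S = {}")
    case False
    have "root_paths c S \<subseteq> U \<or> root_paths c S \<inter> U = {}"
      by (rule cut_connectedD[OF IH]) (use c U in auto)
    moreover have "value c \<in> root_paths c S" using False by (rule root_in_root_paths)
    moreover from False have "c \<noteq> \<langle>\<rangle>" by auto
    then have "x \<in> U \<longleftrightarrow> value c \<in> U" using c calculation(2) by (intro U) auto
    ultimately show ?thesis by blast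
  qed simp
  show ?case unfolding cut_connected_def
  proof (intro allI impI)
    fix U
    assume U: "\<forall>a b. (a, b) \<in> child_arcs \<langle>l, x, r\<rangle> \<longrightarrow> a \<in> root_paths \<langle>l, x, r\<rangle> S
        \<longrightarrow> b \<in> root_paths \<langle>l, x, r\<rangle> S \<longrightarrow> (a \<in> U \<longleftrightarrow> b \<in> U)"
    show "root_paths \<langle>l, x, r\<rangle> S \<subseteq> U \<or> root_paths \<langle>l, x, r\<rangle> S \<inter> U = {}"
    proof (cases "S \<inter> set_tree \<langle>l, x, r\<rangle> = {}")
      case False
      then have eq: "root_paths \<langle>l, x, r\<rangle> S = insert x (root_paths l S \<union> root_paths r S)"
        by (simp del: tree.set)
      have closed: "a \<in> U \<longleftrightarrow> b \<in> U"
        if "(a, b) \<in> child_arcs \<langle>l, x, r\<rangle>" "a \<in> insert x (root_paths l S \<union> root_paths r S)"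
          "b \<in> insert x (root_paths l S \<union> root_paths r S)" for a b
        using U[unfolded eq] that by blast
      have "c \<in> {l, r} \<Longrightarrow> root_paths c S = {} \<or> (root_paths c S \<subseteq> U \<and> x \<in> U)
          \<or> (root_paths c S \<inter> U = {} \<and> x \<notin> U)" for c
        using side[OF _ _ closed] Node by blast
      from this[of l] this[of r] show ?thesis unfolding eq by blast
    qed simp
  qed
qed (simp add: cut_connected_def)

lemma cut_connected_span_nodes: "cut_connected (child_arcs t) (span_nodes t S)"
proof (induction t)
  case (Node l x r)
  have "cut_connected (child_arcs \<langle>l, x, r\<rangle>) (span_nodes l S)"
    by (rule cut_connected_mono[OF Node(1)]) auto
  moreover have "cut_connected (child_arcs \<langle>l, x, r\<rangle>) (span_nodes r S)"
    by (rule cut_connected_mono[OF Node(2)]) auto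
  moreover have "cut_connected (child_arcs \<langle>l, x, r\<rangle>) (insert x (root_paths l S \<union> root_paths r S))"
  proof (cases "S \<inter> set_tree \<langle>l, x, r\<rangle> = {}")
    case True
    then have "root_paths l S = {}" "root_paths r S = {}" by (auto simp: root_paths_empty_iff)
    then show ?thesis by (simp add: cut_connected_def)
  next
    case False
    then show ?thesis using cut_connected_root_paths[of "\<langle>l, x, r\<rangle>" S] by (simp del: tree.set)
  qed
  ultimately show ?case by (simp del: child_arcs.simps)
qed (simp add: cut_connected_def)

text \<open>
  Connectivity passes to a child subtree \<open>c\<close>: of the two sides of a cut of \<open>c\<close>, the one without the
  root of \<open>c\<close> has no arcs to nodes outside \<open>c\<close>, so it defines a cut of the whole tree with the same
  crossing arcs.
\<close>

lemma cut_connected_subtree: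
  assumes "distinct (inorder \<langle>l, x, r\<rangle>)" "cut_connected (child_arcs \<langle>l, x, r\<rangle>) V" "c \<in> {l, r}"
  shows "cut_connected (child_arcs c) (V \<inter> set_tree c)"
  unfolding cut_connected_def
proof (intro allI impI)
  fix U
  assume U: "\<forall>a b. (a, b) \<in> child_arcs c \<longrightarrow> a \<in> V \<inter> set_tree c \<longrightarrow> b \<in> V \<inter> set_tree c \<longrightarrow> (a \<in> U \<longleftrightarrow> b \<in> U)"
  have disj: "x \<notin> set_tree l" "x \<notin> set_tree r" "set_tree l \<inter> set_tree r = {}"
    using assms(1) by auto
  have sub: "child_arcs l \<subseteq> set_tree l \<times> set_tree l" "child_arcs r \<subseteq> set_tree r \<times> set_tree r"
    by (rule child_arcs_subset)+
  define U' where "U' = (if value c \<in> U then set_tree c - U else set_tree c \<inter> U)"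
  have "V \<subseteq> U' \<or> V \<inter> U' = {}"
  proof (rule cut_connectedD[OF assms(2)])
    fix a b assume ab: "(a, b) \<in> child_arcs \<langle>l, x, r\<rangle>" "a \<in> V" "b \<in> V"
    have root: "value c \<notin> U'" by (simp add: U'_def)
    have U'c: "U' \<subseteq> set_tree c" by (auto simp: U'_def)
    have val: "value d \<in> set_tree d" if "d \<noteq> \<langle>\<rangle>" for d :: "'a Tree.tree" using that by (cases d) auto
    consider d where "d \<in> {l, r}" "d \<noteq> \<langle>\<rangle>" "a = x" "b = value d"
      | "(a, b) \<in> child_arcs c" | d where "d \<in> {l, r}" "(a, b) \<in> child_arcs d" "set_tree d \<inter> set_tree c = {}"
      using ab(1) assms(3) disj(3) by auto
    then show "a \<in> U' \<longleftrightarrow> b \<in> U'"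
    proof cases
      case 1
      then show ?thesis using root U'c disj assms(3) val[of d] by (cases "d = c") auto
    next
      case 2
      moreover from 2 have "a \<in> set_tree c" "b \<in> set_tree c" using child_arcs_subset[of c] by auto
      ultimately show ?thesis using U ab by (auto simp: U'_def)
    next
      case 3
      then have "a \<in> set_tree d" "b \<in> set_tree d" using child_arcs_subset[of d] by auto
      then show ?thesis using 3 U'c by auto
    qed
  qed
  then show "V \<inter> set_tree c \<subseteq> U \<or> V \<inter> set_tree c \<inter> U = {}"
    by (auto simp: U'_def split: if_splits)
qed

text \<open>
  The arc from \<open>x\<close> to the root of \<open>c\<close> is the only one between \<open>c\<close> and the rest of the tree.
\<close>

lemma cut_connected_crosses_root_arc:
  assumes "distinct (inorder \<langle>l, x, r\<rangle>)" "cut_connected (child_arcs \<langle>l, x, r\<rangle>) V" "c \<in> {l, r}"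
    and "V \<inter> set_tree c \<noteq> {}" "\<not> V \<subseteq> set_tree c"
  shows "x \<in> V \<and> value c \<in> V"
proof (rule ccontr)
  assume *: "\<not> (x \<in> V \<and> value c \<in> V)"
  have disj: "x \<notin> set_tree l" "x \<notin> set_tree r" "set_tree l \<inter> set_tree r = {}"
    using assms(1) by auto
  have val: "value d \<in> set_tree d" if "d \<noteq> \<langle>\<rangle>" for d :: "'a Tree.tree" using that by (cases d) auto
  have "V \<subseteq> set_tree c \<or> V \<inter> set_tree c = {}"
  proof (rule cut_connectedD[OF assms(2)])
    fix a b assume ab: "(a, b) \<in> child_arcs \<langle>l, x, r\<rangle>" "a \<in> V" "b \<in> V"
    then consider d where "d \<in> {l, r}" "d \<noteq> \<langle>\<rangle>" "a = x" "b = value d"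
      | d where "d \<in> {l, r}" "(a, b) \<in> child_arcs d"
      by auto
    then show "a \<in> set_tree c \<longleftrightarrow> b \<in> set_tree c"
    proof cases
      case 1
      then show ?thesis using * ab disj assms(3) val[of d] by (cases "d = c") auto
    next
      case 2
      then have "a \<in> set_tree d" "b \<in> set_tree d" using child_arcs_subset[of d] by auto
      then show ?thesis using 2 assms(3) disj by auto
    qed
  qed
  with assms show False by blast
qed

lemma root_paths_minimal:
  "distinct (inorder t) \<Longrightarrow> cut_connected (child_arcs t) V \<Longrightarrow> value t \<in> V \<Longrightarrow> root_paths t V \<subseteq> V"
proof (induction t arbitrary: V)
  case (Node l x r)
  have sub: "root_paths c V \<subseteq> V"
    if c: "c \<in> {l, r}" and IH: "\<And>W. cut_connected (child_arcs c) W \<Longrightarrow> value c \<in> W \<Longrightarrow> root_paths c W \<subseteq> W" for c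
  proof (cases "V \<inter> set_tree c = {}")
    case True
    then show ?thesis by (metis root_paths_empty_iff empty_subsetI)
  next
    case False
    have "x \<notin> set_tree c" using c Node.prems(1) by auto
    with Node.prems(3) have "\<not> V \<subseteq> set_tree c" by auto
    from cut_connected_crosses_root_arc[OF Node.prems(1,2) c False this] have "value c \<in> V" by simp
    moreover have "value c \<in> set_tree c" using False by (cases c) auto
    ultimately have "root_paths c (V \<inter> set_tree c) \<subseteq> V \<inter> set_tree c"
      by (intro IH cut_connected_subtree[OF Node.prems(1,2) c]) auto
    moreover have "root_paths c (V \<inter> set_tree c) = root_paths c V" by (rule root_paths_cong) auto
    ultimately show ?thesis by auto
  qed
  have "root_paths l V \<subseteq> V" "root_paths r V \<subseteq> V"
    using sub[of l] sub[of r] Node.IH Node.prems(1) by auto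
  then show ?case using Node.prems(3) by auto
qed auto

lemma root_paths_mono: "S \<subseteq> S' \<Longrightarrow> root_paths t S \<subseteq> root_paths t S'"
  by (induction t) auto

text \<open>
  If \<open>S\<close> is not contained in one child subtree, then a connected set including \<open>S\<close> contains the
  root, and with it all root paths to its own nodes.
\<close>

lemma span_nodes_minimal:
  "distinct (inorder t) \<Longrightarrow> cut_connected (child_arcs t) V \<Longrightarrow> S \<subseteq> V \<Longrightarrow> S \<subseteq> set_tree t \<Longrightarrow> S \<noteq> {}
    \<Longrightarrow> span_nodes t S \<subseteq> V"
proof (induction t arbitrary: V)
  case (Node l x r)
  have dist: "distinct (inorder l)" "distinct (inorder r)" using Node.prems(1) by auto
  have conn: "cut_connected (child_arcs c) (V \<inter> set_tree c)" if "c \<in> {l, r}" for c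
    by (rule cut_connected_subtree[OF Node.prems(1,2) that])
  show ?case
  proof (cases "S \<subseteq> set_tree l \<or> S \<subseteq> set_tree r")
    case True
    then show ?thesis
      using Node.IH(1)[OF dist(1) conn] Node.IH(2)[OF dist(2) conn] Node.prems(3,5) by auto
  next
    case False
    have "x \<in> V"
    proof (rule ccontr)
      assume "x \<notin> V"
      with Node.prems False have "V \<inter> set_tree l \<noteq> {}" "\<not> V \<subseteq> set_tree l" by auto
      from cut_connected_crosses_root_arc[OF Node.prems(1,2) _ this] \<open>x \<notin> V\<close> show False by simp
    qed
    then have "root_paths \<langle>l, x, r\<rangle> V \<subseteq> V"
      using Node.prems by (intro root_paths_minimal) auto
    with root_paths_mono[OF Node.prems(3), of "\<langle>l, x, r\<rangle>"] have "root_paths \<langle>l, x, r\<rangle> S \<subseteq> V" by auto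
    then show ?thesis using False Node.prems(4,5) by (auto split: if_splits)
  qed
qed auto

lemma spanning_tree_size_eq:
  assumes "distinct (inorder t)" "S \<subseteq> set_tree t" "S \<noteq> {}"
  shows "spanning_tree_size t S = card (span_nodes t S)"
  unfolding spanning_tree_size_def
proof (rule Least_equality)
  have "span_nodes t S \<noteq> {}" using subset_span_nodes[OF assms(2)] assms(3) by auto
  from connected_if_cut_connected[OF cut_connected_span_nodes this span_nodes_subset]
  show "\<exists>H. subgraph H (bst_graph t) \<and> Digraph_Component.connected H \<and> S \<subseteq> verts H
      \<and> card (verts H) = card (span_nodes t S)"
    using subset_span_nodes[OF assms(2)] by metis
next
  fix m
  assume "\<exists>H. subgraph H (bst_graph t) \<and> Digraph_Component.connected H \<and> S \<subseteq> verts H \<and> card (verts H) = m"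
  then obtain H where H: "subgraph H (bst_graph t)" "Digraph_Component.connected H" "S \<subseteq> verts H" "card (verts H) = m"
    by blast
  have "span_nodes t S \<subseteq> verts H"
    using span_nodes_minimal[OF assms(1) cut_connected_if_connected[OF H(1,2)] H(3) assms(2,3)] .
  moreover have "finite (verts H)"
    using H(1) finite_subset[of "verts H" "set_tree t"] by (auto simp: subgraph_def bst_graph_def)
  ultimately show "card (span_nodes t S) \<le> m" using H(4) card_mono by blast
qed

section \<open>Random search trees on arbitrary key sets\<close>

text \<open>
  The subtrees of a random search tree have key sets other than \<open>{1..n}\<close>, so the recursion is stated
  for arbitrary finite key sets.
\<close>

definition random_bst_on :: "nat set \<Rightarrow> nat Tree.tree pmf" where
  "random_bst_on A = map_pmf bst_of_list (pmf_of_set (permutations_of_set A))"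

lemma fold_bst_insert_Node:
  "x \<notin> set xs \<Longrightarrow> fold bst_insert xs \<langle>l, x, r\<rangle> =
     \<langle>fold bst_insert (filter (\<lambda>y. y < x) xs) l, x, fold bst_insert (filter (\<lambda>y. \<not> y < x) xs) r\<rangle>"
  by (induction xs arbitrary: l r) auto

lemma bst_of_list_Cons:
  "x \<notin> set xs \<Longrightarrow> bst_of_list (x # xs) =
     \<langle>bst_of_list (filter (\<lambda>y. y < x) xs), x, bst_of_list (filter (\<lambda>y. \<not> y < x) xs)\<rangle>"
  by (simp add: bst_of_list_def fold_bst_insert_Node)

lemma bst_of_list_keys:
  "distinct xs \<Longrightarrow> distinct (inorder (bst_of_list xs)) \<and> set_tree (bst_of_list xs) = set xs"
proof (induction xs rule: length_induct)
  case (1 xs)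
  show ?case
  proof (cases xs)
    case Nil
    then show ?thesis by (simp add: bst_of_list_def)
  next
    case (Cons x ys)
    have "distinct (inorder (bst_of_list (filter P ys)))
        \<and> set_tree (bst_of_list (filter P ys)) = set (filter P ys)" for P
      using 1 Cons by (auto simp: less_Suc_eq_le)
    then show ?thesis using 1(2) Cons by (auto simp: bst_of_list_Cons simp flip: set_inorder)
  qed
qed

lemma set_pmf_random_bst_on:
  assumes "finite A" "t \<in> set_pmf (random_bst_on A)"
  shows "distinct (inorder t)" "set_tree t = A"
proof -
  obtain xs where xs: "xs \<in> permutations_of_set A" "t = bst_of_list xs"
    using assms by (auto simp: random_bst_on_def)
  show "distinct (inorder t)" "set_tree t = A"
    using bst_of_list_keys[of xs] permutations_of_setD[OF xs(1)] xs(2) by auto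
qed

lemma finite_set_pmf_random_bst_on [simp]: "finite A \<Longrightarrow> finite (set_pmf (random_bst_on A))"
  by (simp add: random_bst_on_def)

lemma random_bst_on_empty [simp]: "random_bst_on {} = return_pmf \<langle>\<rangle>"
  by (simp add: random_bst_on_def bst_of_list_def pmf_of_set_singleton)

text \<open>
  The first inserted key becomes the root and splits the remaining permutation into the
  subsequences of smaller and of larger keys, which are independent uniform permutations.
\<close>

lemma random_bst_on_rec:
  assumes "finite A" "A \<noteq> {}"
  shows "random_bst_on A = pmf_of_set A \<bind>
    (\<lambda>x. map_pmf (\<lambda>(l, r). \<langle>l, x, r\<rangle>)
       (pair_pmf (random_bst_on {a \<in> A. a < x}) (random_bst_on {a \<in> A. x < a})))"
proof -
  let ?p = "\<lambda>B. pmf_of_set (permutations_of_set B)"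
  have "random_bst_on A = pmf_of_set A \<bind> (\<lambda>x. map_pmf (\<lambda>xs. bst_of_list (x # xs)) (?p (A - {x})))"
    unfolding random_bst_on_def random_permutation_of_set[OF assms]
    by (simp add: map_bind_pmf map_pmf_def bind_assoc_pmf bind_return_pmf)
  also have "\<dots> = pmf_of_set A \<bind>
    (\<lambda>x. map_pmf (\<lambda>(l, r). \<langle>l, x, r\<rangle>)
       (pair_pmf (random_bst_on {a \<in> A. a < x}) (random_bst_on {a \<in> A. x < a})))"
  proof (rule bind_pmf_cong)
    fix x assume "x \<in> set_pmf (pmf_of_set A)"
    with assms have x: "x \<in> A" by simp
    have "map_pmf (\<lambda>xs. bst_of_list (x # xs)) (?p (A - {x})) =
        map_pmf ((\<lambda>(ys, zs). \<langle>bst_of_list ys, x, bst_of_list zs\<rangle>) \<circ> partition (\<lambda>y. y < x)) (?p (A - {x}))"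
    proof (rule map_pmf_cong)
      fix xs assume "xs \<in> set_pmf (?p (A - {x}))"
      then have "xs \<in> permutations_of_set (A - {x})" using assms(1) by simp
      from permutations_of_setD(1)[OF this] have "x \<notin> set xs" by simp
      then show "bst_of_list (x # xs)
          = ((\<lambda>(ys, zs). \<langle>bst_of_list ys, x, bst_of_list zs\<rangle>) \<circ> partition (\<lambda>y. y < x)) xs"
        by (simp add: bst_of_list_Cons o_def)
    qed simp
    also have "\<dots> = map_pmf (\<lambda>(ys, zs). \<langle>bst_of_list ys, x, bst_of_list zs\<rangle>)
        (pair_pmf (?p {y \<in> A - {x}. y < x}) (?p {y \<in> A - {x}. \<not> y < x}))"
      using assms(1) by (subst partition_random_permutations[symmetric]) (auto simp: pmf.map_comp)
    also have "{y \<in> A - {x}. y < x} = {a \<in> A. a < x}" by auto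
    also have "{y \<in> A - {x}. \<not> y < x} = {a \<in> A. x < a}" by auto
    also have "map_pmf (\<lambda>(ys, zs). \<langle>bst_of_list ys, x, bst_of_list zs\<rangle>)
        (pair_pmf (?p {a \<in> A. a < x}) (?p {a \<in> A. x < a})) =
      map_pmf (\<lambda>(l, r). \<langle>l, x, r\<rangle>)
        (map_pmf (map_prod bst_of_list bst_of_list) (pair_pmf (?p {a \<in> A. a < x}) (?p {a \<in> A. x < a})))"
      by (simp add: pmf.map_comp o_def case_prod_unfold)
    also have "map_pmf (map_prod bst_of_list bst_of_list) (pair_pmf (?p {a \<in> A. a < x}) (?p {a \<in> A. x < a}))
      = pair_pmf (random_bst_on {a \<in> A. a < x}) (random_bst_on {a \<in> A. x < a})"
      unfolding random_bst_on_def
      by (simp add: map_prod_def pair_map_pmf1 pair_map_pmf2 pmf.map_comp o_def case_prod_unfold)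
    finally show "map_pmf (\<lambda>xs. bst_of_list (x # xs)) (?p (A - {x})) = map_pmf (\<lambda>(l, r). \<langle>l, x, r\<rangle>)
       (pair_pmf (random_bst_on {a \<in> A. a < x}) (random_bst_on {a \<in> A. x < a}))" .
  qed simp
  finally show ?thesis .
qed

lemma expectation_pair_pmf_mult:
  fixes f :: "'a \<Rightarrow> real" and g :: "'b \<Rightarrow> real"
  assumes "finite (set_pmf p)" "finite (set_pmf q)"
  shows "measure_pmf.expectation (pair_pmf p q) (\<lambda>(x, y). f x * g y) =
    measure_pmf.expectation p f * measure_pmf.expectation q g"
proof -
  have "measure_pmf.expectation (pair_pmf p q) (\<lambda>(x, y). f x * g y) =
      (\<Sum>(x, y)\<in>set_pmf p \<times> set_pmf q. (pmf p x * f x) * (pmf q y * g y))"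
    using assms by (subst integral_measure_pmf[of "set_pmf p \<times> set_pmf q"])
      (auto simp: pmf_pair intro!: sum.cong)
  also have "\<dots> = (\<Sum>x\<in>set_pmf p. pmf p x * f x) * (\<Sum>y\<in>set_pmf q. pmf q y * g y)"
    by (simp add: sum_product sum.cartesian_product)
  also have "\<dots> = measure_pmf.expectation p f * measure_pmf.expectation q g"
    using assms by (simp add: integral_measure_pmf[of "set_pmf p"] integral_measure_pmf[of "set_pmf q"])
  finally show ?thesis .
qed

lemma expectation_cong_pmf:
  "(\<And>x. x \<in> set_pmf p \<Longrightarrow> f x = g x) \<Longrightarrow> measure_pmf.expectation p f = measure_pmf.expectation p (g :: _ \<Rightarrow> real)"
  by (intro integral_cong_AE) (auto simp: AE_measure_pmf_iff)

lemma expectation_random_bst_on_rec: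
  fixes f :: "nat Tree.tree \<Rightarrow> real"
  assumes "finite A" "A \<noteq> {}"
  shows "real (card A) * measure_pmf.expectation (random_bst_on A) f =
    (\<Sum>x\<in>A. measure_pmf.expectation
       (pair_pmf (random_bst_on {a \<in> A. a < x}) (random_bst_on {a \<in> A. x < a})) (\<lambda>(l, r). f \<langle>l, x, r\<rangle>))"
proof -
  have "measure_pmf.expectation (random_bst_on A) f =
    (\<Sum>x\<in>A. measure_pmf.expectation (map_pmf (\<lambda>(l, r). \<langle>l, x, r\<rangle>)
       (pair_pmf (random_bst_on {a \<in> A. a < x}) (random_bst_on {a \<in> A. x < a}))) f /\<^sub>R real (card A))"
    unfolding random_bst_on_rec[OF assms] using assms
    by (intro pmf_expectation_bind_pmf_of_set) auto
  also have "\<dots> = (\<Sum>x\<in>A. measure_pmf.expectation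
       (pair_pmf (random_bst_on {a \<in> A. a < x}) (random_bst_on {a \<in> A. x < a})) (\<lambda>(l, r). f \<langle>l, x, r\<rangle>)) / card A"
    by (simp add: sum_divide_distrib divide_inverse case_prod_unfold mult.commute sum_distrib_left)
  finally show ?thesis using assms by simp
qed

text \<open>
  The rank of a key runs through \<open>{..<card A}\<close> exactly once.
\<close>

lemma sum_card_less:
  fixes A :: "nat set" and F :: "nat \<Rightarrow> nat \<Rightarrow> real"
  assumes "finite A"
  shows "(\<Sum>x\<in>A. F (card {a \<in> A. a < x}) (card {a \<in> A. x < a})) = (\<Sum>k<card A. F k (card A - 1 - k))"
proof -
  have gr: "card {a \<in> A. x < a} = card A - 1 - card {a \<in> A. a < x}" if "x \<in> A" for x
  proof -
    have "A = {a \<in> A. a < x} \<union> insert x {a \<in> A. x < a}" using that by auto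
    also have "card \<dots> = card {a \<in> A. a < x} + Suc (card {a \<in> A. x < a})"
      using assms by (subst card_Un_disjoint) auto
    finally show ?thesis by linarith
  qed
  have "(\<Sum>x\<in>A. G (card {a \<in> A. a < x})) = (\<Sum>k<card A. G k)" for G :: "nat \<Rightarrow> real"
    using assms
  proof (induction A rule: finite_linorder_max_induct)
    case (insert b A)
    have "{a \<in> insert b A. a < b} = A" using insert.hyps by auto
    moreover have "{a \<in> insert b A. a < x} = {a \<in> A. a < x}" if "x \<in> A" for x
      using insert.hyps that by (auto dest: order.asym)
    moreover have "b \<notin> A" using insert.hyps by auto
    ultimately show ?case using insert by simp
  qed simp
  from this[of "\<lambda>k. F k (card A - 1 - k)"] show ?thesis using gr by simp
qed

section \<open>Node counts on root paths, summed over all node sets\<close>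

lemma sum_Pow_insert:
  assumes "finite A" "x \<notin> A"
  shows "(\<Sum>S\<in>Pow (insert x A). f S) = (\<Sum>S\<in>Pow A. f S + f (insert x S) :: real)"
proof -
  have "(\<Sum>S\<in>Pow (insert x A). f S) = (\<Sum>S\<in>Pow A. f S) + (\<Sum>S\<in>insert x ` Pow A. f S)"
    unfolding Pow_insert using assms by (intro sum.union_disjoint) auto
  also have "(\<Sum>S\<in>insert x ` Pow A. f S) = (\<Sum>S\<in>Pow A. f (insert x S))"
    using assms by (subst sum.reindex) (auto simp: inj_on_def)
  finally show ?thesis by (simp add: sum.distrib)
qed

lemma sum_Pow_Un:
  assumes "finite A" "finite B" "A \<inter> B = {}"
  shows "(\<Sum>S\<in>Pow (A \<union> B). f S) = (\<Sum>S\<in>Pow A. \<Sum>T\<in>Pow B. f (S \<union> T) :: real)"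
  unfolding sum.cartesian_product
  by (rule sum.reindex_bij_witness[where i = "\<lambda>(S, T). S \<union> T" and j = "\<lambda>U. (U \<inter> A, U \<inter> B)"])
     (use assms in \<open>auto simp flip: Int_Un_distrib simp: Int_absorb2\<close>)

lemma sum_Pow_power_card:
  "finite A \<Longrightarrow> (\<Sum>S\<in>Pow A. v ^ card S) = (1 + v :: real) ^ card A"
proof (induction A rule: finite_induct)
  case (insert x A)
  have "(\<Sum>S\<in>Pow (insert x A). v ^ card S) = (\<Sum>S\<in>Pow A. v ^ card S + v ^ card (insert x S))"
    by (rule sum_Pow_insert) fact+
  also have "\<dots> = (\<Sum>S\<in>Pow A. (1 + v) * v ^ card S)"
  proof (rule sum.cong)
    fix S assume "S \<in> Pow A"
    then have "finite S" "x \<notin> S" using insert finite_subset by auto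
    then show "v ^ card S + v ^ card (insert x S) = (1 + v) * v ^ card S" by (simp add: algebra_simps)
  qed simp
  also have "\<dots> = (1 + v) ^ card (insert x A)" using insert by (simp add: sum_distrib_left[symmetric])
  finally show ?case .
qed simp

lemma sum_Pow_Node:
  assumes "distinct (inorder \<langle>l, x, r\<rangle>)"
  shows "(\<Sum>S\<in>Pow (set_tree \<langle>l, x, r\<rangle>). f S) =
    (\<Sum>S\<in>Pow (set_tree l). \<Sum>T\<in>Pow (set_tree r). f (S \<union> T) + f (insert x (S \<union> T)) :: real)"
proof -
  have d: "x \<notin> set_tree l \<union> set_tree r" "set_tree l \<inter> set_tree r = {}" using assms by auto
  have "set_tree \<langle>l, x, r\<rangle> = insert x (set_tree l \<union> set_tree r)" by auto
  then have "(\<Sum>S\<in>Pow (set_tree \<langle>l, x, r\<rangle>). f S) =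
      (\<Sum>S\<in>Pow (set_tree l \<union> set_tree r). f S + f (insert x S))"
    using sum_Pow_insert[OF _ d(1)] by simp
  also have "\<dots> = (\<Sum>S\<in>Pow (set_tree l). \<Sum>T\<in>Pow (set_tree r). f (S \<union> T) + f (insert x (S \<union> T)))"
    by (rule sum_Pow_Un) (use d in auto)
  finally show ?thesis .
qed

definition paths_size :: "'a Tree.tree \<Rightarrow> 'a set \<Rightarrow> real" where
  "paths_size t S = real (card (root_paths t S))"

lemma finite_root_paths [simp]: "finite (root_paths t S)"
  by (rule finite_subset[OF root_paths_subset finite_set_tree])

lemma paths_size_empty [simp]: "paths_size t {} = 0"
  using root_paths_empty_iff[of t "{}"] by (simp add: paths_size_def)

lemma card_root_paths_Node:
  assumes "distinct (inorder \<langle>l, x, r\<rangle>)"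
  shows "real (card (insert x (root_paths l S \<union> root_paths r S))) = 1 + paths_size l S + paths_size r S"
proof -
  have "root_paths l S \<inter> root_paths r S = {}" "x \<notin> root_paths l S \<union> root_paths r S"
    using assms root_paths_subset[of l S] root_paths_subset[of r S] by auto
  then show ?thesis by (simp add: card_Un_disjoint paths_size_def)
qed

lemma paths_size_Node:
  assumes "distinct (inorder \<langle>l, x, r\<rangle>)" "S \<subseteq> set_tree l" "T \<subseteq> set_tree r"
  shows "paths_size \<langle>l, x, r\<rangle> (insert x (S \<union> T)) = 1 + paths_size l S + paths_size r T"
    and "paths_size \<langle>l, x, r\<rangle> (S \<union> T) =
      (if S \<union> T = {} then 0 else 1 + paths_size l S + paths_size r T)"
proof -
  have "root_paths l (insert x (S \<union> T)) = root_paths l S" "root_paths r (insert x (S \<union> T)) = root_paths r T"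
    "root_paths l (S \<union> T) = root_paths l S" "root_paths r (S \<union> T) = root_paths r T"
    by (rule root_paths_cong; use assms in auto)+
  then have "paths_size l (insert x (S \<union> T)) = paths_size l S" "paths_size r (insert x (S \<union> T)) = paths_size r T"
    "paths_size l (S \<union> T) = paths_size l S" "paths_size r (S \<union> T) = paths_size r T"
    by (simp_all add: paths_size_def)
  note eq = this
  show "paths_size \<langle>l, x, r\<rangle> (insert x (S \<union> T)) = 1 + paths_size l S + paths_size r T"
    using card_root_paths_Node[OF assms(1), of "insert x (S \<union> T)"] eq by (simp add: paths_size_def)
  show "paths_size \<langle>l, x, r\<rangle> (S \<union> T) =
      (if S \<union> T = {} then 0 else 1 + paths_size l S + paths_size r T)"
  proof (cases "S \<union> T = {}")
    case False
    then have "(S \<union> T) \<inter> set_tree \<langle>l, x, r\<rangle> \<noteq> {}" using assms by auto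
    then show ?thesis using card_root_paths_Node[OF assms(1), of "S \<union> T"] eq False
      by (simp add: paths_size_def del: tree.set)
  qed simp
qed

definition path_poly1 :: "real \<Rightarrow> 'a Tree.tree \<Rightarrow> real" where
  "path_poly1 v t = (\<Sum>S\<in>Pow (set_tree t). v ^ card S * paths_size t S)"

definition path_poly2 :: "real \<Rightarrow> 'a Tree.tree \<Rightarrow> real" where
  "path_poly2 v t = (\<Sum>S\<in>Pow (set_tree t). v ^ card S * (paths_size t S * (paths_size t S - 1)))"

lemma card_insert_Un:
  assumes "distinct (inorder \<langle>l, x, r\<rangle>)" "S \<subseteq> set_tree l" "T \<subseteq> set_tree r"
  shows "card (S \<union> T) = card S + card T" "card (insert x (S \<union> T)) = Suc (card S + card T)"
proof -
  have "finite S" "finite T" using assms finite_subset finite_set_tree by blast+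
  moreover have "S \<inter> T = {}" "x \<notin> S \<union> T" using assms by auto
  ultimately show "card (S \<union> T) = card S + card T" "card (insert x (S \<union> T)) = Suc (card S + card T)"
    by (simp_all add: card_Un_disjoint)
qed

text \<open>
  Sets \<open>S\<close> correspond to a part in each subtree and the choice whether to include the root; this
  choice produces the factor \<open>a\<close>. The subtracted \<open>1\<close> accounts for the empty set, for which the root
  is not counted.
\<close>

lemma path_poly1_Node:
  fixes v :: real
  assumes "distinct (inorder \<langle>l, x, r\<rangle>)"
  defines "a \<equiv> 1 + v"
  shows "path_poly1 v \<langle>l, x, r\<rangle> = a ^ (card (set_tree l) + card (set_tree r) + 1) - 1
      + a * (path_poly1 v l * a ^ card (set_tree r) + a ^ card (set_tree l) * path_poly1 v r)"
proof -
  let ?w = "\<lambda>S. v ^ card S"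
  have "path_poly1 v \<langle>l, x, r\<rangle> = (\<Sum>S\<in>Pow (set_tree l). \<Sum>T\<in>Pow (set_tree r).
      a * (?w S * ?w T + (?w S * paths_size l S) * ?w T + ?w S * (?w T * paths_size r T))
      - (if S = {} \<and> T = {} then 1 else 0))"
    unfolding path_poly1_def sum_Pow_Node[OF assms(1)]
    by (intro sum.cong refl)
       (auto simp: card_insert_Un[OF assms(1)] paths_size_Node[OF assms(1)] a_def power_add algebra_simps simp del: tree.set)
  also have "\<dots> = a * ((\<Sum>S\<in>Pow (set_tree l). \<Sum>T\<in>Pow (set_tree r). ?w S * ?w T)
      + (\<Sum>S\<in>Pow (set_tree l). \<Sum>T\<in>Pow (set_tree r). (?w S * paths_size l S) * ?w T)
      + (\<Sum>S\<in>Pow (set_tree l). \<Sum>T\<in>Pow (set_tree r). ?w S * (?w T * paths_size r T))) - 1"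
  proof -
    have "(\<Sum>S\<in>Pow (set_tree l). \<Sum>T\<in>Pow (set_tree r). if S = {} \<and> T = {} then 1 else 0 :: real)
        = (\<Sum>S\<in>Pow (set_tree l). if S = {} then 1 else 0)"
      by (intro sum.cong refl) (simp add: sum.If_cases)
    also have "\<dots> = 1" by (simp add: sum.If_cases)
    finally have "(\<Sum>S\<in>Pow (set_tree l). \<Sum>T\<in>Pow (set_tree r). if S = {} \<and> T = {} then 1 else 0 :: real) = 1" .
    then show ?thesis by (simp only: sum_subtractf sum.distrib sum_distrib_left[symmetric])
  qed
  also have "\<dots> = a ^ (card (set_tree l) + card (set_tree r) + 1) - 1
      + a * (path_poly1 v l * a ^ card (set_tree r) + a ^ card (set_tree l) * path_poly1 v r)"
    unfolding path_poly1_def a_def sum_product[symmetric]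
    by (simp add: sum_Pow_power_card power_add algebra_simps)
  finally show ?thesis .
qed

text \<open>
  If \<open>y\<close> is the sum of the counts in the two subtrees, then the contribution is \<open>(1 + y) * y\<close>. Unlike
  the count itself, this vanishes for the empty set without counting the root separately.
\<close>

lemma path_poly2_Node:
  fixes v :: real
  assumes "distinct (inorder \<langle>l, x, r\<rangle>)"
  defines "a \<equiv> 1 + v"
  shows "path_poly2 v \<langle>l, x, r\<rangle> = a * (
      (path_poly2 v l + 2 * path_poly1 v l) * a ^ card (set_tree r)
      + a ^ card (set_tree l) * (path_poly2 v r + 2 * path_poly1 v r)
      + 2 * (path_poly1 v l * path_poly1 v r))"
proof -
  let ?w = "\<lambda>S. v ^ card S"
  let ?f = "\<lambda>t S. ?w S * (paths_size t S * (paths_size t S - 1)) + 2 * (?w S * paths_size t S)"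
  have "path_poly2 v \<langle>l, x, r\<rangle> = (\<Sum>S\<in>Pow (set_tree l). \<Sum>T\<in>Pow (set_tree r).
      a * (?f l S * ?w T + ?w S * ?f r T + 2 * ((?w S * paths_size l S) * (?w T * paths_size r T))))"
    unfolding path_poly2_def sum_Pow_Node[OF assms(1)]
    by (intro sum.cong refl)
       (auto simp: card_insert_Un[OF assms(1)] paths_size_Node[OF assms(1)] a_def power_add algebra_simps simp del: tree.set)
  also have "\<dots> = a * ((\<Sum>S\<in>Pow (set_tree l). \<Sum>T\<in>Pow (set_tree r). ?f l S * ?w T)
      + (\<Sum>S\<in>Pow (set_tree l). \<Sum>T\<in>Pow (set_tree r). ?w S * ?f r T)
      + 2 * (\<Sum>S\<in>Pow (set_tree l). \<Sum>T\<in>Pow (set_tree r). (?w S * paths_size l S) * (?w T * paths_size r T)))"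
    by (simp only: sum_distrib_left[symmetric] sum.distrib)
  also have "\<dots> = a * (
      (path_poly2 v l + 2 * path_poly1 v l) * a ^ card (set_tree r)
      + a ^ card (set_tree l) * (path_poly2 v r + 2 * path_poly1 v r)
      + 2 * (path_poly1 v l * path_poly1 v r))"
    unfolding path_poly1_def path_poly2_def a_def
    by (simp only: sum_distrib_left[symmetric] sum_distrib_right[symmetric] sum.distrib
        sum_Pow_power_card finite_set_tree)
  finally show ?thesis .
qed



section \<open>Explicit bivariate generating functions\<close>

definition fps_geo :: "real \<Rightarrow> real fps" where "fps_geo a = Abs_fps (\<lambda>n. a ^ n)"
text \<open>
  The series of \<open>ln (1 / (1 - z))\<close>; its constant coefficient is \<open>1 / 0 = 0\<close>.
\<close>

definition fps_log :: "real fps" where "fps_log = Abs_fps (\<lambda>n. 1 / real n)"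

lemma fps_geo_nth [simp]: "fps_nth (fps_geo a) n = a ^ n" by (simp add: fps_geo_def)
lemma fps_log_nth [simp]: "fps_nth fps_log n = 1 / real n" by (simp add: fps_log_def)

lemma fps_geo_eq: "fps_geo a = 1 + fps_const a * fps_X * fps_geo a"
  by (rule fps_ext) (auto simp: mult.assoc power_eq_if)

lemma fps_geo_square_nth: "fps_nth (fps_geo a * fps_geo a) n = (real n + 1) * a ^ n"
  by (simp add: fps_mult_nth flip: power_add)

lemma fps_deriv_geo: "fps_deriv (fps_geo a) = fps_const a * (fps_geo a * fps_geo a)"
  by (rule fps_ext) (simp only: fps_deriv_nth fps_geo_nth fps_mult_left_const_nth fps_geo_square_nth, simp)

lemma fps_deriv_log: "fps_deriv fps_log = fps_geo 1"
  by (rule fps_ext) simp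

context fixes v :: real begin

text \<open>
  The solution, with constant coefficient \<open>0\<close>, of the differential equation
  \<open>fps_deriv_path_fps1\<close> that encodes the root decomposition; it is found by multiplying with the
  integrating factor \<open>(1 - a * z)\<^sup>2\<close>, where \<open>a = 1 + v\<close>.
\<close>

definition path_fps1 :: "real fps" where
  "path_fps1 = fps_geo (1 + v) ^ 2 * (fps_const v * (2 * fps_const (1 + v) * fps_log
     - fps_const (1 + v) * fps_X - fps_const v * (fps_geo 1 - 1)))"

text \<open>
  The corresponding solution for the second factorial moment.
\<close>

definition path_fps2 :: "real fps" where
  "path_fps2 = (let A = fps_const (1 + v); V = fps_const v; U = fps_geo (1 + v); S = fps_geo 1; L = fps_log in
     U ^ 2 * (8 * A^2 * V^2 * U * L^2 + 4 * A^2 * V * L^2 - 16 * A * V^2 * U * L - 4 * A * V * (1 - V) * L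
       + 8 * V^2 * (U - 1) + 2 * A * V * (V + 2) * fps_X + 2 * A * V^2 * (S - 1)))"

text \<open>
  Products of the two poles reduce to sums. With this relation the differential equations become
  identities of polynomials in the two geometric series and the logarithm.
\<close>

lemma partial_fractions:
  "fps_const v * fps_geo 1 * fps_geo (1 + v) = fps_const (1 + v) * fps_geo (1 + v) - fps_geo 1"
proof -
  define A V U S where "A = fps_const (1 + v)" "V = fps_const v" "U = fps_geo (1 + v)" "S = fps_geo (1::real)"
  have "A = 1 + V" by (simp add: A_V_U_S_def flip: fps_const_add)
  moreover have "U = 1 + A * fps_X * U" unfolding A_V_U_S_def by (rule fps_geo_eq)
  moreover have "S = 1 + fps_X * S" unfolding A_V_U_S_def using fps_geo_eq[of 1] by simp
  ultimately have "V * S * U = A * U - S" by algebra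
  then show ?thesis by (simp add: A_V_U_S_def)
qed

lemma fps_deriv_path_fps1:
  "fps_deriv path_fps1 = 2 * fps_const (1 + v) * (fps_geo (1 + v) * path_fps1)
     + fps_const (1 + v) * (fps_geo (1 + v) * fps_geo (1 + v)) - fps_geo 1 * fps_geo 1"
proof -
  define A V U S where "A = fps_const (1 + v)" "V = fps_const v" "U = fps_geo (1 + v)" "S = fps_geo (1::real)"
  define L where "L = fps_log"
  have A: "A = 1 + V" by (simp add: A_V_U_S_def flip: fps_const_add)
  have pf: "V * S * U = A * U - S" using partial_fractions by (simp add: A_V_U_S_def)
  have dU: "fps_deriv U = A * (U * U)" and dS: "fps_deriv S = S * S" and dL: "fps_deriv L = S"
    and dA: "fps_deriv A = 0" "fps_deriv V = 0"
    by (auto simp: A_V_U_S_def L_def fps_deriv_geo fps_deriv_log)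
  have g: "path_fps1 = U ^ 2 * (V * (2 * A * L - A * fps_X - V * (S - 1)))"
    by (simp add: path_fps1_def A_V_U_S_def L_def)
  have "fps_deriv path_fps1 = 2 * A * U ^ 3 * (V * (2 * A * L - A * fps_X - V * (S - 1)))
      + U ^ 2 * (V * (2 * A * S - A - V * (S * S)))"
    unfolding g by (simp add: dU dS dL dA power2_eq_square power3_eq_cube algebra_simps)
  also have "\<dots> = 2 * A * (U * path_fps1) + A * (U * U) - S * S"
    unfolding g using A pf by algebra
  finally show ?thesis by (simp add: A_V_U_S_def)
qed

lemma fps_deriv_path_fps2:
  "fps_deriv path_fps2 = 2 * fps_const (1 + v) * (fps_geo (1 + v) * (path_fps2 + 2 * path_fps1))
     + 2 * fps_const (1 + v) * (path_fps1 * path_fps1)"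
proof -
  define A V U S where "A = fps_const (1 + v)" "V = fps_const v" "U = fps_geo (1 + v)" "S = fps_geo (1::real)"
  define L where "L = fps_log"
  have A: "A = 1 + V" by (simp add: A_V_U_S_def flip: fps_const_add)
  have pf: "V * S * U = A * U - S" using partial_fractions by (simp add: A_V_U_S_def)
  have geo: "U = 1 + A * fps_X * U" unfolding A_V_U_S_def by (rule fps_geo_eq)
  have dU: "fps_deriv U = A * (U * U)" and dS: "fps_deriv S = S * S" and dL: "fps_deriv L = S"
    and dA: "fps_deriv A = 0" "fps_deriv V = 0"
    by (auto simp: A_V_U_S_def L_def fps_deriv_geo fps_deriv_log)
  have g: "path_fps1 = U ^ 2 * (V * (2 * A * L - A * fps_X - V * (S - 1)))"
    by (simp add: path_fps1_def A_V_U_S_def L_def)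
  \<comment> \<open>One factor \<open>U\<close> is spent on eliminating \<open>fps_X\<close> and the product \<open>S * U\<close>.\<close>
  have Ug: "path_fps1 = U * (V * (2 * A * U * L - 2 * U + S + 1))"
    unfolding g using A pf geo by algebra
  define H where "H = 8 * A^2 * V^2 * U * L^2 + 4 * A^2 * V * L^2 - 16 * A * V^2 * U * L - 4 * A * V * (1 - V) * L
       + 8 * V^2 * (U - 1) + 2 * A * V * (V + 2) * fps_X + 2 * A * V^2 * (S - 1)"
  have g2: "path_fps2 = U ^ 2 * H" by (simp add: path_fps2_def A_V_U_S_def L_def Let_def H_def)
  have dH: "fps_deriv H = 8 * A^2 * V^2 * (A * (U * U) * L^2 + 2 * U * L * S) + 8 * A^2 * V * L * S
      - 16 * A * V^2 * (A * (U * U) * L + U * S) - 4 * A * V * (1 - V) * S + 8 * V^2 * A * (U * U)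
      + 2 * A * V * (V + 2) + 2 * A * V^2 * (S * S)"
    unfolding H_def by (simp add: dU dS dL dA power2_eq_square) (simp add: algebra_simps)
  have "fps_deriv path_fps2 = 2 * A * (U * path_fps2) + U ^ 2 * fps_deriv H"
    unfolding g2 by (simp add: dU power2_eq_square algebra_simps)
  moreover have "fps_deriv H = 2 * A * V^2 * (2 * A * U * L - 2 * U + S + 1)^2
      + 4 * A * V * (2 * A * U * L - 2 * U + S + 1)"
    unfolding dH using A pf by algebra
  ultimately have "fps_deriv path_fps2 = 2 * A * (U * (path_fps2 + 2 * path_fps1)) + 2 * A * (path_fps1 * path_fps1)"
    unfolding Ug by algebra
  then show ?thesis by (simp add: A_V_U_S_def)
qed

end

section \<open>Expectations over random search trees\<close>

lemma fps_mult_nth_lessThan: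
  "n > 0 \<Longrightarrow> fps_nth (f * g) (n - 1) = (\<Sum>k<n. fps_nth f k * fps_nth (g :: real fps) (n - 1 - k))"
  by (cases n) (auto simp: fps_mult_nth atLeast0AtMost lessThan_Suc_atMost)

lemma fps_nth_two_const_mult: "fps_nth (2 * fps_const a * f) n = 2 * a * fps_nth f n" for a :: real
proof -
  have *: "2 * fps_const a = fps_const (2 * a)" by (simp add: numeral_fps_const)
  show ?thesis unfolding * by (rule fps_mult_left_const_nth)
qed

lemma path_fps1_rec:
  assumes "n > 0"
  shows "real n * fps_nth (path_fps1 v) n = (\<Sum>k<n. (1 + v) ^ n - 1
    + (1 + v) * (fps_nth (path_fps1 v) k * (1 + v) ^ (n - 1 - k) + (1 + v) ^ k * fps_nth (path_fps1 v) (n - 1 - k)))"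
proof -
  define a where "a = 1 + v"
  have "real n * fps_nth (path_fps1 v) n = fps_nth (fps_deriv (path_fps1 v)) (n - 1)"
    using assms by (simp add: Suc_diff_1)
  also have "\<dots> = 2 * a * fps_nth (fps_geo a * path_fps1 v) (n - 1) + a * (real n * a ^ (n - 1)) - real n"
    using assms fps_geo_square_nth[of a "n - 1"] fps_geo_square_nth[of 1 "n - 1"]
    unfolding fps_deriv_path_fps1 a_def[symmetric]
    by (simp only: fps_sub_nth fps_add_nth fps_nth_two_const_mult fps_mult_left_const_nth) (simp add: of_nat_diff)
  also have "a * (real n * a ^ (n - 1)) = real n * a ^ n"
    using power_minus_mult[OF assms, of a] by (metis mult.commute mult.left_commute)
  also have "2 * a * fps_nth (fps_geo a * path_fps1 v) (n - 1) =
      a * (fps_nth (path_fps1 v * fps_geo a) (n - 1) + fps_nth (fps_geo a * path_fps1 v) (n - 1))"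
    by (simp add: mult.commute[of "path_fps1 v"])
  also have "\<dots> + real n * a ^ n - real n =
    (\<Sum>k<n. a ^ n - 1 + a * (fps_nth (path_fps1 v) k * a ^ (n - 1 - k) + a ^ k * fps_nth (path_fps1 v) (n - 1 - k)))"
    unfolding fps_mult_nth_lessThan[OF assms]
    by (simp add: sum.distrib sum_subtractf right_diff_distrib flip: sum_distrib_left)
  finally show ?thesis by (simp add: a_def)
qed

lemma path_fps2_rec:
  assumes "n > 0"
  shows "real n * fps_nth (path_fps2 v) n = (\<Sum>k<n. (1 + v) * (
      (fps_nth (path_fps2 v) k + 2 * fps_nth (path_fps1 v) k) * (1 + v) ^ (n - 1 - k)
      + (1 + v) ^ k * (fps_nth (path_fps2 v) (n - 1 - k) + 2 * fps_nth (path_fps1 v) (n - 1 - k))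
      + 2 * (fps_nth (path_fps1 v) k * fps_nth (path_fps1 v) (n - 1 - k))))"
proof -
  define a where "a = 1 + v"
  define F where "F = path_fps2 v + 2 * path_fps1 v"
  have F: "fps_nth F k = fps_nth (path_fps2 v) k + 2 * fps_nth (path_fps1 v) k" for k
    by (simp add: F_def numeral_fps_const)
  have "real n * fps_nth (path_fps2 v) n = fps_nth (fps_deriv (path_fps2 v)) (n - 1)"
    using assms by (simp add: Suc_diff_1)
  also have "\<dots> = 2 * a * fps_nth (fps_geo a * F) (n - 1) + 2 * a * fps_nth (path_fps1 v * path_fps1 v) (n - 1)"
    unfolding fps_deriv_path_fps2 a_def[symmetric] F_def[symmetric]
    by (simp only: fps_add_nth fps_nth_two_const_mult)
  also have "2 * a * fps_nth (fps_geo a * F) (n - 1) =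
      a * (fps_nth (F * fps_geo a) (n - 1) + fps_nth (fps_geo a * F) (n - 1))"
    by (simp add: mult.commute[of F])
  also have "\<dots> + 2 * a * fps_nth (path_fps1 v * path_fps1 v) (n - 1) = (\<Sum>k<n. a * (
      fps_nth F k * a ^ (n - 1 - k) + a ^ k * fps_nth F (n - 1 - k)
      + 2 * (fps_nth (path_fps1 v) k * fps_nth (path_fps1 v) (n - 1 - k))))"
    unfolding fps_mult_nth_lessThan[OF assms]
    by (simp add: sum.distrib algebra_simps flip: sum_distrib_left)
  finally show ?thesis by (simp only: F a_def)
qed

lemma expectation_pair_bilinear:
  fixes f :: "'a \<Rightarrow> real" and g :: "'b \<Rightarrow> real"
  assumes "finite (set_pmf p)" "finite (set_pmf q)"
  shows "measure_pmf.expectation (pair_pmf p q) (\<lambda>(x, y). c + (f x + g y) + d * (h x * k y)) =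
    c + (measure_pmf.expectation p f + measure_pmf.expectation q g)
    + d * (measure_pmf.expectation p h * measure_pmf.expectation q k)"
proof -
  note [simp] = integrable_measure_pmf_finite[of "pair_pmf p q"] assms
  have "measure_pmf.expectation (pair_pmf p q) (\<lambda>(x, y). c + (f x + g y) + d * (h x * k y)) =
    c + (measure_pmf.expectation (pair_pmf p q) (\<lambda>(x, y). f x * 1)
       + measure_pmf.expectation (pair_pmf p q) (\<lambda>(x, y). 1 * g y))
    + d * measure_pmf.expectation (pair_pmf p q) (\<lambda>(x, y). h x * k y)"
    by (simp add: case_prod_unfold)
  then show ?thesis unfolding expectation_pair_pmf_mult[OF assms] by simp
qed

text \<open>
  The form \<open>c + (f + g) + d * h * k\<close> covers all recursions below: the two subtrees are
  independent, so the product \<open>h * k\<close> factors, and \<open>f\<close> and \<open>g\<close> may depend on the size of the other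
  subtree.
\<close>

lemma expectation_random_bst_on_split:
  fixes F :: "nat Tree.tree \<Rightarrow> real"
  assumes A: "finite A" "A \<noteq> {}"
    and F: "\<And>l x r. distinct (inorder \<langle>l, x, r\<rangle>) \<Longrightarrow> card A = Suc (card (set_tree l) + card (set_tree r)) \<Longrightarrow>
      F \<langle>l, x, r\<rangle> = c + (f (card (set_tree r)) l + g (card (set_tree l)) r) + d * (h l * k r)"
  shows "real (card A) * measure_pmf.expectation (random_bst_on A) F = (\<Sum>x\<in>A.
      let L = {a \<in> A. a < x}; R = {a \<in> A. x < a} in
      c + (measure_pmf.expectation (random_bst_on L) (f (card R)) + measure_pmf.expectation (random_bst_on R) (g (card L)))
      + d * (measure_pmf.expectation (random_bst_on L) h * measure_pmf.expectation (random_bst_on R) k))"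
  unfolding expectation_random_bst_on_rec[OF A]
proof (rule sum.cong[OF refl])
  fix x assume x: "x \<in> A"
  define L R where "L = {a \<in> A. a < x}" and "R = {a \<in> A. x < a}"
  have fin: "finite L" "finite R" using A by (auto simp: L_def R_def)
  have "card A = card (insert x (L \<union> R))" using x by (intro arg_cong[of _ _ card]) (auto simp: L_def R_def)
  also have "\<dots> = Suc (card L + card R)"
  proof -
    have "L \<inter> R = {}" "x \<notin> L \<union> R" by (auto simp: L_def R_def)
    then show ?thesis using fin by (simp add: card_Un_disjoint)
  qed
  finally have card: "card A = Suc (card L + card R)" .
  have "measure_pmf.expectation (pair_pmf (random_bst_on L) (random_bst_on R)) (\<lambda>(l, r). F \<langle>l, x, r\<rangle>)
    = measure_pmf.expectation (pair_pmf (random_bst_on L) (random_bst_on R))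
        (\<lambda>(l, r). c + (f (card R) l + g (card L) r) + d * (h l * k r))"
  proof (rule expectation_cong_pmf)
    fix lr assume "lr \<in> set_pmf (pair_pmf (random_bst_on L) (random_bst_on R))"
    then obtain l r where lr: "lr = (l, r)" "l \<in> set_pmf (random_bst_on L)" "r \<in> set_pmf (random_bst_on R)"
      by auto
    note l = set_pmf_random_bst_on[OF fin(1) lr(2)] and r = set_pmf_random_bst_on[OF fin(2) lr(3)]
    have "x \<notin> set_tree l" "x \<notin> set_tree r" "set_tree l \<inter> set_tree r = {}"
      unfolding l(2) r(2) L_def R_def by auto
    then have "distinct (inorder \<langle>l, x, r\<rangle>)" using l(1) r(1) by simp
    from F[OF this] show "(case lr of (l, r) \<Rightarrow> F \<langle>l, x, r\<rangle>) =
        (case lr of (l, r) \<Rightarrow> c + (f (card R) l + g (card L) r) + d * (h l * k r))"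
      using l r card lr by simp
  qed
  also have "\<dots> = c + (measure_pmf.expectation (random_bst_on L) (f (card R))
      + measure_pmf.expectation (random_bst_on R) (g (card L)))
      + d * (measure_pmf.expectation (random_bst_on L) h * measure_pmf.expectation (random_bst_on R) k)"
    by (rule expectation_pair_bilinear) (use fin in auto)
  finally show "measure_pmf.expectation (pair_pmf (random_bst_on {a \<in> A. a < x}) (random_bst_on {a \<in> A. x < a}))
      (\<lambda>(l, r). F \<langle>l, x, r\<rangle>) = (let L = {a \<in> A. a < x}; R = {a \<in> A. x < a} in
      c + (measure_pmf.expectation (random_bst_on L) (f (card R)) + measure_pmf.expectation (random_bst_on R) (g (card L)))
      + d * (measure_pmf.expectation (random_bst_on L) h * measure_pmf.expectation (random_bst_on R) k))"
    by (simp add: Let_def L_def R_def)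
qed

lemma card_less_parts:
  assumes "finite (A :: nat set)" "x \<in> A"
  shows "card {a \<in> A. a < x} < card A" "card {a \<in> A. x < a} < card A"
  by (rule psubset_card_mono; use assms in auto)+

text \<open>
  Root decomposition and differential equation give the same recurrence in the number of keys.
\<close>

lemma expectation_path_poly1:
  "finite A \<Longrightarrow> measure_pmf.expectation (random_bst_on A) (path_poly1 v) = fps_nth (path_fps1 v) (card A)"
proof (induction "card A" arbitrary: A rule: less_induct)
  case less
  let ?a = "1 + v" and ?E = "\<lambda>A. measure_pmf.expectation (random_bst_on A)"
  show ?case
  proof (cases "A = {}")
    case True
    then show ?thesis by (simp add: path_poly1_def path_fps1_def)
  next
    case False
    define F where "F = (\<lambda>k m. ?a ^ card A - 1
      + ?a * (fps_nth (path_fps1 v) k * ?a ^ m + ?a ^ k * fps_nth (path_fps1 v) m))"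
    have "real (card A) * ?E A (path_poly1 v) = (\<Sum>x\<in>A.
      let L = {a \<in> A. a < x}; R = {a \<in> A. x < a} in
      (?a ^ card A - 1) + (?E L (\<lambda>t. ?a * path_poly1 v t * ?a ^ card R) + ?E R (\<lambda>t. ?a * ?a ^ card L * path_poly1 v t))
      + 0 * (?E L (\<lambda>t. 0) * ?E R (\<lambda>t. 0)))"
      by (rule expectation_random_bst_on_split[OF less.prems False], subst path_poly1_Node)
         (auto simp: algebra_simps)
    also have "\<dots> = (\<Sum>x\<in>A. F (card {a \<in> A. a < x}) (card {a \<in> A. x < a}))"
    proof (intro sum.cong refl)
      fix x assume x: "x \<in> A"
      define L R where "L = {a \<in> A. a < x}" and "R = {a \<in> A. x < a}"
      have IH: "?E L (path_poly1 v) = fps_nth (path_fps1 v) (card L)" "?E R (path_poly1 v) = fps_nth (path_fps1 v) (card R)"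
        using less.hyps[OF card_less_parts(1)[OF less.prems x]] less.hyps[OF card_less_parts(2)[OF less.prems x]] less.prems
        by (auto simp: L_def R_def)
      show "(let L = {a \<in> A. a < x}; R = {a \<in> A. x < a} in
      (?a ^ card A - 1) + (?E L (\<lambda>t. ?a * path_poly1 v t * ?a ^ card R) + ?E R (\<lambda>t. ?a * ?a ^ card L * path_poly1 v t))
      + 0 * (?E L (\<lambda>t. 0) * ?E R (\<lambda>t. 0))) = F (card {a \<in> A. a < x}) (card {a \<in> A. x < a})"
        unfolding Let_def L_def[symmetric] R_def[symmetric] F_def
        by (simp only: integral_mult_right_zero integral_mult_left_zero IH) (simp add: algebra_simps)
    qed
    also have "\<dots> = (\<Sum>k<card A. F k (card A - 1 - k))"
      by (rule sum_card_less[OF less.prems])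
    also have "\<dots> = real (card A) * fps_nth (path_fps1 v) (card A)"
      unfolding F_def by (rule path_fps1_rec[symmetric]) (use less.prems False in \<open>auto simp: card_gt_0_iff\<close>)
    finally show ?thesis using less.prems False by simp
  qed
qed

lemma expectation_path_poly2:
  "finite A \<Longrightarrow> measure_pmf.expectation (random_bst_on A) (path_poly2 v) = fps_nth (path_fps2 v) (card A)"
proof (induction "card A" arbitrary: A rule: less_induct)
  case less
  let ?a = "1 + v" and ?E = "\<lambda>A. measure_pmf.expectation (random_bst_on A)"
  show ?case
  proof (cases "A = {}")
    case True
    then show ?thesis by (simp add: path_poly2_def path_fps2_def Let_def power2_eq_square numeral_fps_const)
  next
    case False
    define F where "F = (\<lambda>k m. ?a * (
      (fps_nth (path_fps2 v) k + 2 * fps_nth (path_fps1 v) k) * ?a ^ m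
      + ?a ^ k * (fps_nth (path_fps2 v) m + 2 * fps_nth (path_fps1 v) m)
      + 2 * (fps_nth (path_fps1 v) k * fps_nth (path_fps1 v) m)))"
    have "real (card A) * ?E A (path_poly2 v) = (\<Sum>x\<in>A.
      let L = {a \<in> A. a < x}; R = {a \<in> A. x < a} in
      0 + (?E L (\<lambda>t. ?a * (path_poly2 v t + 2 * path_poly1 v t) * ?a ^ card R)
         + ?E R (\<lambda>t. ?a * ?a ^ card L * (path_poly2 v t + 2 * path_poly1 v t)))
      + (2 * ?a) * (?E L (path_poly1 v) * ?E R (path_poly1 v)))"
      by (rule expectation_random_bst_on_split[OF less.prems False], subst path_poly2_Node)
         (auto simp: algebra_simps)
    also have "\<dots> = (\<Sum>x\<in>A. F (card {a \<in> A. a < x}) (card {a \<in> A. x < a}))"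
    proof (intro sum.cong refl)
      fix x assume x: "x \<in> A"
      define L R where "L = {a \<in> A. a < x}" and "R = {a \<in> A. x < a}"
      have fin: "finite L" "finite R" using less.prems by (auto simp: L_def R_def)
      have IH: "?E L (path_poly2 v) = fps_nth (path_fps2 v) (card L)" "?E R (path_poly2 v) = fps_nth (path_fps2 v) (card R)"
        using less.hyps[OF card_less_parts(1)[OF less.prems x]] less.hyps[OF card_less_parts(2)[OF less.prems x]] less.prems
        by (auto simp: L_def R_def)
      have lin: "?E B (\<lambda>t. path_poly2 v t + 2 * path_poly1 v t) = ?E B (path_poly2 v) + 2 * ?E B (path_poly1 v)"
        if "finite B" for B
        using that by (simp add: integrable_measure_pmf_finite)
      show "(let L = {a \<in> A. a < x}; R = {a \<in> A. x < a} in
      0 + (?E L (\<lambda>t. ?a * (path_poly2 v t + 2 * path_poly1 v t) * ?a ^ card R)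
         + ?E R (\<lambda>t. ?a * ?a ^ card L * (path_poly2 v t + 2 * path_poly1 v t)))
      + (2 * ?a) * (?E L (path_poly1 v) * ?E R (path_poly1 v))) = F (card {a \<in> A. a < x}) (card {a \<in> A. x < a})"
        unfolding Let_def L_def[symmetric] R_def[symmetric] F_def
        by (simp only: integral_mult_right_zero integral_mult_left_zero lin[OF fin(1)] lin[OF fin(2)] IH
            expectation_path_poly1[OF fin(1)] expectation_path_poly1[OF fin(2)]) (simp add: algebra_simps)
    qed
    also have "\<dots> = (\<Sum>k<card A. F k (card A - 1 - k))"
      by (rule sum_card_less[OF less.prems])
    also have "\<dots> = real (card A) * fps_nth (path_fps2 v) (card A)"
      unfolding F_def by (rule path_fps2_rec[symmetric]) (use less.prems False in \<open>auto simp: card_gt_0_iff\<close>)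
    finally show ?thesis using less.prems False by simp
  qed
qed

text \<open>
  Functionals in the manner of Quicksort: each subtree contributes its own value plus a toll \<open>h\<close>. The
  expectation depends on the number of keys only and is determined by the recurrence \<open>c\<close>.
\<close>

lemma expectation_additive_functional:
  fixes f h :: "nat Tree.tree \<Rightarrow> real" and c w :: "nat \<Rightarrow> real"
  assumes Node: "\<And>l x r. distinct (inorder \<langle>l, x, r\<rangle>) \<Longrightarrow> f \<langle>l, x, r\<rangle> = (f l + h l) + (f r + h r)"
    and Leaf: "f \<langle>\<rangle> = c 0"
    and h: "\<And>B. finite B \<Longrightarrow> measure_pmf.expectation (random_bst_on B) h = w (card B)"
    and c: "\<And>n. n > 0 \<Longrightarrow> real n * c n = 2 * (\<Sum>k<n. c k + w k)"
  shows "finite A \<Longrightarrow> measure_pmf.expectation (random_bst_on A) f = c (card A)"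
proof (induction "card A" arbitrary: A rule: less_induct)
  case less
  let ?E = "\<lambda>A. measure_pmf.expectation (random_bst_on A)"
  show ?case
  proof (cases "A = {}")
    case True
    then show ?thesis by (simp add: Leaf)
  next
    case False
    have "real (card A) * ?E A f = (\<Sum>x\<in>A.
      let L = {a \<in> A. a < x}; R = {a \<in> A. x < a} in
      0 + (?E L (\<lambda>t. f t + h t) + ?E R (\<lambda>t. f t + h t)) + 0 * (?E L (\<lambda>t. 0) * ?E R (\<lambda>t. 0)))"
      by (rule expectation_random_bst_on_split[OF less.prems False]) (auto simp: Node)
    also have "\<dots> = (\<Sum>x\<in>A. (c (card {a \<in> A. a < x}) + w (card {a \<in> A. a < x}))
        + (c (card {a \<in> A. x < a}) + w (card {a \<in> A. x < a})))"
      using less.prems less.hyps[OF card_less_parts(1)] less.hyps[OF card_less_parts(2)]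
      by (intro sum.cong refl) (simp add: Let_def integrable_measure_pmf_finite h)
    also have "\<dots> = (\<Sum>k<card A. (c k + w k) + (c (card A - 1 - k) + w (card A - 1 - k)))"
      by (rule sum_card_less[OF less.prems, of "\<lambda>k m. (c k + w k) + (c m + w m)"])
    also have "\<dots> = (\<Sum>k<card A. c k + w k) + (\<Sum>k<card A. c (card A - 1 - k) + w (card A - 1 - k))"
      by (rule sum.distrib)
    also have "(\<Sum>k<card A. c (card A - 1 - k) + w (card A - 1 - k)) = (\<Sum>k<card A. c k + w k)"
      using sum.nat_diff_reindex[of "\<lambda>k. c k + w k" "card A"] by simp
    also have "(\<Sum>k<card A. c k + w k) + (\<Sum>k<card A. c k + w k) = real (card A) * c (card A)"
      using c[of "card A"] less.prems False by (simp add: card_gt_0_iff)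
    finally show ?thesis using less.prems False by simp
  qed
qed

section \<open>Extraction of coefficients\<close>

text \<open>
  The coefficient of \<open>z ^ (N - k)\<close> in \<open>ln (1 / (1 - z)) / (1 - z) ^ (k + 1)\<close>, see
  \<open>fps_nth_geo1_power_log\<close>. The Pascal rule of the binomial coefficients carries over.
\<close>

definition binom_harm :: "nat \<Rightarrow> nat \<Rightarrow> real" where
  "binom_harm N k = real (N choose k) * (harm N - harm k)"

text \<open>
  Likewise the coefficient of \<open>z ^ (N - k)\<close> in \<open>(ln (1 / (1 - z)))\<^sup>2 / (1 - z) ^ (k + 1)\<close>.
\<close>

definition binom_harm2 :: "nat \<Rightarrow> nat \<Rightarrow> real" where
  "binom_harm2 N k = real (N choose k) * ((harm N - harm k)^2 - (harm2 N - harm2 k))"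

lemma harm2_Suc: "harm2 (Suc n) = harm2 n + 1 / (real n + 1)^2"
  by (simp add: harm2_def add.commute)

lemma harm_Suc_real: "harm (Suc n) = harm n + 1 / (real n + 1)"
  by (simp add: harm_Suc divide_inverse add.commute)

lemma binomial_absorb_real: "(real k + 1) * real (Suc N choose Suc k) = (real N + 1) * real (N choose k)"
  using Suc_times_binomial[of k N] by (metis of_nat_Suc of_nat_mult add.commute)

lemma binom_harm_Pascal: "binom_harm (Suc N) (Suc k) = binom_harm N (Suc k) + binom_harm N k"
proof -
  define P Q h where "P = real (N choose Suc k)" "Q = real (N choose k)" "h = (harm N - harm (Suc k) :: real)"
  have PQ: "(P + Q) / (real N + 1) = Q / (real k + 1)"
    using binomial_absorb_real[of k N] by (simp add: P_Q_h_def field_simps)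
  have "binom_harm (Suc N) (Suc k) = (P + Q) * (h + 1 / (real N + 1))"
    by (simp add: binom_harm_def P_Q_h_def harm_Suc_real[of N] algebra_simps)
  also have "\<dots> = (P + Q) * h + Q / (real k + 1)" using PQ by (simp add: distrib_left)
  also have "\<dots> = P * h + Q * (h + 1 / (real k + 1))" by (simp add: algebra_simps)
  also have "\<dots> = binom_harm N (Suc k) + binom_harm N k"
    by (simp add: binom_harm_def P_Q_h_def harm_Suc_real)
  finally show ?thesis .
qed

lemma binom_harm2_Pascal: "binom_harm2 (Suc N) (Suc k) = binom_harm2 N (Suc k) + binom_harm2 N k"
proof -
  define P Q where "P = real (N choose Suc k)" "Q = real (N choose k)"
  define h e where "h = (harm N - harm (Suc k) :: real)" "e = harm2 N - harm2 (Suc k)"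
  define a b where "a = 1 / (real N + 1)" "b = 1 / (real k + 1)"
  have PQ: "(P + Q) * a = Q * b"
    using binomial_absorb_real[of k N] by (simp add: P_Q_def a_b_def field_simps)
  have "binom_harm2 (Suc N) (Suc k) = (P + Q) * ((h + a)^2 - (e + a^2))"
  proof -
    have "harm (Suc N) - harm (Suc k) = h + a" "harm2 (Suc N) - harm2 (Suc k) = e + a^2"
      "real (Suc N choose Suc k) = P + Q"
      by (simp_all add: P_Q_def h_e_def a_b_def harm_Suc_real[of N] harm2_Suc[of N] power_one_over)
    then show ?thesis by (simp add: binom_harm2_def)
  qed
  also have "\<dots> = (P + Q) * (h^2 - e) + 2 * h * ((P + Q) * a)"
    by (simp add: power2_eq_square algebra_simps)
  also have "\<dots> = P * (h^2 - e) + Q * ((h + b)^2 - (e + b^2))"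
    unfolding PQ by (simp add: power2_eq_square algebra_simps)
  also have "\<dots> = binom_harm2 N (Suc k) + binom_harm2 N k"
    by (simp add: binom_harm2_def P_Q_def h_e_def a_b_def harm_Suc_real harm2_Suc power_one_over)
  finally show ?thesis .
qed

lemma fps_nth_geo1_mult_Suc:
  "fps_nth (fps_geo 1 * f) (Suc n) = fps_nth f (Suc n) + fps_nth (fps_geo 1 * f) n"
proof -
  have "fps_geo 1 = 1 + fps_X * fps_geo 1" using fps_geo_eq[of 1] by simp
  then have "fps_geo 1 * f = f + fps_X * (fps_geo 1 * f)" by algebra
  then have "fps_nth (fps_geo 1 * f) (Suc n) = fps_nth (f + fps_X * (fps_geo 1 * f)) (Suc n)" by metis
  then show ?thesis by simp
qed

text \<open>
  Multiplication with \<open>1 / (1 - z)\<close> forms partial sums of coefficients, so any array \<open>F\<close> that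
  satisfies the Pascal rule and has the right boundary values lists the coefficients.
\<close>

lemma fps_nth_geo1_power_mult:
  assumes "\<And>n. fps_nth (fps_geo 1 * f) n = F n 0" "\<And>m. fps_nth f 0 = F 0 m"
    and "\<And>n m. F (Suc n) (Suc m) = F n (Suc m) + F (Suc n) m"
  shows "fps_nth (fps_geo 1 ^ Suc m * f) n = F n m"
proof (induction m arbitrary: n)
  case 0
  then show ?case using assms(1) by simp
next
  case (Suc m)
  note outer = Suc.IH
  show ?case
  proof (induction n)
    case 0
    then show ?case using assms(2) by (simp add: fps_power_zeroth)
  next
    case (Suc n)
    have "fps_geo 1 ^ Suc (Suc m) * f = fps_geo 1 * (fps_geo 1 ^ Suc m * f)" by (simp add: mult.assoc)
    then show ?case
      using fps_nth_geo1_mult_Suc[of "fps_geo 1 ^ Suc m * f" n] Suc outer[of "Suc n"] assms(3)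
      by (simp add: mult.assoc)
  qed
qed

lemma fps_nth_geo1_power: "fps_nth (fps_geo 1 ^ Suc m) n = real (n + m choose m)"
proof -
  have "fps_nth (fps_geo 1 ^ Suc m * 1) n = real (n + m choose m)"
    by (rule fps_nth_geo1_power_mult[where F = "\<lambda>n m. real (n + m choose m)"]) auto
  then show ?thesis by simp
qed

lemma fps_nth_geo1_log: "fps_nth (fps_geo 1 * fps_log) n = harm n"
proof (induction n)
  case (Suc n)
  then show ?case unfolding fps_nth_geo1_mult_Suc by (simp add: harm_Suc_real)
qed (simp add: harm_def)

lemma fps_nth_geo1_power_log: "fps_nth (fps_geo 1 ^ Suc m * fps_log) n = binom_harm (n + m) m"
proof (rule fps_nth_geo1_power_mult)
  show "fps_nth (fps_geo 1 * fps_log) n = binom_harm (n + 0) 0" for n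
    by (simp only: fps_nth_geo1_log) (simp add: binom_harm_def harm_def)
  show "binom_harm (Suc n + Suc m) (Suc m) = binom_harm (n + Suc m) (Suc m) + binom_harm (Suc n + m) m" for n m
    using binom_harm_Pascal[of "n + Suc m" m] by simp
qed (simp add: binom_harm_def)

lemma fps_nth_log_square_Suc: "fps_nth (fps_log ^ 2) (Suc n) = 2 * harm n / (real n + 1)"
proof -
  have "(real n + 1) * fps_nth (fps_log ^ 2) (Suc n) = fps_nth (fps_deriv (fps_log ^ 2)) n"
    by (simp add: add.commute)
  also have "fps_deriv (fps_log ^ 2) = 2 * (fps_geo 1 * fps_log)"
    by (simp add: power2_eq_square fps_deriv_log algebra_simps)
  also have "fps_nth \<dots> n = 2 * harm n"
    by (simp add: numeral_fps_const fps_nth_geo1_log)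
  finally show ?thesis by (simp add: field_simps)
qed

lemma fps_nth_geo1_log_square: "fps_nth (fps_geo 1 * fps_log ^ 2) n = harm n ^ 2 - harm2 n"
proof (induction n)
  case (Suc n)
  have "(1 / (real n + 1))\<^sup>2 = 1 / (real n + 1)\<^sup>2" by (rule power_one_over)
  then show ?case unfolding fps_nth_geo1_mult_Suc fps_nth_log_square_Suc Suc
    by (simp add: harm_Suc_real harm2_Suc power2_sum)
qed (simp add: harm_def harm2_def power2_eq_square)

lemma fps_nth_geo1_power_log_square: "fps_nth (fps_geo 1 ^ Suc m * fps_log ^ 2) n = binom_harm2 (n + m) m"
proof (rule fps_nth_geo1_power_mult)
  show "fps_nth (fps_geo 1 * fps_log ^ 2) n = binom_harm2 (n + 0) 0" for n
    by (simp only: fps_nth_geo1_log_square) (simp add: binom_harm2_def harm_def harm2_def)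
  show "binom_harm2 (Suc n + Suc m) (Suc m) = binom_harm2 (n + Suc m) (Suc m) + binom_harm2 (Suc n + m) m" for n m
    using binom_harm2_Pascal[of "n + Suc m" m] by simp
qed (simp add: binom_harm2_def power2_eq_square)

lemma fps_geo_power_expand:
  "fps_geo (1 + v) ^ Suc k * f =
    fps_geo (1 + v) ^ k * (fps_geo 1 * f) + fps_const v * (fps_X * (fps_geo (1 + v) ^ Suc k * (fps_geo 1 * f)))"
proof -
  define V U S where "V = fps_const v" "U = fps_geo (1 + v)" "S = fps_geo (1::real)"
  have "U = 1 + (1 + V) * fps_X * U" unfolding V_U_S_def using fps_geo_eq[of "1 + v"] by (simp flip: fps_const_add)
  moreover have "S = 1 + fps_X * S" unfolding V_U_S_def using fps_geo_eq[of 1] by simp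
  ultimately have U: "U = S + V * fps_X * (S * U)" by algebra
  have "U ^ Suc k * f = U ^ k * (U * f)" by (simp add: algebra_simps)
  also have "\<dots> = U ^ k * ((S + V * fps_X * (S * U)) * f)" using U by metis
  also have "\<dots> = U ^ k * (S * f) + V * (fps_X * (U ^ Suc k * (S * f)))" by (simp add: algebra_simps)
  finally show ?thesis by (simp add: V_U_S_def)
qed

text \<open>
  The expansion in powers of \<open>v\<close> uses
  \<open>1 / (1 - (1 + v) * z) ^ (k + 1) = (\<Sum>j. (j + k choose k) * (v * z) ^ j / (1 - z) ^ (j + k + 1))\<close>.
\<close>

lemma fps_nth_geo_power_mult:
  "fps_nth (fps_geo (1 + v) ^ Suc k * f) n =
    (\<Sum>j\<le>n. v ^ j * (real (j + k choose k) * fps_nth (fps_geo 1 ^ Suc (j + k) * f) (n - j)))"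
proof (induction k arbitrary: n f)
  case 0
  show ?case
  proof (induction n arbitrary: f)
    case 0
    show ?case by (simp add: fps_geo_power_expand[of v 0 f, simplified])
  next
    case (Suc n)
    have "fps_nth (fps_geo (1 + v) ^ Suc 0 * f) (Suc n) = fps_nth (fps_geo 1 * f) (Suc n)
        + v * fps_nth (fps_geo (1 + v) ^ Suc 0 * (fps_geo 1 * f)) n"
      by (subst fps_geo_power_expand) simp
    then show ?case unfolding Suc sum.atMost_Suc_shift
      by (simp add: sum_distrib_left mult.assoc mult.commute mult.left_commute)
  qed
next
  case (Suc k)
  note outer = Suc.IH
  show ?case
  proof (induction n arbitrary: f)
    case 0
    have "fps_nth (fps_geo (1 + v) ^ Suc (Suc k) * f) 0 = fps_nth (fps_geo (1 + v) ^ Suc k * (fps_geo 1 * f)) 0"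
      by (subst fps_geo_power_expand) simp
    then show ?case by (simp add: fps_power_zeroth)
  next
    case (Suc n)
    let ?T = "\<lambda>j. fps_nth (fps_geo 1 ^ Suc (j + Suc k) * f) (Suc n - j)"
    have "fps_nth (fps_geo (1 + v) ^ Suc (Suc k) * f) (Suc n) =
        fps_nth (fps_geo (1 + v) ^ Suc k * (fps_geo 1 * f)) (Suc n)
        + v * fps_nth (fps_geo (1 + v) ^ Suc (Suc k) * (fps_geo 1 * f)) n"
      by (subst fps_geo_power_expand) simp
    also have "\<dots> = (\<Sum>j\<le>Suc n. v ^ j * (real (j + k choose k) * ?T j))
        + v * (\<Sum>j\<le>n. v ^ j * (real (j + Suc k choose Suc k) * ?T (Suc j)))"
      unfolding Suc outer by (simp add: mult.assoc mult.commute mult.left_commute)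
    also have "\<dots> = (\<Sum>j\<le>Suc n. v ^ j * (real (j + Suc k choose Suc k) * ?T j))"
      unfolding sum.atMost_Suc_shift
      by (simp add: sum_distrib_left sum.distrib[symmetric] algebra_simps)
    finally show ?case .
  qed
qed


text \<open>
  Once the generating functions are sorted by powers of \<open>v\<close>, all their numerators are of this form.
\<close>

definition fps_comb :: "real \<Rightarrow> real \<Rightarrow> real \<Rightarrow> real \<Rightarrow> real \<Rightarrow> real fps" where
  "fps_comb a b c d e = fps_const a * fps_log ^ 2 + fps_const b * fps_log + fps_const c
     + fps_const d * fps_X + fps_const e * fps_geo 1"

definition comb_coeff :: "real \<Rightarrow> real \<Rightarrow> real \<Rightarrow> real \<Rightarrow> real \<Rightarrow> nat \<Rightarrow> nat \<Rightarrow> real" where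
  "comb_coeff a b c d e n m = a * binom_harm2 (n + m) m + b * binom_harm (n + m) m + c * real (n + m choose m)
     + d * (if n = 0 then 0 else real (n - 1 + m choose m)) + e * real (Suc (n + m) choose Suc m)"

lemma fps_nth_geo1_power_comb:
  "fps_nth (fps_geo 1 ^ Suc m * fps_comb a b c d e) n = comb_coeff a b c d e n m"
proof -
  let ?S = "fps_geo 1 ^ Suc m"
  have "?S * fps_comb a b c d e = fps_const a * (?S * fps_log ^ 2) + fps_const b * (?S * fps_log)
      + fps_const c * ?S + fps_const d * (fps_X * ?S) + fps_const e * fps_geo 1 ^ Suc (Suc m)"
    unfolding fps_comb_def by (simp only: power_Suc distrib_left mult_ac)
  then show ?thesis
    by (simp only: fps_add_nth fps_mult_left_const_nth fps_X_mult_nth fps_nth_geo1_power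
        fps_nth_geo1_power_log fps_nth_geo1_power_log_square) (simp add: comb_coeff_def)
qed

definition shift_coeff :: "nat \<Rightarrow> nat \<Rightarrow> (nat \<Rightarrow> nat \<Rightarrow> real) \<Rightarrow> nat \<Rightarrow> nat \<Rightarrow> real" where
  "shift_coeff i k c n p = (if i \<le> p \<and> p \<le> n + i
     then real (p - i + k choose k) * c (n + i - p) (p - i + k) else 0)"

lemma fps_nth_shifted_comb:
  assumes "i \<le> d"
  shows "fps_nth (fps_const (v ^ i) * (fps_geo (1 + v) ^ Suc k * fps_comb a b c e f)) n =
    (\<Sum>p\<le>n + d. shift_coeff i k (comb_coeff a b c e f) n p * v ^ p)"
proof -
  let ?c = "shift_coeff i k (comb_coeff a b c e f) n"
  have "(\<Sum>p\<le>n + d. ?c p * v ^ p) = (\<Sum>p\<in>{i..n + i}. ?c p * v ^ p)"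
    by (rule sum.mono_neutral_right) (use assms in \<open>auto simp: shift_coeff_def\<close>)
  also have "\<dots> = (\<Sum>j\<in>{0..n}. ?c (j + i) * v ^ (j + i))"
    using sum.shift_bounds_cl_nat_ivl[of "\<lambda>p. ?c p * v ^ p" 0 i n] by simp
  also have "\<dots> = v ^ i * (\<Sum>j\<le>n. v ^ j * (real (j + k choose k) * comb_coeff a b c e f (n - j) (j + k)))"
    unfolding sum_distrib_left atLeast0AtMost
    by (intro sum.cong) (auto simp: shift_coeff_def power_add)
  also have "\<dots> = fps_nth (fps_const (v ^ i) * (fps_geo (1 + v) ^ Suc k * fps_comb a b c e f)) n"
    by (simp only: fps_mult_left_const_nth fps_nth_geo_power_mult fps_nth_geo1_power_comb)
  finally show ?thesis ..
qed

text \<open>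
  The right-hand side may formally have a larger degree: multiplication of a truncated expansion
  with a power of \<open>v\<close> produces terms beyond degree \<open>n\<close>.
\<close>

lemma poly_coeff_unique:
  fixes c d :: "nat \<Rightarrow> real"
  assumes "\<And>v. (\<Sum>p\<le>n. c p * v ^ p) = (\<Sum>p\<le>n + k. d p * v ^ p)" "p \<le> n"
  shows "c p = d p"
proof -
  have "(\<Sum>p\<le>n + k. (if p \<le> n then c p else 0) * v ^ p) = (\<Sum>p\<le>n + k. d p * v ^ p)" for v
  proof -
    have "(\<Sum>p\<le>n + k. (if p \<le> n then c p else 0) * v ^ p) = (\<Sum>p\<le>n. (if p \<le> n then c p else 0) * v ^ p)"
      by (rule sum.mono_neutral_right) auto
    also have "\<dots> = (\<Sum>p\<le>n. c p * v ^ p)" by simp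
    finally show ?thesis using assms(1) by simp
  qed
  then have "\<forall>p\<le>n + k. (if p \<le> n then c p else 0) = d p"
    using polyfun_eq_coeffs[where c = "\<lambda>p. if p \<le> n then c p else 0" and n = "n + k" and d = d] by simp
  then show ?thesis using assms(2) by (metis trans_le_add1)
qed

lemma path_fps1_expand: "path_fps1 v =
    fps_const (v ^ 1) * (fps_geo (1 + v) ^ Suc 1 * fps_comb 0 2 0 (-1) 0)
  + fps_const (v ^ 2) * (fps_geo (1 + v) ^ Suc 1 * fps_comb 0 2 1 (-1) (-1))"
proof -
  define V U S L where "V = fps_const v" "U = fps_geo (1 + v)" "S = fps_geo (1::real)" "L = fps_log"
  have c: "fps_const (v ^ i) = V ^ i" for i by (simp add: V_U_S_L_def fps_const_power)
  have A: "fps_const (1 + v) = 1 + V" by (simp add: V_U_S_L_def flip: fps_const_add)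
  have k: "fps_comb 0 2 0 (-1) 0 = 2 * L - fps_X" "fps_comb 0 2 1 (-1) (-1) = 2 * L + 1 - fps_X - S"
    by (simp_all add: fps_comb_def V_U_S_L_def numeral_fps_const flip: fps_const_neg)
  show ?thesis
    unfolding path_fps1_def c A k V_U_S_L_def[symmetric]
    by (simp add: power2_eq_square algebra_simps)
qed

text \<open>
  The generating function is sorted by explicit powers of \<open>v\<close>, after replacing \<open>a\<close> by \<open>1 + v\<close>, so
  that the coefficient of \<open>v ^ p\<close> can be read off from each summand.
\<close>

lemma path_fps2_expand: "path_fps2 v =
    fps_const (v ^ 1) * (fps_geo (1 + v) ^ Suc 1 * fps_comb 4 (-4) 0 4 0)
  + fps_const (v ^ 2) * (fps_geo (1 + v) ^ Suc 2 * fps_comb 8 (-16) 8 0 0)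
  + fps_const (v ^ 2) * (fps_geo (1 + v) ^ Suc 1 * fps_comb 8 0 (-10) 6 2)
  + fps_const (v ^ 3) * (fps_geo (1 + v) ^ Suc 2 * fps_comb 16 (-16) 0 0 0)
  + fps_const (v ^ 3) * (fps_geo (1 + v) ^ Suc 1 * fps_comb 4 4 (-2) 2 2)
  + fps_const (v ^ 4) * (fps_geo (1 + v) ^ Suc 2 * fps_comb 8 0 0 0 0)"
proof -
  define V U S L where "V = fps_const v" "U = fps_geo (1 + v)" "S = fps_geo (1::real)" "L = fps_log"
  have c: "fps_const (v ^ i) = V ^ i" for i by (simp add: V_U_S_L_def fps_const_power)
  have A: "fps_const (1 + v) = 1 + V" by (simp add: V_U_S_L_def flip: fps_const_add)
  have k: "fps_comb 4 (-4) 0 4 0 = 4 * L^2 - 4 * L + 4 * fps_X"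
    "fps_comb 8 (-16) 8 0 0 = 8 * L^2 - 16 * L + 8"
    "fps_comb 8 0 (-10) 6 2 = 8 * L^2 - 10 + 6 * fps_X + 2 * S"
    "fps_comb 16 (-16) 0 0 0 = 16 * L^2 - 16 * L"
    "fps_comb 4 4 (-2) 2 2 = 4 * L^2 + 4 * L - 2 + 2 * fps_X + 2 * S"
    "fps_comb 8 0 0 0 0 = 8 * L^2"
    by (simp_all add: fps_comb_def V_U_S_L_def numeral_fps_const flip: fps_const_neg)
  have pw: "U ^ Suc 1 = U * U" "U ^ Suc 2 = U * U * U" "V ^ 1 = V" by (simp_all add: numeral_eq_Suc)
  show ?thesis
    unfolding path_fps2_def c A k Let_def V_U_S_L_def[symmetric] pw by algebra
qed

lemma path_fps1_coeff:
  assumes G: "\<And>v. (\<Sum>p\<le>n. G p * v ^ p) = fps_nth (path_fps1 v) n" and p: "2 \<le> p" "p \<le> n"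
  shows "G p = real p * (2 * binom_harm (n + 1) p - real (n choose p))
    + (real p - 1) * (2 * binom_harm (n + 1) (p - 1) - real (n choose (p - 1))
        - real (n + 2 choose p) + real (n + 1 choose (p - 1)))"
proof -
  have "G p = shift_coeff 1 1 (comb_coeff 0 2 0 (-1) 0) n p + shift_coeff 2 1 (comb_coeff 0 2 1 (-1) (-1)) n p"
    using p(2)
  proof (rule poly_coeff_unique[rotated])
    fix v
    show "(\<Sum>p\<le>n. G p * v ^ p) = (\<Sum>p\<le>n + 2. (shift_coeff 1 1 (comb_coeff 0 2 0 (-1) 0) n p
        + shift_coeff 2 1 (comb_coeff 0 2 1 (-1) (-1)) n p) * v ^ p)"
      unfolding G path_fps1_expand distrib_right sum.distrib fps_add_nth
      by (intro arg_cong2[of _ _ _ _ "(+)"] fps_nth_shifted_comb) auto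
  qed
  moreover obtain q r where "p = Suc (Suc q)" "n = Suc (Suc q) + r"
    using p by (metis le_Suc_ex numeral_2_eq_2 plus_nat.simps(2) add_0)
  ultimately show ?thesis
    by (simp add: shift_coeff_def comb_coeff_def algebra_simps numeral_eq_Suc del: binomial_Suc_Suc)
qed

text \<open>
  For \<open>p = 2\<close> and \<open>p = 3\<close> some of the summands are absent in the expansion. The formula still holds,
  because their factors \<open>real p - 2\<close>, \<open>p - 1 choose 2\<close> and \<open>p - 2 choose 2\<close> vanish there.
\<close>

lemma path_fps2_coeff:
  assumes G: "\<And>v. (\<Sum>p\<le>n. G p * v ^ p) = fps_nth (path_fps2 v) n" and p: "2 \<le> p" "p \<le> n"
  shows "G p =
    real p * (4 * binom_harm2 (n + 1) p - 4 * binom_harm (n + 1) p + 4 * real (n choose p))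
    + real (p choose 2) * (8 * binom_harm2 (n + 2) p - 16 * binom_harm (n + 2) p + 8 * real (n + 2 choose p))
    + (real p - 1) * (8 * binom_harm2 (n + 1) (p - 1) - 10 * real (n + 1 choose (p - 1))
        + 6 * real (n choose (p - 1)) + 2 * real (n + 2 choose p))
    + real (p - 1 choose 2) * (16 * binom_harm2 (n + 2) (p - 1) - 16 * binom_harm (n + 2) (p - 1))
    + (real p - 2) * (4 * binom_harm2 (n + 1) (p - 2) + 4 * binom_harm (n + 1) (p - 2) - 2 * real (n + 1 choose (p - 2))
        + 2 * real (n choose (p - 2)) + 2 * real (n + 2 choose (p - 1)))
    + real (p - 2 choose 2) * (8 * binom_harm2 (n + 2) (p - 2))"
proof -
  have eq: "G p = shift_coeff 1 1 (comb_coeff 4 (-4) 0 4 0) n p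
      + shift_coeff 2 2 (comb_coeff 8 (-16) 8 0 0) n p + shift_coeff 2 1 (comb_coeff 8 0 (-10) 6 2) n p
      + shift_coeff 3 2 (comb_coeff 16 (-16) 0 0 0) n p + shift_coeff 3 1 (comb_coeff 4 4 (-2) 2 2) n p
      + shift_coeff 4 2 (comb_coeff 8 0 0 0 0) n p"
    using p(2)
  proof (rule poly_coeff_unique[rotated])
    fix v
    show "(\<Sum>p\<le>n. G p * v ^ p) = (\<Sum>p\<le>n + 4. (shift_coeff 1 1 (comb_coeff 4 (-4) 0 4 0) n p
      + shift_coeff 2 2 (comb_coeff 8 (-16) 8 0 0) n p + shift_coeff 2 1 (comb_coeff 8 0 (-10) 6 2) n p
      + shift_coeff 3 2 (comb_coeff 16 (-16) 0 0 0) n p + shift_coeff 3 1 (comb_coeff 4 4 (-2) 2 2) n p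
      + shift_coeff 4 2 (comb_coeff 8 0 0 0 0) n p) * v ^ p)"
      unfolding G path_fps2_expand distrib_right sum.distrib fps_add_nth
      by (intro arg_cong2[of _ _ _ _ "(+)"] fps_nth_shifted_comb) auto
  qed
  obtain q r where qr: "p = Suc (Suc q)" "n = Suc (Suc q) + r"
    using p by (metis le_Suc_ex numeral_2_eq_2 plus_nat.simps(2) add_0)
  consider "q = 0" | "q = 1" | s where "q = Suc (Suc s)" by (metis One_nat_def not0_implies_Suc)
  then show ?thesis
    unfolding eq unfolding qr
    by cases (simp_all add: shift_coeff_def comb_coeff_def numeral_eq_Suc binomial_eq_0 algebra_simps
        del: binomial_Suc_Suc)
qed

section \<open>Closed forms for the moments of the root path count\<close>

text \<open>
  The following rules change one argument of \<open>choose\<close>, \<open>binom_harm\<close> or \<open>binom_harm2\<close> by one. They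
  express everything through the values at \<open>(n, p)\<close>, with rational coefficients.
\<close>

lemma binomial_raise_upper: "(real N + 1 - real k) * real (Suc N choose k) = (real N + 1) * real (N choose k)"
proof (cases "k \<le> Suc N")
  case True
  then show ?thesis using binomial_absorb_comp[of "Suc N" k]
    by (metis (no_types, lifting) of_nat_mult of_nat_diff diff_Suc_1 of_nat_Suc add.commute)
next
  case False
  then show ?thesis by (simp add: binomial_eq_0)
qed

lemma binomial_lower_lower: "(real N - real k) * real (N choose k) = (real k + 1) * real (N choose Suc k)"
  using binomial_absorb_real[of k N] by (simp add: algebra_simps)

lemma binom_harm_raise_upper:
  "(real N + 1 - real k) * binom_harm (Suc N) k = (real N + 1) * binom_harm N k + real (N choose k)"
proof -
  have "(real N + 1 - real k) * binom_harm (Suc N) k =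
      ((real N + 1 - real k) * real (Suc N choose k)) * (harm N - harm k + 1 / (real N + 1))"
  proof -
    have "harm (Suc N) - harm k = harm N - harm k + 1 / (real N + 1)" by (simp add: harm_Suc_real[of N])
    then show ?thesis by (simp only: binom_harm_def mult.assoc)
  qed
  also have "\<dots> = (real N + 1) * binom_harm N k + real (N choose k)"
    unfolding binomial_raise_upper binom_harm_def by (simp add: field_simps)
  finally show ?thesis .
qed

lemma binom_harm_lower_lower:
  "(real N - real k) * binom_harm N k = (real k + 1) * binom_harm N (Suc k) + real (N choose Suc k)"
proof -
  have "(real N - real k) * binom_harm N k =
      ((real N - real k) * real (N choose k)) * (harm N - harm (Suc k) + 1 / (real k + 1))"
    by (simp add: binom_harm_def harm_Suc_real algebra_simps)
  also have "\<dots> = (real k + 1) * binom_harm N (Suc k) + real (N choose Suc k)"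
    unfolding binomial_lower_lower binom_harm_def by (simp add: field_simps)
  finally show ?thesis .
qed

lemma binom_harm2_raise_upper:
  "(real N + 1 - real k) * binom_harm2 (Suc N) k = (real N + 1) * binom_harm2 N k + 2 * binom_harm N k"
proof -
  define h e a where "h = (harm N - harm k :: real)" "e = harm2 N - harm2 k" "a = 1 / (real N + 1)"
  have a: "(real N + 1) * a = 1" by (simp add: h_e_a_def)
  have s: "harm (Suc N) - harm k = h + a" "harm2 (Suc N) - harm2 k = e + a^2"
    by (simp_all add: h_e_a_def harm_Suc_real[of N] harm2_Suc[of N] power_one_over)
  have "(real N + 1 - real k) * binom_harm2 (Suc N) k =
      ((real N + 1 - real k) * real (Suc N choose k)) * ((h + a)^2 - (e + a^2))"
    by (simp only: binom_harm2_def s mult.assoc)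
  also have "\<dots> = real (N choose k) * ((real N + 1) * (h^2 - e) + 2 * h * ((real N + 1) * a))"
    unfolding binomial_raise_upper by (simp add: power2_eq_square algebra_simps)
  also have "\<dots> = (real N + 1) * binom_harm2 N k + 2 * binom_harm N k"
    unfolding a by (simp add: binom_harm2_def binom_harm_def h_e_a_def algebra_simps)
  finally show ?thesis .
qed

lemma binom_harm2_lower_lower:
  "(real N - real k) * binom_harm2 N k = (real k + 1) * binom_harm2 N (Suc k) + 2 * binom_harm N (Suc k)"
proof -
  define h e a where "h = (harm N - harm (Suc k) :: real)" "e = harm2 N - harm2 (Suc k)" "a = 1 / (real k + 1)"
  have a: "(real k + 1) * a = 1" by (simp add: h_e_a_def)
  have s: "harm N - harm k = h + a" "harm2 N - harm2 k = e + a^2"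
    by (simp_all add: h_e_a_def harm_Suc_real[of k] harm2_Suc[of k] power_one_over)
  have "(real N - real k) * binom_harm2 N k =
      ((real N - real k) * real (N choose k)) * ((h + a)^2 - (e + a^2))"
    by (simp only: binom_harm2_def s mult.assoc)
  also have "\<dots> = real (N choose Suc k) * ((real k + 1) * (h^2 - e) + 2 * h * ((real k + 1) * a))"
    unfolding binomial_lower_lower by (simp add: power2_eq_square algebra_simps)
  also have "\<dots> = (real k + 1) * binom_harm2 N (Suc k) + 2 * binom_harm N (Suc k)"
    unfolding a by (simp add: binom_harm2_def binom_harm_def h_e_a_def algebra_simps)
  finally show ?thesis .
qed

lemma choose_two_real: "real (m choose 2) = real m * (real m - 1) / 2"
  by (induction m) (simp_all add: numeral_2_eq_2 field_simps)

text \<open>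
  For \<open>2 \<le> p \<le> n\<close>, by \<open>expectation_paths_sum1\<close> and \<open>expectation_paths_sum2\<close>, \<open>paths_total1 n p\<close> and
  \<open>paths_total2 n p\<close> are the expected sums of \<open>X\<close> and of \<open>X * (X - 1)\<close> over all sets of \<open>p\<close> nodes of a random search tree
  with \<open>n\<close> nodes.
\<close>

definition paths_total1 :: "nat \<Rightarrow> nat \<Rightarrow> real" where
  "paths_total1 n p = real p * (2 * binom_harm (n + 1) p - real (n choose p))
    + (real p - 1) * (2 * binom_harm (n + 1) (p - 1) - real (n choose (p - 1))
        - real (n + 2 choose p) + real (n + 1 choose (p - 1)))"

definition paths_total2 :: "nat \<Rightarrow> nat \<Rightarrow> real" where
  "paths_total2 n p =
    real p * (4 * binom_harm2 (n + 1) p - 4 * binom_harm (n + 1) p + 4 * real (n choose p))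
    + real (p choose 2) * (8 * binom_harm2 (n + 2) p - 16 * binom_harm (n + 2) p + 8 * real (n + 2 choose p))
    + (real p - 1) * (8 * binom_harm2 (n + 1) (p - 1) - 10 * real (n + 1 choose (p - 1))
        + 6 * real (n choose (p - 1)) + 2 * real (n + 2 choose p))
    + real (p - 1 choose 2) * (16 * binom_harm2 (n + 2) (p - 1) - 16 * binom_harm (n + 2) (p - 1))
    + (real p - 2) * (4 * binom_harm2 (n + 1) (p - 2) + 4 * binom_harm (n + 1) (p - 2) - 2 * real (n + 1 choose (p - 2))
        + 2 * real (n choose (p - 2)) + 2 * real (n + 2 choose (p - 1)))
    + real (p - 2 choose 2) * (8 * binom_harm2 (n + 2) (p - 2))"

lemma moment_reductions:
  fixes n p :: nat
  assumes "2 \<le> p" "p \<le> n"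
  defines "t \<equiv> real n - real p + 1" and "x \<equiv> real p" and "m \<equiv> real n"
  shows "t * real (n + 1 choose p) = (m + 1) * real (n choose p)"
    "t * binom_harm (n + 1) p = (m + 1) * binom_harm n p + real (n choose p)"
    "t * binom_harm2 (n + 1) p = (m + 1) * binom_harm2 n p + 2 * binom_harm n p"
    "(t + 1) * real (n + 2 choose p) = (m + 2) * real (n + 1 choose p)"
    "(t + 1) * binom_harm (n + 2) p = (m + 2) * binom_harm (n + 1) p + real (n + 1 choose p)"
    "(t + 1) * binom_harm2 (n + 2) p = (m + 2) * binom_harm2 (n + 1) p + 2 * binom_harm (n + 1) p"
    "t * real (n choose (p - 1)) = x * real (n choose p)"
    "(t + 1) * real (n + 1 choose (p - 1)) = x * real (n + 1 choose p)"
    "(t + 1) * binom_harm (n + 1) (p - 1) = x * binom_harm (n + 1) p + real (n + 1 choose p)"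
    "(t + 1) * binom_harm2 (n + 1) (p - 1) = x * binom_harm2 (n + 1) p + 2 * binom_harm (n + 1) p"
    "(t + 2) * real (n + 2 choose (p - 1)) = x * real (n + 2 choose p)"
    "(t + 2) * binom_harm (n + 2) (p - 1) = x * binom_harm (n + 2) p + real (n + 2 choose p)"
    "(t + 2) * binom_harm2 (n + 2) (p - 1) = x * binom_harm2 (n + 2) p + 2 * binom_harm (n + 2) p"
    "(t + 1) * real (n choose (p - 2)) = (x - 1) * real (n choose (p - 1))"
    "(t + 2) * real (n + 1 choose (p - 2)) = (x - 1) * real (n + 1 choose (p - 1))"
    "(t + 2) * binom_harm (n + 1) (p - 2) = (x - 1) * binom_harm (n + 1) (p - 1) + real (n + 1 choose (p - 1))"
    "(t + 2) * binom_harm2 (n + 1) (p - 2) = (x - 1) * binom_harm2 (n + 1) (p - 1) + 2 * binom_harm (n + 1) (p - 1)"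
    "(t + 3) * binom_harm2 (n + 2) (p - 2) = (x - 1) * binom_harm2 (n + 2) (p - 1) + 2 * binom_harm (n + 2) (p - 1)"
proof -
  have p: "Suc (p - 1) = p" "Suc (p - 2) = p - 1" "real (p - 1) = x - 1" "real (p - 2) = x - 2"
    using assms(1) by (auto simp: x_def)
  note R = binomial_raise_upper binom_harm_raise_upper binom_harm2_raise_upper
  note L = binomial_lower_lower binom_harm_lower_lower binom_harm2_lower_lower
  note R1 = R[of n p] and R2 = R[of "Suc n" p]
    and L0 = L[of n "p - 1", unfolded p] and L1 = L[of "Suc n" "p - 1", unfolded p]
    and L2 = L[of "Suc (Suc n)" "p - 1", unfolded p]
    and K0 = L[of n "p - 2", unfolded p] and K1 = L[of "Suc n" "p - 2", unfolded p]
    and K2 = L[of "Suc (Suc n)" "p - 2", unfolded p]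
  note eqs = R1 R2 L0 L1 L2 K0 K1 K2
  have c: "real n - real p + 1 = real n + 1 - real p" by simp
  show "t * real (n + 1 choose p) = (m + 1) * real (n choose p)"
    "t * binom_harm (n + 1) p = (m + 1) * binom_harm n p + real (n choose p)"
    "t * binom_harm2 (n + 1) p = (m + 1) * binom_harm2 n p + 2 * binom_harm n p"
    unfolding t_def m_def c using R1 by simp_all
  show "(t + 1) * real (n + 2 choose p) = (m + 2) * real (n + 1 choose p)"
    "(t + 1) * binom_harm (n + 2) p = (m + 2) * binom_harm (n + 1) p + real (n + 1 choose p)"
    "(t + 1) * binom_harm2 (n + 2) p = (m + 2) * binom_harm2 (n + 1) p + 2 * binom_harm (n + 1) p"
    unfolding t_def m_def using R2 by (simp_all add: algebra_simps del: binomial_Suc_Suc)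
  show "t * real (n choose (p - 1)) = x * real (n choose p)"
    unfolding t_def using L0 by (simp add: x_def algebra_simps)
  show "(t + 1) * real (n + 1 choose (p - 1)) = x * real (n + 1 choose p)"
    "(t + 1) * binom_harm (n + 1) (p - 1) = x * binom_harm (n + 1) p + real (n + 1 choose p)"
    "(t + 1) * binom_harm2 (n + 1) (p - 1) = x * binom_harm2 (n + 1) p + 2 * binom_harm (n + 1) p"
    unfolding t_def using L1 by (simp_all add: x_def algebra_simps)
  show "(t + 2) * real (n + 2 choose (p - 1)) = x * real (n + 2 choose p)"
    "(t + 2) * binom_harm (n + 2) (p - 1) = x * binom_harm (n + 2) p + real (n + 2 choose p)"
    "(t + 2) * binom_harm2 (n + 2) (p - 1) = x * binom_harm2 (n + 2) p + 2 * binom_harm (n + 2) p"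
    unfolding t_def using L2 by (simp_all add: x_def algebra_simps)
  show "(t + 1) * real (n choose (p - 2)) = (x - 1) * real (n choose (p - 1))"
    unfolding t_def using K0 by (simp add: x_def algebra_simps)
  show "(t + 2) * real (n + 1 choose (p - 2)) = (x - 1) * real (n + 1 choose (p - 1))"
    "(t + 2) * binom_harm (n + 1) (p - 2) = (x - 1) * binom_harm (n + 1) (p - 1) + real (n + 1 choose (p - 1))"
    "(t + 2) * binom_harm2 (n + 1) (p - 2) = (x - 1) * binom_harm2 (n + 1) (p - 1) + 2 * binom_harm (n + 1) (p - 1)"
    unfolding t_def using K1 by (simp_all add: x_def algebra_simps)
  show "(t + 3) * binom_harm2 (n + 2) (p - 2) = (x - 1) * binom_harm2 (n + 2) (p - 1) + 2 * binom_harm (n + 2) (p - 1)"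
    unfolding t_def using K2 by (simp add: x_def algebra_simps)
qed

lemma paths_total1_closed:
  assumes "2 \<le> p" "p \<le> n"
  shows "(real n + 1 - real p) * (real n + 2 - real p) * paths_total1 n p =
    2 * real p * (real n + 1)^2 * binom_harm n p
    + (real p + real p ^ 2 + real n - 2 * real n * real p + 2 * real n * real p ^ 2 + real n ^ 2
       - 2 * real n ^ 2 * real p) * real (n choose p)"
proof -
  define t x m where "t = real n - real p + 1" "x = real p" "m = real n"
  have m: "m = t + x - 1" by (simp add: t_x_m_def)
  define A B C where "A = binom_harm2 n p" "B = binom_harm n p" "C = real (n choose p)"
  note red = moment_reductions[OF assms, folded t_x_m_def A_B_C_def]
  have C20: "t * ((t + 1) * real (n + 2 choose p)) = (m + 2) * ((m + 1) * C)"
    and C11: "t * ((t + 1) * real (n + 1 choose (p - 1))) = x * ((m + 1) * C)"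
    and B11: "t * ((t + 1) * binom_harm (n + 1) (p - 1)) = x * ((m + 1) * B + C) + (m + 1) * C"
    using red(1,2,4,8,9) by algebra+
  have "t * (t + 1) * paths_total1 n p =
      x * (2 * (t + 1) * (t * binom_harm (n + 1) p) - t * (t + 1) * C)
    + (x - 1) * (2 * (t * ((t + 1) * binom_harm (n + 1) (p - 1))) - (t + 1) * (t * real (n choose (p - 1)))
      - t * ((t + 1) * real (n + 2 choose p)) + t * ((t + 1) * real (n + 1 choose (p - 1))))"
    unfolding paths_total1_def t_x_m_def(2)[symmetric] A_B_C_def[symmetric] by algebra
  also have "\<dots> = 2 * x * (m + 1)^2 * B + (x + x^2 + m - 2 * m * x + 2 * m * x^2 + m^2 - 2 * m^2 * x) * C"
    unfolding C20 C11 B11 red(2) red(7) m by algebra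
  finally show ?thesis by (simp add: t_x_m_def A_B_C_def algebra_simps)
qed

text \<open>
  Clearing the denominators one shift at a time keeps every step a polynomial identity. The
  result contains the polynomials \<open>Psi3\<close> and \<open>Psi4\<close> of the variance formula; the remaining parts of
  its coefficients cancel against \<open>excess_total2\<close>.
\<close>

lemma paths_total2_closed:
  assumes "2 \<le> p" "p \<le> n"
  defines "x \<equiv> real p" and "m \<equiv> real n"
  shows "(m + 1 - x) * (m + 2 - x) * (m + 3 - x) * (m + 4 - x) * paths_total2 n p =
    4 * x * (m + 2) * (m + 1)^2 * (m * x + 2 + x) * binom_harm2 n p
    + (8 * x * (m + 2 - x) * (m + 3 - x) * (m + 4 - x) - 4 * Psi3 m x) * binom_harm n p
    + (2 * Psi4 m x + (m + 2 - x) * (m + 3 - x) * (m + 4 - x) * ((12 * x + 4) * (m + 1 - x) + 8)) * real (n choose p)"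
proof -
  define t where "t = real n - real p + 1"
  have m: "m = t + x - 1" by (simp add: t_def x_def m_def)
  define A B C where "A = binom_harm2 n p" "B = binom_harm n p" "C = real (n choose p)"
  note red = moment_reductions[OF assms(1,2), folded t_def x_def m_def A_B_C_def]
  have c: "real (p choose 2) = x * (x - 1) / 2" "real (p - 1 choose 2) = (x - 1) * (x - 2) / 2"
    "real (p - 2 choose 2) = (x - 2) * (x - 3) / 2"
    using assms(1) by (simp_all add: choose_two_real x_def)
  \<comment> \<open>The first digit is the increase of \<open>n\<close>, the second one the decrease of \<open>p\<close>; denominators are left out.\<close>
  define C10 B10 A10 where "C10 = (m + 1) * C" "B10 = (m + 1) * B + C" "A10 = (m + 1) * A + 2 * B"
  define C20 B20 A20 where "C20 = (m + 2) * C10" "B20 = (m + 2) * B10 + C10" "A20 = (m + 2) * A10 + 2 * B10"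
  define C11 B11 A11 where "C11 = x * C10" "B11 = x * B10 + C10" "A11 = x * A10 + 2 * B10"
  define C21 B21 A21 where "C21 = x * C20" "B21 = x * B20 + C20" "A21 = x * A20 + 2 * B20"
  define C12 B12 A12 where "C12 = (x - 1) * C11" "B12 = (x - 1) * B11 + C11" "A12 = (x - 1) * A11 + 2 * B11"
  note defs = C10_B10_A10_def C20_B20_A20_def C11_B11_A11_def C21_B21_A21_def C12_B12_A12_def
  have r1: "t * real (n + 1 choose p) = C10" "t * binom_harm (n + 1) p = B10" "t * binom_harm2 (n + 1) p = A10"
    using red(1-3) by (simp_all add: defs)
  have r2: "t * ((t + 1) * real (n + 2 choose p)) = C20" "t * ((t + 1) * binom_harm (n + 2) p) = B20"
      "t * ((t + 1) * binom_harm2 (n + 2) p) = A20"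
    using red(4-6) r1 C20_B20_A20_def by algebra+
  have r11: "t * ((t + 1) * real (n + 1 choose (p - 1))) = C11" "t * ((t + 1) * binom_harm (n + 1) (p - 1)) = B11"
      "t * ((t + 1) * binom_harm2 (n + 1) (p - 1)) = A11"
    using red(8-10) r1 C11_B11_A11_def by algebra+
  have r21: "t * ((t + 1) * ((t + 2) * real (n + 2 choose (p - 1)))) = C21"
      "t * ((t + 1) * ((t + 2) * binom_harm (n + 2) (p - 1))) = B21"
      "t * ((t + 1) * ((t + 2) * binom_harm2 (n + 2) (p - 1))) = A21"
    using red(11-13) r2 C21_B21_A21_def by algebra+
  have r12: "t * ((t + 1) * ((t + 2) * real (n + 1 choose (p - 2)))) = C12"
      "t * ((t + 1) * ((t + 2) * binom_harm (n + 1) (p - 2))) = B12"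
      "t * ((t + 1) * ((t + 2) * binom_harm2 (n + 1) (p - 2))) = A12"
    using red(15-17) r11 C12_B12_A12_def by algebra+
  have r22: "t * ((t + 1) * ((t + 2) * ((t + 3) * binom_harm2 (n + 2) (p - 2)))) = (x - 1) * A21 + 2 * B21"
    using red(18) r21 by algebra
  have r02: "t * ((t + 1) * real (n choose (p - 2))) = (x - 1) * (x * C)"
    using red(7,14) by algebra
  have "t * (t + 1) * (t + 2) * (t + 3) * paths_total2 n p =
      x * ((t + 1) * (t + 2) * (t + 3)) * (4 * (t * binom_harm2 (n + 1) p) - 4 * (t * binom_harm (n + 1) p) + 4 * t * C)
    + real (p choose 2) * ((t + 2) * (t + 3)) * (8 * (t * ((t + 1) * binom_harm2 (n + 2) p))
        - 16 * (t * ((t + 1) * binom_harm (n + 2) p)) + 8 * (t * ((t + 1) * real (n + 2 choose p))))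
    + (x - 1) * ((t + 2) * (t + 3)) * (8 * (t * ((t + 1) * binom_harm2 (n + 1) (p - 1)))
        - 10 * (t * ((t + 1) * real (n + 1 choose (p - 1))))
        + 6 * (t + 1) * (t * real (n choose (p - 1))) + 2 * (t * ((t + 1) * real (n + 2 choose p))))
    + real (p - 1 choose 2) * (t + 3) * (16 * (t * ((t + 1) * ((t + 2) * binom_harm2 (n + 2) (p - 1))))
        - 16 * (t * ((t + 1) * ((t + 2) * binom_harm (n + 2) (p - 1)))))
    + (x - 2) * (t + 3) * (4 * (t * ((t + 1) * ((t + 2) * binom_harm2 (n + 1) (p - 2))))
        + 4 * (t * ((t + 1) * ((t + 2) * binom_harm (n + 1) (p - 2))))
        - 2 * (t * ((t + 1) * ((t + 2) * real (n + 1 choose (p - 2)))))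
        + 2 * (t + 2) * (t * ((t + 1) * real (n choose (p - 2))))
        + 2 * (t * ((t + 1) * ((t + 2) * real (n + 2 choose (p - 1))))))
    + real (p - 2 choose 2) * (8 * (t * ((t + 1) * ((t + 2) * ((t + 3) * binom_harm2 (n + 2) (p - 2))))))"
    unfolding paths_total2_def x_def[symmetric] A_B_C_def[symmetric] by algebra
  also have "\<dots> = 4 * x * (m + 2) * (m + 1)^2 * (m * x + 2 + x) * A
    + (8 * x * (t + 1) * (t + 2) * (t + 3) - 4 * Psi3 m x) * B
    + (2 * Psi4 m x + (t + 1) * (t + 2) * (t + 3) * ((12 * x + 4) * t + 8)) * C"
    unfolding r1 r2 r11 r21 r12 r22 r02 red(7) c unfolding defs Psi3_def Psi4_def m
    by (simp add: field_simps) algebra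
  finally show ?thesis by (simp add: t_def x_def m_def A_B_C_def algebra_simps)
qed

section \<open>Sums of the difference between root paths and spanning tree\<close>

definition subsets_of_card :: "'a Tree.tree \<Rightarrow> nat \<Rightarrow> 'a set set" where
  "subsets_of_card t p = {S. S \<subseteq> set_tree t \<and> card S = p}"

definition span_size :: "'a Tree.tree \<Rightarrow> 'a set \<Rightarrow> real" where
  "span_size t S = real (card (span_nodes t S))"

lemma finite_subsets_of_card [simp]: "finite (subsets_of_card t p)"
  by (rule finite_subset[of _ "Pow (set_tree t)"]) (auto simp: subsets_of_card_def)

lemma card_subsets_of_card: "card (subsets_of_card t p) = card (set_tree t) choose p"
  unfolding subsets_of_card_def by (rule n_subsets) simp

definition paths_sum1 :: "nat \<Rightarrow> 'a Tree.tree \<Rightarrow> real" where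
  "paths_sum1 p t = (\<Sum>S\<in>subsets_of_card t p. paths_size t S)"

definition paths_sum2 :: "nat \<Rightarrow> 'a Tree.tree \<Rightarrow> real" where
  "paths_sum2 p t = (\<Sum>S\<in>subsets_of_card t p. paths_size t S * (paths_size t S - 1))"

definition excess_sum1 :: "nat \<Rightarrow> 'a Tree.tree \<Rightarrow> real" where
  "excess_sum1 p t = (\<Sum>S\<in>subsets_of_card t p. paths_size t S - span_size t S)"

definition excess_sum2 :: "nat \<Rightarrow> 'a Tree.tree \<Rightarrow> real" where
  "excess_sum2 p t = (\<Sum>S\<in>subsets_of_card t p.
     paths_size t S * (paths_size t S - 1) - span_size t S * (span_size t S - 1))"

text \<open>
  A functional that vanishes on all sets that are not contained in one child subtree splits into
  contributions of the two children. A set contained in both would be empty, which \<open>0 < p\<close> excludes.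
\<close>

lemma sum_subsets_of_card_Node:
  fixes D :: "'a set \<Rightarrow> real"
  assumes "distinct (inorder \<langle>l, x, r\<rangle>)" "0 < p"
    and "\<And>S. S \<subseteq> set_tree l \<Longrightarrow> S \<noteq> {} \<Longrightarrow> D S = Dl S"
    and "\<And>S. S \<subseteq> set_tree r \<Longrightarrow> S \<noteq> {} \<Longrightarrow> D S = Dr S"
    and "\<And>S. S \<subseteq> set_tree \<langle>l, x, r\<rangle> \<Longrightarrow> \<not> S \<subseteq> set_tree l \<Longrightarrow> \<not> S \<subseteq> set_tree r \<Longrightarrow> D S = 0"
  shows "(\<Sum>S\<in>subsets_of_card \<langle>l, x, r\<rangle> p. D S) =
    (\<Sum>S\<in>subsets_of_card l p. Dl S) + (\<Sum>S\<in>subsets_of_card r p. Dr S)"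
proof -
  have ne: "S \<noteq> {}" if "S \<in> subsets_of_card t p" for S and t :: "'a Tree.tree"
    using that assms(2) by (auto simp: subsets_of_card_def)
  have disj: "set_tree l \<inter> set_tree r = {}" using assms(1) by auto
  have "(\<Sum>S\<in>subsets_of_card \<langle>l, x, r\<rangle> p. D S) = (\<Sum>S\<in>subsets_of_card l p \<union> subsets_of_card r p. D S)"
  proof (rule sum.mono_neutral_right)
    show "subsets_of_card l p \<union> subsets_of_card r p \<subseteq> subsets_of_card \<langle>l, x, r\<rangle> p"
      by (auto simp: subsets_of_card_def)
    show "\<forall>S\<in>subsets_of_card \<langle>l, x, r\<rangle> p - (subsets_of_card l p \<union> subsets_of_card r p). D S = 0"
      using assms(5) by (auto simp: subsets_of_card_def simp del: tree.set)
  qed simp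
  also have "\<dots> = (\<Sum>S\<in>subsets_of_card l p. D S) + (\<Sum>S\<in>subsets_of_card r p. D S)"
  proof (rule sum.union_disjoint)
    show "subsets_of_card l p \<inter> subsets_of_card r p = {}"
    proof (rule ccontr)
      assume "subsets_of_card l p \<inter> subsets_of_card r p \<noteq> {}"
      then obtain S where S: "S \<in> subsets_of_card l p" "S \<in> subsets_of_card r p" by blast
      then have "S \<subseteq> set_tree l \<inter> set_tree r" by (auto simp: subsets_of_card_def)
      with disj ne[OF S(1)] show False by simp
    qed
  qed simp_all
  also have "(\<Sum>S\<in>subsets_of_card l p. D S) = (\<Sum>S\<in>subsets_of_card l p. Dl S)"
    using ne by (intro sum.cong refl assms(3)) (auto simp: subsets_of_card_def)
  also have "(\<Sum>S\<in>subsets_of_card r p. D S) = (\<Sum>S\<in>subsets_of_card r p. Dr S)"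
    using ne by (intro sum.cong refl assms(4)) (auto simp: subsets_of_card_def)
  finally show ?thesis .
qed

lemma sizes_in_child:
  assumes "distinct (inorder \<langle>l, x, r\<rangle>)" "c \<in> {l, r}" "S \<subseteq> set_tree c" "S \<noteq> {}"
  shows "paths_size \<langle>l, x, r\<rangle> S = 1 + paths_size c S" "span_size \<langle>l, x, r\<rangle> S = span_size c S"
proof -
  have disj: "set_tree l \<inter> set_tree r = {}" using assms(1) by auto
  show "paths_size \<langle>l, x, r\<rangle> S = 1 + paths_size c S"
    using paths_size_Node(2)[OF assms(1), of S "{}"] paths_size_Node(2)[OF assms(1), of "{}" S] assms(2-4)
    by auto
  have "\<not> S \<subseteq> set_tree l" if "S \<subseteq> set_tree r" using that disj assms(4) by blast
  then show "span_size \<langle>l, x, r\<rangle> S = span_size c S" using assms(2,3) by (auto simp: span_size_def)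
qed

lemma sizes_across_root:
  assumes "S \<subseteq> set_tree \<langle>l, x, r\<rangle>" "\<not> S \<subseteq> set_tree l" "\<not> S \<subseteq> set_tree r"
  shows "span_size \<langle>l, x, r\<rangle> S = paths_size \<langle>l, x, r\<rangle> S"
proof -
  have "S \<inter> set_tree \<langle>l, x, r\<rangle> \<noteq> {}" using assms by blast
  then show ?thesis using assms by (simp add: span_size_def paths_size_def del: tree.set)
qed

lemma excess_sum1_Node:
  assumes "distinct (inorder \<langle>l, x, r\<rangle>)" "0 < p"
  shows "excess_sum1 p \<langle>l, x, r\<rangle> = (excess_sum1 p l + real (card (set_tree l) choose p))
    + (excess_sum1 p r + real (card (set_tree r) choose p))"
proof -
  have "excess_sum1 p \<langle>l, x, r\<rangle> = (\<Sum>S\<in>subsets_of_card l p. (paths_size l S - span_size l S) + 1)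
      + (\<Sum>S\<in>subsets_of_card r p. (paths_size r S - span_size r S) + 1)"
    unfolding excess_sum1_def
    by (rule sum_subsets_of_card_Node[OF assms])
       (simp_all add: sizes_in_child[OF assms(1), of l, simplified] sizes_in_child[OF assms(1), of r, simplified]
          sizes_across_root del: tree.set)
  then show ?thesis by (simp add: excess_sum1_def sum.distrib card_subsets_of_card)
qed

text \<open>
  Within one child, \<open>X\<close> grows by one and \<open>Y\<close> does not change, so \<open>X * (X - 1)\<close> grows by \<open>2 * X\<close>.
\<close>

lemma excess_sum2_Node:
  assumes "distinct (inorder \<langle>l, x, r\<rangle>)" "0 < p"
  shows "excess_sum2 p \<langle>l, x, r\<rangle> = (excess_sum2 p l + 2 * paths_sum1 p l) + (excess_sum2 p r + 2 * paths_sum1 p r)"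
proof -
  let ?D = "\<lambda>t S. (paths_size t S * (paths_size t S - 1) - span_size t S * (span_size t S - 1)) + 2 * paths_size t S"
  have "excess_sum2 p \<langle>l, x, r\<rangle> = (\<Sum>S\<in>subsets_of_card l p. ?D l S) + (\<Sum>S\<in>subsets_of_card r p. ?D r S)"
    unfolding excess_sum2_def
    by (rule sum_subsets_of_card_Node[OF assms])
       (simp_all add: sizes_in_child[OF assms(1), of l, simplified] sizes_in_child[OF assms(1), of r, simplified]
          sizes_across_root algebra_simps del: tree.set)
  then show ?thesis by (simp add: excess_sum2_def paths_sum1_def sum.distrib sum_distrib_left)
qed

lemma sum_Pow_by_card:
  "(\<Sum>S\<in>Pow (set_tree t). v ^ card S * f S) =
    (\<Sum>p\<le>card (set_tree t). (\<Sum>S\<in>subsets_of_card t p. f S) * v ^ p :: real)"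
proof -
  have "(\<Sum>S\<in>Pow (set_tree t). v ^ card S * f S) =
      (\<Sum>p\<le>card (set_tree t). \<Sum>S | S \<in> Pow (set_tree t) \<and> card S = p. v ^ card S * f S)"
    by (rule sum.group[symmetric]) (auto intro: card_mono)
  also have "\<dots> = (\<Sum>p\<le>card (set_tree t). (\<Sum>S\<in>subsets_of_card t p. f S) * v ^ p)"
    by (intro sum.cong refl) (simp add: sum_distrib_left subsets_of_card_def mult.commute)
  finally show ?thesis .
qed

lemma expectation_sum_random_bst_on:
  fixes f :: "nat \<Rightarrow> nat Tree.tree \<Rightarrow> real"
  assumes "finite A"
  shows "measure_pmf.expectation (random_bst_on A) (\<lambda>t. \<Sum>p\<le>card (set_tree t). f p t * v ^ p) =
    (\<Sum>p\<le>card A. measure_pmf.expectation (random_bst_on A) (f p) * v ^ p)"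
proof -
  have "measure_pmf.expectation (random_bst_on A) (\<lambda>t. \<Sum>p\<le>card (set_tree t). f p t * v ^ p) =
      measure_pmf.expectation (random_bst_on A) (\<lambda>t. \<Sum>p\<le>card A. f p t * v ^ p)"
    by (rule expectation_cong_pmf) (use set_pmf_random_bst_on[OF assms] in simp)
  also have "\<dots> = (\<Sum>p\<le>card A. measure_pmf.expectation (random_bst_on A) (f p) * v ^ p)"
    using assms by (simp add: integrable_measure_pmf_finite)
  finally show ?thesis .
qed

lemma expectation_paths_sum1:
  assumes "finite A" "2 \<le> p" "p \<le> card A"
  shows "measure_pmf.expectation (random_bst_on A) (paths_sum1 p) = paths_total1 (card A) p"
  unfolding paths_total1_def
proof (rule path_fps1_coeff[OF _ assms(2,3)])
  fix v
  show "(\<Sum>p\<le>card A. measure_pmf.expectation (random_bst_on A) (paths_sum1 p) * v ^ p) = fps_nth (path_fps1 v) (card A)"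
    unfolding expectation_path_poly1[OF assms(1), symmetric] path_poly1_def sum_Pow_by_card
      paths_sum1_def[symmetric] expectation_sum_random_bst_on[OF assms(1)] ..
qed

lemma expectation_paths_sum2:
  assumes "finite A" "2 \<le> p" "p \<le> card A"
  shows "measure_pmf.expectation (random_bst_on A) (paths_sum2 p) = paths_total2 (card A) p"
  unfolding paths_total2_def
proof (rule path_fps2_coeff[OF _ assms(2,3)])
  fix v
  show "(\<Sum>p\<le>card A. measure_pmf.expectation (random_bst_on A) (paths_sum2 p) * v ^ p) = fps_nth (path_fps2 v) (card A)"
    unfolding expectation_path_poly2[OF assms(1), symmetric] path_poly2_def sum_Pow_by_card
      paths_sum2_def[symmetric] expectation_sum_random_bst_on[OF assms(1)] ..
qed

lemma expectation_paths_sum1_eq_0: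
  assumes "finite A" "card A < p"
  shows "measure_pmf.expectation (random_bst_on A) (paths_sum1 p) = 0"
proof -
  have "measure_pmf.expectation (random_bst_on A) (paths_sum1 p) = measure_pmf.expectation (random_bst_on A) (\<lambda>t. 0)"
  proof (rule expectation_cong_pmf)
    fix t assume "t \<in> set_pmf (random_bst_on A)"
    then have "card (subsets_of_card t p) = 0"
      using set_pmf_random_bst_on[OF assms(1)] assms(2) by (simp add: card_subsets_of_card binomial_eq_0)
    then show "paths_sum1 p t = 0" by (simp add: paths_sum1_def)
  qed
  then show ?thesis by simp
qed


section \<open>Alternating binomial tails\<close>

definition alt_tail :: "nat \<Rightarrow> nat \<Rightarrow> nat \<Rightarrow> real" where
  "alt_tail j n p = (\<Sum>k=p..n. (-1) ^ k / real k ^ j * real (n choose k))"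

lemma alt_tail_eq_0: "n < p \<Longrightarrow> alt_tail j n p = 0"
  by (simp add: alt_tail_def)

lemma alt_tail_self: "alt_tail j p p = (-1) ^ p / real p ^ j"
  by (simp add: alt_tail_def)

text \<open>
  Partial alternating sums of a row of the Pascal triangle telescope.
\<close>

lemma alt_tail_0_Suc:
  assumes "0 < p" "p \<le> Suc n"
  shows "alt_tail 0 (Suc n) p = (-1) ^ p * real (n choose (p - 1))"
proof -
  define f where "f = (\<lambda>k. (-1) ^ Suc k * real (n choose (k - 1)))"
  have "alt_tail 0 (Suc n) p = (\<Sum>k=p..Suc n. f (Suc k) - f k)"
    unfolding alt_tail_def
  proof (rule sum.cong[OF refl])
    fix k assume "k \<in> {p..Suc n}"
    then obtain q where "k = Suc q" using assms(1) by (cases k) auto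
    then show "(-1) ^ k / real k ^ 0 * real (Suc n choose k) = f (Suc k) - f k"
      by (simp add: f_def algebra_simps)
  qed
  also have "\<dots> = f (Suc (Suc n)) - f p" using assms(2) by (intro sum_Suc_diff) simp
  finally show ?thesis by (simp add: f_def binomial_eq_0)
qed

text \<open>
  This is the absorption identity \<open>k * (n + 1 choose k) = (n + 1) * (n choose (k - 1))\<close>: a step in \<open>n\<close>
  lowers the exponent of \<open>k\<close> by one.
\<close>

lemma alt_tail_Suc:
  assumes "0 < p"
  shows "alt_tail (Suc j) (Suc n) p = alt_tail (Suc j) n p + alt_tail j (Suc n) p / (real n + 1)"
proof -
  have "alt_tail (Suc j) (Suc n) p =
      (\<Sum>k=p..Suc n. (-1) ^ k / real k ^ Suc j * real (n choose k) + (-1) ^ k / real k ^ j * real (Suc n choose k) / (real n + 1))"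
    unfolding alt_tail_def
  proof (rule sum.cong[OF refl])
    fix k assume "k \<in> {p..Suc n}"
    then obtain q where q: "k = Suc q" using assms by (cases k) auto
    have "real (Suc n choose k) = real (n choose k) + real (n choose q)" by (simp add: q)
    also have "real (n choose q) = real k * real (Suc n choose k) / (real n + 1)"
      using binomial_absorb_real[of q n] q by (simp add: field_simps del: binomial_Suc_Suc)
    finally have "real (Suc n choose k) = real (n choose k) + real k * real (Suc n choose k) / (real n + 1)" .
    then have "(-1) ^ k / real k ^ Suc j * real (Suc n choose k) =
        (-1) ^ k / real k ^ Suc j * (real (n choose k) + real k * real (Suc n choose k) / (real n + 1))" by metis
    also have "\<dots> = (-1) ^ k / real k ^ Suc j * real (n choose k) + (-1) ^ k / real k ^ j * real (Suc n choose k) / (real n + 1)"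
    proof -
      have "a / (r * b) * (N + r * M / d) = a / (r * b) * N + a / b * M / d" if "r \<noteq> 0" for a b r N M d :: real
        using that by (simp add: distrib_left)
      from this[of "real k"] show ?thesis using q by (simp del: of_nat_Suc binomial_Suc_Suc)
    qed
    finally show "(-1) ^ k / real k ^ Suc j * real (Suc n choose k) =
      (-1) ^ k / real k ^ Suc j * real (n choose k) + (-1) ^ k / real k ^ j * real (Suc n choose k) / (real n + 1)" .
  qed
  also have "\<dots> = (\<Sum>k=p..Suc n. (-1) ^ k / real k ^ Suc j * real (n choose k)) + alt_tail j (Suc n) p / (real n + 1)"
    by (simp only: sum.distrib alt_tail_def sum_divide_distrib)
  also have "(\<Sum>k=p..Suc n. (-1) ^ k / real k ^ Suc j * real (n choose k)) = alt_tail (Suc j) n p"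
    unfolding alt_tail_def by (rule sum.mono_neutral_right) (auto simp: binomial_eq_0)
  finally show ?thesis .
qed

text \<open>
  The solution of the Quicksort recurrence with toll \<open>n choose p\<close>; it is the expected sum of \<open>X - Y\<close>,
  by \<open>expectation_excess_sum1\<close>.
\<close>

definition excess_total1 :: "nat \<Rightarrow> nat \<Rightarrow> real" where
  "excess_total1 n p = 2 * real p * (real n + 1) * (-1) ^ p * alt_tail 1 n p - (2 * real p + 2) * real (n choose p)"

text \<open>
  The solution for the toll that is \<open>2 * paths_total1 n p\<close> for \<open>p \<le> n\<close> and \<open>0\<close> for \<open>n < p\<close>. All of its
  parts vanish for \<open>n < p\<close>.
\<close>

definition excess_total2 :: "nat \<Rightarrow> nat \<Rightarrow> real" where
  "excess_total2 n p = (8 * real p * binom_harm n p + 8 * real (n choose p)) / (real n + 1 - real p)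
    + (12 * real p + 4) * real (n choose p)
    + 4 * (real n + 1) * (-1) ^ p * ((2 * (harm n - harm p) + (2 - 3 * real p ^ 2) / real p) * alt_tail 1 n p
        - 2 * alt_tail 2 n p)"

text \<open>
  The full-history recurrence follows from its difference in \<open>n\<close>.
\<close>

lemma quicksort_recurrence:
  fixes e w :: "nat \<Rightarrow> real"
  assumes "\<And>n. (real n + 1) * e (Suc n) = (real n + 2) * e n + 2 * w n"
  shows "real n * e n = 2 * (\<Sum>k<n. e k + w k)"
proof (induction n)
  case (Suc n)
  then show ?case using assms[of n] by (simp add: algebra_simps)
qed simp

lemma excess_total1_rec:
  assumes "0 < p"
  shows "(real n + 1) * excess_total1 (Suc n) p = (real n + 2) * excess_total1 n p + 2 * real (n choose p)"
proof (cases "Suc n < p")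
  case True
  then show ?thesis by (simp add: excess_total1_def alt_tail_eq_0 binomial_eq_0)
next
  case False
  define s where "s = (-1 :: real) ^ p"
  have s: "s * s = 1" by (simp add: s_def flip: power_add mult_2)
  define c d where "c = real (n choose (p - 1))" "d = real (n choose p)"
  have low: "(real n - real p + 1) * c = real p * d"
    using binomial_lower_lower[of n "p - 1"] assms by (simp add: c_d_def of_nat_diff algebra_simps)
  have pas: "real (Suc n choose p) = c + d" using assms by (cases p) (auto simp: c_d_def)
  have tail: "(real n + 1) * alt_tail 1 (Suc n) p = (real n + 1) * alt_tail 1 n p + s * c"
    using alt_tail_Suc[OF assms, of 0 n] alt_tail_0_Suc[OF assms, of n] False
    by (simp add: s_def c_d_def field_simps)
  show ?thesis
    unfolding excess_total1_def pas s_def[symmetric] c_d_def(2)[symmetric]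
    using tail low s by (simp add: of_nat_Suc add.commute) algebra
qed

text \<open>
  In the step from \<open>n\<close> to \<open>n + 1\<close> the tails cancel: the harmonic number grows by \<open>1 / (n + 1)\<close>, which
  contributes \<open>2 / (n + 1)\<close> times the first tail, and this is what the second tail contributes with
  the opposite sign. The rest is a rational identity.
\<close>

lemma excess_total2_rec:
  assumes "2 \<le> p"
  shows "(real n + 1) * excess_total2 (Suc n) p = (real n + 2) * excess_total2 n p
    + 4 * (if p \<le> n then paths_total1 n p else 0)"
proof -
  consider "Suc n < p" | "Suc n = p" | "p \<le> n" by linarith
  then show ?thesis
  proof cases
    case 1
    then show ?thesis by (simp add: excess_total2_def alt_tail_eq_0 binomial_eq_0 binom_harm_def)
  next
    case 2
    define x s where "x = real p" "s = (-1 :: real) ^ p"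
    have s: "s * s = 1" by (simp add: x_s_def flip: power_add mult_2)
    define k where "k = (2 - 3 * x^2) / x"
    have "excess_total2 p p = 8 + (12 * x + 4) + 4 * (x + 1) * s * (k * (s / x) - 2 * (s / x^2))"
      unfolding excess_total2_def alt_tail_self binom_harm_def k_def x_s_def by simp
    also have "\<dots> = 8 + (12 * x + 4) + 4 * (x + 1) * (s * s) * (k / x - 2 / x^2)"
      by (simp add: algebra_simps)
    also have "k / x - 2 / x^2 = (2 - 3 * x^2) / x / x - 2 / x^2" by (simp add: k_def)
    also have "(2 - 3 * x^2) / x / x - 2 / x^2 = -3"
      using assms by (simp add: x_s_def(1) field_simps power2_eq_square)
    also have "8 + (12 * x + 4) + 4 * (x + 1) * (s * s) * -3 = 0" unfolding s by simp
    finally have "excess_total2 (Suc n) p = 0" using 2 by simp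
    moreover have "excess_total2 n p = 0"
      using 2 by (simp add: excess_total2_def alt_tail_eq_0 binomial_eq_0 binom_harm_def)
    ultimately show ?thesis using 2 by simp
  next
    case 3
    define t x m where "t = real n - real p + 1" "x = real p" "m = real n"
    define s where "s = (-1 :: real) ^ p"
    have s: "s * s = 1" by (simp add: s_def flip: power_add mult_2)
    have pos: "t > 0" "x > 0" "m > 0" using assms 3 by (auto simp: t_x_m_def)
    have m: "m = t + x - 1" by (simp add: t_x_m_def)
    define B C h where "B = binom_harm n p" "C = real (n choose p)" "h = (harm n - harm p :: real)"
    note red = moment_reductions[OF assms 3, folded t_x_m_def B_C_h_def]
    define c where "c = real (n choose (p - 1))"
    have c: "t * c = x * C" using red(7) by (simp add: c_def)
    have B: "B = C * h" by (simp add: B_C_h_def binom_harm_def)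
    have C1: "real (Suc n choose p) = (m + 1) * C / t" using red(1) pos by (simp add: field_simps del: binomial_Suc_Suc)
    have B1: "binom_harm (Suc n) p = ((m + 1) * B + C) / t" using red(2) pos by (simp add: field_simps)
    have h1: "harm (Suc n) - harm p = h + 1 / (m + 1)" by (simp add: B_C_h_def harm_Suc_real[of n] t_x_m_def)
    have T1: "alt_tail 1 n p = alt_tail 1 (Suc n) p - s * c / (m + 1)"
      using alt_tail_Suc[of p 0 n] alt_tail_0_Suc[of p n] assms 3
      by (simp add: s_def c_def t_x_m_def)
    have T2: "alt_tail 2 n p = alt_tail 2 (Suc n) p - alt_tail 1 (Suc n) p / (m + 1)"
      using alt_tail_Suc[of p 1 n] assms by (simp add: t_x_m_def numeral_2_eq_2)
    define k where "k = (2 - 3 * x ^ 2) / x"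
    have k: "x * k = 2 - 3 * x ^ 2" using pos by (simp add: k_def)
    \<comment> \<open>Both tails at \<open>n\<close> are now written through those at \<open>n + 1\<close>, abbreviated \<open>P\<close> and \<open>Q\<close>.\<close>
    define P where "P = alt_tail 1 (Suc n) p"
    define Q where "Q = alt_tail 2 (Suc n) p"
    have tails: "(2 * (h + 1 / (m + 1)) + k) * P - 2 * Q
        = ((2 * h + k) * (P - s * c / (m + 1)) - 2 * (Q - P / (m + 1))) + (2 * h + k) * s * c / (m + 1)"
      unfolding divide_inverse by algebra
    define g where "g = paths_total1 n p"
    have g: "t * (t + 1) * g = 2 * x * (m + 1)^2 * B + (x + x^2 + m - 2 * m * x + 2 * m * x^2 + m^2 - 2 * m^2 * x) * C"
      using paths_total1_closed[OF assms 3] by (simp add: g_def t_x_m_def B_C_h_def algebra_simps)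
    define W where "W = (2 * h + k) * (P - s * c / (m + 1)) - 2 * (Q - P / (m + 1))"
    have E0: "excess_total2 n p = (8 * x * B + 8 * C) / t + (12 * x + 4) * C + 4 * (m + 1) * s * W"
      unfolding excess_total2_def T1 T2 W_def P_def Q_def k_def s_def t_x_m_def B_C_h_def by (simp add: algebra_simps)
    have shift: "real (Suc n) + 1 = m + 2" "m + 2 - real p = t + 1" by (simp_all add: t_x_m_def)
    have Wt: "(2 * (h + 1 / (m + 1)) + k) * P - 2 * Q = W + (2 * h + k) * s * c / (m + 1)"
      unfolding W_def by (rule tails)
    have E1: "excess_total2 (Suc n) p = (8 * x * (((m + 1) * B + C) / t) + 8 * ((m + 1) * C / t)) / (t + 1)
        + (12 * x + 4) * ((m + 1) * C / t) + 4 * (m + 2) * s * (W + (2 * h + k) * s * c / (m + 1))"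
      unfolding Wt[symmetric] unfolding excess_total2_def B1 C1 h1 shift P_def Q_def k_def s_def t_x_m_def(2) ..
    have inv: "t * inverse t = 1" "(t + 1) * inverse (t + 1) = 1" "(m + 1) * inverse (m + 1) = 1"
      using pos by simp_all
    have "t * (t + 1) * ((m + 1) * excess_total2 (Suc n) p) =
        (m + 1) * (8 * x * ((m + 1) * B + C) + 8 * (m + 1) * C) + (t + 1) * (12 * x + 4) * (m + 1)^2 * C
        + t * (t + 1) * (4 * (m + 2) * s * (m + 1) * W + 4 * (m + 2) * (2 * h + k) * (s * s) * c)"
      unfolding E1 divide_inverse using inv by algebra
    also have "t * (t + 1) * (4 * (m + 2) * s * (m + 1) * W + 4 * (m + 2) * (2 * h + k) * (s * s) * c)
        = t * (t + 1) * (4 * (m + 2) * s * (m + 1) * W) + (t + 1) * (4 * (m + 2)) * (2 * x * B + (2 - 3 * x^2) * C)"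
      unfolding s B k[symmetric] using c by algebra
    also have "(m + 1) * (8 * x * ((m + 1) * B + C) + 8 * (m + 1) * C) + (t + 1) * (12 * x + 4) * (m + 1)^2 * C
        + (t * (t + 1) * (4 * (m + 2) * s * (m + 1) * W) + (t + 1) * (4 * (m + 2)) * (2 * x * B + (2 - 3 * x^2) * C))
        = (m + 2) * (t + 1) * (8 * x * B + 8 * C) + t * (t + 1) * (m + 2) * ((12 * x + 4) * C + 4 * (m + 1) * s * W)
          + 4 * (t * (t + 1) * g)"
      unfolding g m by algebra
    also have "\<dots> = t * (t + 1) * ((m + 2) * excess_total2 n p + 4 * g)"
      unfolding E0 divide_inverse using inv by algebra
    finally have "(m + 1) * excess_total2 (Suc n) p = (m + 2) * excess_total2 n p + 4 * g"
      using pos by simp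
    then show ?thesis using 3 by (simp add: t_x_m_def g_def)
  qed
qed


section \<open>Mean and variance of the spanning tree size\<close>

lemma expectation_excess_sum1:
  assumes "finite A" "0 < p"
  shows "measure_pmf.expectation (random_bst_on A) (excess_sum1 p) = excess_total1 (card A) p"
proof (rule expectation_additive_functional[OF _ _ _ _ assms(1),
      where h = "\<lambda>t. real (card (set_tree t) choose p)" and w = "\<lambda>k. real (k choose p)"])
  show "excess_sum1 p (\<langle>\<rangle> :: nat Tree.tree) = excess_total1 0 p"
  proof -
    have "subsets_of_card (\<langle>\<rangle> :: nat Tree.tree) p = {}" using assms(2) by (auto simp: subsets_of_card_def)
    then show ?thesis using assms(2) by (simp add: excess_sum1_def excess_total1_def alt_tail_eq_0 binomial_eq_0)
  qed
next
  fix B :: "nat set" assume B: "finite B"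
  have "measure_pmf.expectation (random_bst_on B) (\<lambda>t. real (card (set_tree t) choose p)) =
      measure_pmf.expectation (random_bst_on B) (\<lambda>t. real (card B choose p))"
    by (rule expectation_cong_pmf) (use set_pmf_random_bst_on[OF B] in simp)
  then show "measure_pmf.expectation (random_bst_on B) (\<lambda>t. real (card (set_tree t) choose p)) = real (card B choose p)"
    by simp
next
  fix n :: nat
  show "real n * excess_total1 n p = 2 * (\<Sum>k<n. excess_total1 k p + real (k choose p))"
    by (rule quicksort_recurrence) (rule excess_total1_rec[OF assms(2)])
qed (rule excess_sum1_Node[OF _ assms(2)])

lemma expectation_excess_sum2:
  assumes "finite A" "2 \<le> p"
  shows "measure_pmf.expectation (random_bst_on A) (excess_sum2 p) = excess_total2 (card A) p"
proof (rule expectation_additive_functional[OF _ _ _ _ assms(1),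
      where h = "\<lambda>t. 2 * paths_sum1 p t" and w = "\<lambda>k. 2 * (if p \<le> k then paths_total1 k p else 0)"])
  show "excess_sum2 p (\<langle>\<rangle> :: nat Tree.tree) = excess_total2 0 p"
  proof -
    have "subsets_of_card (\<langle>\<rangle> :: nat Tree.tree) p = {}" using assms(2) by (auto simp: subsets_of_card_def)
    then show ?thesis using assms(2)
      by (simp add: excess_sum2_def excess_total2_def alt_tail_eq_0 binom_harm_def binomial_eq_0)
  qed
next
  fix B :: "nat set" assume B: "finite B"
  then show "measure_pmf.expectation (random_bst_on B) (\<lambda>t. 2 * paths_sum1 p t)
      = 2 * (if p \<le> card B then paths_total1 (card B) p else 0)"
    using expectation_paths_sum1[OF B assms(2)] expectation_paths_sum1_eq_0[OF B, of p] by simp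
next
  fix n :: nat
  show "real n * excess_total2 n p =
      2 * (\<Sum>k<n. excess_total2 k p + 2 * (if p \<le> k then paths_total1 k p else 0))"
    by (rule quicksort_recurrence) (use excess_total2_rec[OF assms(2)] in simp)
qed (rule excess_sum2_Node, use assms in auto)



lemma random_bst_eq: "random_bst n = random_bst_on {1..n}"
  by (simp add: random_bst_def random_bst_on_def)

text \<open>
  Averaging over the chosen set first reduces the distribution of \<open>Y\<close> to sums over all sets of \<open>p\<close>
  nodes of a random search tree.
\<close>

lemma expectation_Y:
  fixes f :: "nat \<Rightarrow> real"
  assumes "1 \<le> p" "p \<le> n"
  shows "real (n choose p) * measure_pmf.expectation (Y n p) f =
    measure_pmf.expectation (random_bst_on {1..n}) (\<lambda>t. \<Sum>S\<in>subsets_of_card t p. f (card (span_nodes t S)))"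
proof -
  define T where "T = random_bst_on {1..n}"
  define K where "K = {S. S \<subseteq> {1..n} \<and> card S = p}"
  have K: "finite K" "card K = n choose p" using n_subsets[of "{1..n}" p] by (simp_all add: K_def)
  have pos: "n choose p > 0" using assms by simp
  then have ne: "K \<noteq> {}" using K by auto
  have fin: "finite (set_pmf T)" by (simp add: T_def)
  have "measure_pmf.expectation (Y n p) f =
      measure_pmf.expectation (pair_pmf T (pmf_of_set K)) (\<lambda>(t, S). f (spanning_tree_size t S))"
    unfolding Y_def T_def K_def random_bst_eq by (simp add: case_prod_unfold)
  also have "pair_pmf T (pmf_of_set K) = T \<bind> (\<lambda>t. map_pmf (Pair t) (pmf_of_set K))"
    by (simp add: pair_pmf_def map_pmf_def)
  also have "measure_pmf.expectation \<dots> (\<lambda>(t, S). f (spanning_tree_size t S)) =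
      (\<Sum>t\<in>set_pmf T. pmf T t *\<^sub>R measure_pmf.expectation (map_pmf (Pair t) (pmf_of_set K)) (\<lambda>(t, S). f (spanning_tree_size t S)))"
    using fin K ne by (intro pmf_expectation_bind) auto
  also have "\<dots> = (\<Sum>t\<in>set_pmf T. pmf T t *\<^sub>R ((\<Sum>S\<in>subsets_of_card t p. f (card (span_nodes t S))) / real (n choose p)))"
  proof (intro sum.cong refl arg_cong2[of _ _ _ _ scaleR])
    fix t assume "t \<in> set_pmf T"
    then have t: "distinct (inorder t)" "set_tree t = {1..n}"
      using set_pmf_random_bst_on[of "{1..n}" t] by (simp_all add: T_def)
    have sub: "subsets_of_card t p = K" by (simp add: subsets_of_card_def K_def t)
    have "measure_pmf.expectation (map_pmf (Pair t) (pmf_of_set K)) (\<lambda>(t, S). f (spanning_tree_size t S))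
        = (\<Sum>S\<in>K. f (spanning_tree_size t S)) / real (card K)"
      using K ne by (simp add: integral_pmf_of_set)
    also have "(\<Sum>S\<in>K. f (spanning_tree_size t S)) = (\<Sum>S\<in>K. f (card (span_nodes t S)))"
    proof (intro sum.cong refl)
      fix S assume "S \<in> K"
      then have "S \<subseteq> set_tree t" "S \<noteq> {}" using t assms by (auto simp: K_def)
      then show "f (spanning_tree_size t S) = f (card (span_nodes t S))"
        using spanning_tree_size_eq[OF t(1)] by simp
    qed
    finally show "measure_pmf.expectation (map_pmf (Pair t) (pmf_of_set K)) (\<lambda>(t, S). f (spanning_tree_size t S))
        = (\<Sum>S\<in>subsets_of_card t p. f (card (span_nodes t S))) / real (n choose p)"
      using K sub by simp
  qed
  also have "\<dots> = measure_pmf.expectation T (\<lambda>t. (\<Sum>S\<in>subsets_of_card t p. f (card (span_nodes t S))) / real (n choose p))"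
    using fin by (subst integral_measure_pmf[of "set_pmf T"]) auto
  also have "\<dots> = measure_pmf.expectation T (\<lambda>t. \<Sum>S\<in>subsets_of_card t p. f (card (span_nodes t S))) / real (n choose p)"
    by simp
  finally show ?thesis using pos by (simp add: T_def)
qed

lemma finite_set_pmf_Y: "p \<le> n \<Longrightarrow> finite (set_pmf (Y n p))"
proof -
  assume "p \<le> n"
  then have "card {S. S \<subseteq> {1..n} \<and> card S = p} > 0" using n_subsets[of "{1..n}" p] by simp
  then have "{S. S \<subseteq> {1..n} \<and> card S = p} \<noteq> {}" "finite {S. S \<subseteq> {1..n} \<and> card S = p}"
    unfolding card_gt_0_iff by blast+
  then show ?thesis by (simp add: Y_def random_bst_eq)
qed

lemma EY_closed:
  assumes "2 \<le> p" "p \<le> n"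
  shows "real (n choose p) * EY n p = paths_total1 n p - excess_total1 n p"
proof -
  have "real (n choose p) * EY n p =
      measure_pmf.expectation (random_bst_on {1..n}) (\<lambda>t. paths_sum1 p t - excess_sum1 p t)"
    unfolding EY_def using assms
    by (subst expectation_Y) (auto simp: paths_sum1_def excess_sum1_def span_size_def sum_subtractf[symmetric])
  also have "\<dots> = paths_total1 n p - excess_total1 n p"
    using assms by (simp add: integrable_measure_pmf_finite expectation_paths_sum1 expectation_excess_sum1)
  finally show ?thesis .
qed

lemma VY_closed:
  assumes "2 \<le> p" "p \<le> n"
  shows "VY n p = (paths_total2 n p - excess_total2 n p) / real (n choose p) + EY n p - (EY n p)^2"
proof -
  let ?E = "measure_pmf.expectation (Y n p)"
  have fin: "finite (set_pmf (Y n p))" by (rule finite_set_pmf_Y[OF assms(2)])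
  note [simp] = integrable_measure_pmf_finite[OF fin]
  have pos: "real (n choose p) > 0" using assms by simp
  have "real (n choose p) * ?E (\<lambda>y. real y * (real y - 1)) =
      measure_pmf.expectation (random_bst_on {1..n}) (\<lambda>t. paths_sum2 p t - excess_sum2 p t)"
    using assms
    by (subst expectation_Y) (auto simp: paths_sum2_def excess_sum2_def span_size_def sum_subtractf[symmetric])
  also have "\<dots> = paths_total2 n p - excess_total2 n p"
    using assms by (simp add: integrable_measure_pmf_finite expectation_paths_sum2 expectation_excess_sum2)
  finally have ff: "?E (\<lambda>y. real y * (real y - 1)) = (paths_total2 n p - excess_total2 n p) / real (n choose p)"
    using pos by (simp add: field_simps)
  have "VY n p = ?E (\<lambda>y. (real y)^2) - (EY n p)^2"
    unfolding VY_def EY_def by (subst measure_pmf.variance_eq) simp_all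
  also have "?E (\<lambda>y. (real y)^2) = ?E (\<lambda>y. real y * (real y - 1) + real y)"
    by (simp add: power2_eq_square algebra_simps)
  also have "\<dots> = ?E (\<lambda>y. real y * (real y - 1)) + EY n p"
    unfolding EY_def by (rule Bochner_Integration.integral_add) simp_all
  finally show ?thesis unfolding ff .
qed

lemma span_nodes_singleton: "distinct (inorder t) \<Longrightarrow> x \<in> set_tree t \<Longrightarrow> span_nodes t {x} = {x}"
proof (induction t)
  case (Node l y r)
  have "root_paths c {x} = {}" if "x \<notin> set_tree c" for c using that by (simp add: root_paths_empty_iff)
  then show ?case using Node by auto
qed simp

lemma VY_1:
  assumes "1 \<le> n"
  shows "VY n 1 = 0"
proof -
  have const: "measure_pmf.expectation (Y n 1) f = f 1" for f :: "nat \<Rightarrow> real"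
  proof -
    have "real (n choose 1) * measure_pmf.expectation (Y n 1) f =
        measure_pmf.expectation (random_bst_on {1..n}) (\<lambda>t. \<Sum>S\<in>subsets_of_card t 1. f (card (span_nodes t S)))"
      by (rule expectation_Y) (use assms in simp_all)
    also have "\<dots> = measure_pmf.expectation (random_bst_on {1..n}) (\<lambda>t. real (n choose 1) * f 1)"
    proof (rule expectation_cong_pmf)
      fix t assume "t \<in> set_pmf (random_bst_on {1..n})"
      then have t: "distinct (inorder t)" "set_tree t = {1..n}" using set_pmf_random_bst_on[of "{1..n}" t] by simp_all
      have "(\<Sum>S\<in>subsets_of_card t 1. f (card (span_nodes t S))) = (\<Sum>S\<in>subsets_of_card t 1. f 1)"
      proof (intro sum.cong refl)
        fix S assume "S \<in> subsets_of_card t 1"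
        then obtain x where "S = {x}" "x \<in> set_tree t" by (auto simp: subsets_of_card_def card_1_singleton_iff)
        then show "f (card (span_nodes t S)) = f 1" using span_nodes_singleton[OF t(1)] by simp
      qed
      then show "(\<Sum>S\<in>subsets_of_card t 1. f (card (span_nodes t S))) = real (n choose 1) * f 1"
        using t by (simp add: card_subsets_of_card)
    qed
    finally show ?thesis using assms by simp
  qed
  show ?thesis unfolding VY_def const by simp
qed

text \<open>
  The complete alternating sums, obtained from the step rule for tails.
\<close>

lemma alt_tail_one:
  "alt_tail 1 n 1 = - harm n" "alt_tail 2 n 1 = - ((harm n)^2 + harm2 n) / 2"
proof -
  have 0: "alt_tail 0 (Suc n) 1 = -1" for n by (subst alt_tail_0_Suc) auto
  have 1: "alt_tail 1 n 1 = - harm n" for n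
  proof (induction n)
    case (Suc n)
    then show ?case using alt_tail_Suc[of 1 0 n] 0[of n] by (simp add: harm_Suc_real)
  qed (simp add: alt_tail_def harm_def)
  show "alt_tail 1 n 1 = - harm n" by (rule 1)
  show "alt_tail 2 n 1 = - ((harm n)^2 + harm2 n) / 2"
  proof (induction n)
    case (Suc n)
    define a where "a = 1 / (real n + 1)"
    have h: "harm (Suc n) = harm n + a" "harm2 (Suc n) = harm2 n + a^2"
      by (simp_all add: a_def harm_Suc_real harm2_Suc power_one_over)
    have "alt_tail 2 (Suc n) 1 = alt_tail 2 n 1 + alt_tail 1 (Suc n) 1 * a"
      using alt_tail_Suc[of 1 1 n] by (simp add: numeral_2_eq_2 a_def)
    then show ?case unfolding Suc 1 h by (simp add: power2_eq_square field_simps)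
  qed (simp add: alt_tail_def harm_def harm2_def)
qed

lemma alt_tail_split:
  assumes "1 \<le> p" "p \<le> n"
  shows "alt_tail j n p = alt_tail j n 1 - (\<Sum>k=1..p-1. (-1) ^ k / real k ^ j * real (n choose k))"
proof -
  have "alt_tail j n 1 = (\<Sum>k=1..p-1. (-1) ^ k / real k ^ j * real (n choose k)) + alt_tail j n p"
    unfolding alt_tail_def using sum.ub_add_nat[of 1 "p - 1" "\<lambda>k. (-1) ^ k / real k ^ j * real (n choose k)" "n - (p - 1)"] assms
    by simp
  then show ?thesis by simp
qed

lemma falling_4: "falling (a + 4 - b) 4 = (a + 1 - b) * (a + 2 - b) * (a + 3 - b) * (a + 4 - b)"
proof -
  have "{..<4::nat} = {0, 1, 2, 3}" by auto
  then show ?thesis by (simp add: falling_def algebra_simps)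
qed

lemma VY_eq_tails:
  assumes "2 \<le> p" "p \<le> n"
  shows "VY n p = 4 * real p * (real n + 2) * (real n + 1)^2 * (real n * real p + 2 + real p)
          / falling (real n + 4 - real p) 4 * ((harm n - harm p)^2 - (harm2 n - harm2 p))
        - 4 * Psi3 (real n) (real p) / falling (real n + 4 - real p) 4 * (harm n - harm p)
        + 2 * Psi4 (real n) (real p) / falling (real n + 4 - real p) 4
        - 4 * ((2 * (harm n - harm p) + (2 - 3 * real p ^ 2) / real p)
              * ((real n + 1) * (-1)^p / real (n choose p) * alt_tail 1 n p)
            - 2 * ((real n + 1) * (-1)^p / real (n choose p) * alt_tail 2 n p))
        + EY n p - (EY n p)^2"
proof -
  define t x m where "t = real n - real p + 1" "x = real p" "m = real n"
  have t: "t > 0" using assms by (simp add: t_x_m_def)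
  define F where "F = falling (real n + 4 - real p) 4"
  have F: "F = t * (t + 1) * (t + 2) * (t + 3)" by (simp add: F_def falling_4 t_x_m_def algebra_simps)
  have F0: "F > 0" using t by (simp add: F)
  define A h C where "A = (harm n - harm p)^2 - (harm2 n - harm2 p)" "h = (harm n - harm p :: real)" "C = real (n choose p)"
  have C: "C > 0" using assms by (simp add: A_h_C_def)
  have bh: "binom_harm n p = C * h" "binom_harm2 n p = C * A"
    by (simp_all add: binom_harm_def binom_harm2_def A_h_C_def)
  define a where "a = 4 * x * (m + 2) * (m + 1)^2 * (m * x + 2 + x)"
  define G where "G = (t + 1) * (t + 2) * (t + 3)"
  have FG: "F = t * G" by (simp add: F G_def)
  have G0: "G > 0" using t by (simp add: G_def)
  have mom: "F * paths_total2 n p = C * (a * A + (8 * x * G - 4 * Psi3 m x) * h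
      + (2 * Psi4 m x + G * ((12 * x + 4) * t + 8)))"
    using paths_total2_closed[OF assms]
    by (simp add: bh a_def F G_def t_x_m_def A_h_C_def(3) algebra_simps)
  have "paths_total2 n p / C = (a * A + (8 * x * G - 4 * Psi3 m x) * h
      + (2 * Psi4 m x + G * ((12 * x + 4) * t + 8))) / F"
    using mom C F0 by (simp add: field_simps)
  also have "\<dots> = a / F * A - 4 * Psi3 m x / F * h + 2 * Psi4 m x / F + (8 * x * h + 8) / t + 12 * x + 4"
  proof -
    have i: "t * inverse t = 1" "G * inverse G = 1" using t G0 by auto
    show ?thesis unfolding FG divide_inverse inverse_mult_distrib using i by algebra
  qed
  finally have 1: "paths_total2 n p / C = \<dots>" .
  define k where "k = (2 - 3 * real p ^ 2) / real p"
  have "excess_total2 n p / C = (8 * x * h + 8) / t + 12 * x + 4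
      + 4 * ((2 * h + k) * ((real n + 1) * (-1)^p / C * alt_tail 1 n p)
         - 2 * ((real n + 1) * (-1)^p / C * alt_tail 2 n p))"
  proof -
    have i: "C * inverse C = 1" using C by auto
    have t': "real n + 1 - x = t" by (simp add: t_x_m_def)
    show ?thesis unfolding excess_total2_def k_def A_h_C_def(2,3)[symmetric] bh
      unfolding t_x_m_def(2)[symmetric] unfolding t' divide_inverse
      using i by algebra
  qed
  with 1 show ?thesis unfolding VY_closed[OF assms]
    by (simp add: diff_divide_distrib a_def F_def t_x_m_def(2,3) A_h_C_def k_def)
qed

lemma EY_eq_tails:
  assumes "2 \<le> p" "p \<le> n"
  shows "EY n p = 2 * real p * (real n + 1)^2 / ((real n + 1 - real p) * (real n + 2 - real p)) * (harm n - harm p)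
    + (real p + real p ^ 2 + real n - 2 * real n * real p + 2 * real n * real p ^ 2 + real n ^ 2
       - 2 * real n ^ 2 * real p) / ((real n + 1 - real p) * (real n + 2 - real p))
    - 2 * real p * ((real n + 1) * (-1)^p / real (n choose p) * alt_tail 1 n p) + (2 * real p + 2)"
proof -
  define T where "T = (real n + 1 - real p) * (real n + 2 - real p)"
  have T: "T > 0" using assms by (simp add: T_def)
  define C where "C = real (n choose p)"
  have C: "C > 0" using assms by (simp add: C_def)
  define g where "g = real p + real p ^ 2 + real n - 2 * real n * real p + 2 * real n * real p ^ 2 + real n ^ 2
       - 2 * real n ^ 2 * real p"
  define q where "q = 2 * real p * (real n + 1)^2"
  have m: "T * paths_total1 n p = C * (q * (harm n - harm p) + g)"
    using paths_total1_closed[OF assms]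
    unfolding T_def[symmetric] g_def[symmetric] C_def[symmetric] q_def[symmetric] binom_harm_def by (simp add: algebra_simps)
  have e: "C * EY n p = paths_total1 n p - excess_total1 n p" using EY_closed[OF assms] by (simp add: C_def)
  have i: "C * inverse C = 1" using C by auto
  have 1: "paths_total1 n p / C = (q * (harm n - harm p) + g) / T"
    using m T C by (simp add: field_simps)
  have 2: "EY n p = paths_total1 n p / C - excess_total1 n p / C"
    using e C by (simp add: field_simps)
  have 3: "excess_total1 n p / C =
      2 * real p * ((real n + 1) * (-1)^p / C * alt_tail 1 n p) - (2 * real p + 2)"
    unfolding excess_total1_def C_def[symmetric] divide_inverse using i by algebra
  show ?thesis
    unfolding 2 1 3 T_def[symmetric] C_def[symmetric] g_def[symmetric] q_def[symmetric]
    unfolding divide_inverse by algebra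
qed

text \<open>
  The formula \<open>VY_eq_tails\<close>, with the tails replaced by initial segments of the alternating sums.
\<close>

lemma exact_variance:
  assumes "2 \<le> p" "p \<le> n"
  shows "VY n p =
        4 * (-1)^p * (real n + 1) * (2 * real p * harm n - 2 * real p * harm p + 2 - 3 * real p ^ 2)
          / (real p * real (n choose p))
          * (\<Sum>k=1..p-1. (-1)^k / real k * real (n choose k))
        - 8 * (-1)^p * (real n + 1) / real (n choose p)
          * (\<Sum>k=1..p-1. (-1)^k / real k ^ 2 * real (n choose k))
        + 4 * (-1)^p * (real n + 1) / real (n choose p)
          * (harm n ^ 2 - harm2 n - 2 * harm p * harm n)
        + 4 * (-1)^p * (2 - 3 * real p ^ 2) * (real n + 1) / (real p * real (n choose p)) * harm n
        - 4 * Psi3 (real n) (real p) / falling (real n + 4 - real p) 4 * (harm n - harm p)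
        + 4 * real p * (real n + 2) * (real n + 1)^2 * (real n * real p + 2 + real p)
          / falling (real n + 4 - real p) 4
          * ((harm n - harm p)^2 - (harm2 n - harm2 p))
        + 2 * Psi4 (real n) (real p) / falling (real n + 4 - real p) 4
        + EY n p - (EY n p)^2"
proof -
  define S1 where "S1 = (\<Sum>k=1..p-1. (-1)^k / real k * real (n choose k))"
  define S2 where "S2 = (\<Sum>k=1..p-1. (-1)^k / real k ^ 2 * real (n choose k))"
  have T: "alt_tail 1 n p = - harm n - S1" "2 * alt_tail 2 n p = - ((harm n)^2 + harm2 n) - 2 * S2"
    using alt_tail_split[of p n 1] alt_tail_split[of p n 2] alt_tail_one[of n] assms
    by (simp_all add: S1_def S2_def)
  define C where "C = real (n choose p)"
  define x where "x = real p"
  have i: "x * inverse x = 1" using assms by (auto simp: x_def)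
  define s where "s = (-1 :: real) ^ p"
  have "- 4 * ((2 * (harm n - harm p) + (2 - 3 * x ^ 2) / x) * ((real n + 1) * s / C * alt_tail 1 n p)
      - 2 * ((real n + 1) * s / C * alt_tail 2 n p)) =
    4 * s * (real n + 1) * (2 * x * harm n - 2 * x * harm p + 2 - 3 * x ^ 2) / (x * C) * S1
    - 8 * s * (real n + 1) / C * S2
    + 4 * s * (real n + 1) / C * (harm n ^ 2 - harm2 n - 2 * harm p * harm n)
    + 4 * s * (2 - 3 * x ^ 2) * (real n + 1) / (x * C) * harm n"
    unfolding divide_inverse inverse_mult_distrib using i T by algebra
  then show ?thesis
    unfolding VY_eq_tails[OF assms] S1_def[symmetric] S2_def[symmetric] C_def[symmetric] x_def[symmetric]
      s_def[symmetric]
    by linarith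
qed


section \<open>Asymptotics\<close>

text \<open>
  If \<open>u\<close> decreases and \<open>u n - 1 / n\<close> increases, the common limit lies between them.
\<close>

lemma bigo_rate_if_monotone:
  fixes u :: "nat \<Rightarrow> real"
  assumes lim: "u \<longlonglongrightarrow> L"
    and dec: "\<And>n. 0 < n \<Longrightarrow> u (Suc n) \<le> u n"
    and inc: "\<And>n. 0 < n \<Longrightarrow> u n - 1 / real n \<le> u (Suc n) - 1 / real (Suc n)"
  shows "(\<lambda>n. u n - L) \<in> O(\<lambda>n. 1 / real n)"
proof (rule bigoI)
  show "\<forall>\<^sub>F n in sequentially. norm (u n - L) \<le> 1 * norm (1 / real n)"
    using eventually_gt_at_top[of 0]
  proof eventually_elim
    case (elim n)
    have "u m \<le> u n" if "n \<le> m" for m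
      using that
    proof (induction rule: dec_induct)
      case (step m) then show ?case using dec[of m] elim by simp
    qed simp
    then have "L \<le> u n" by (intro LIMSEQ_le_const2[OF lim]) auto
    have "u n - 1 / real n \<le> u m - 1 / real m" if "n \<le> m" for m
      using that
    proof (induction rule: dec_induct)
      case (step m) then show ?case using inc[of m] elim by simp
    qed simp
    moreover have "(\<lambda>m. u m - 1 / real m) \<longlonglongrightarrow> L - 0"
      by (intro tendsto_diff lim lim_1_over_n)
    ultimately have "u n - 1 / real n \<le> L - 0" by (intro LIMSEQ_le_const) auto
    with \<open>L \<le> u n\<close> show ?case by simp
  qed
qed

lemma harm_rate: "(\<lambda>n. harm n - ln (real n) - euler_mascheroni) \<in> O(\<lambda>n. 1 / real n)"
proof (rule bigo_rate_if_monotone[OF euler_mascheroni_LIMSEQ])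
  fix n :: nat assume n: "0 < n"
  then obtain m where m: "n = Suc m" by (cases n) auto
  show "harm (Suc n) - ln (real (Suc n)) \<le> harm n - ln (real n)"
    using decseqD[OF decseq_harm_diff_ln, of m "Suc m"] m by simp
  have "ln (real (Suc n)) - ln (real n) = ln (1 + 1 / real n)"
  proof -
    have "1 + 1 / real n = real (Suc n) / real n" using n by (simp add: field_simps)
    then show ?thesis using n by (simp add: ln_div del: of_nat_Suc)
  qed
  also have "\<dots> \<le> 1 / real n" by (rule ln_add_one_self_le_self) simp
  finally show "harm n - ln (real n) - 1 / real n \<le> harm (Suc n) - ln (real (Suc n)) - 1 / real (Suc n)"
    by (simp add: harm_Suc inverse_eq_divide)
qed

lemma harm2_rate: "(\<lambda>n. harm2 n - pi^2 / 6) \<in> O(\<lambda>n. 1 / real n)"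
proof -
  have "(\<lambda>n. - harm2 n - - (pi^2 / 6)) \<in> O(\<lambda>n. 1 / real n)"
  proof (rule bigo_rate_if_monotone)
    have "harm2 n = (\<Sum>k<n. 1 / (real k + 1)^2)" for n
      by (induction n) (simp_all add: harm2_Suc, simp add: harm2_def)
    then show "(\<lambda>n. - harm2 n) \<longlonglongrightarrow> - (pi^2 / 6)"
      using inverse_squares_sums by (intro tendsto_minus) (simp add: sums_def add.commute)
  next
    fix n :: nat assume n: "0 < n"
    show "- harm2 (Suc n) \<le> - harm2 n" by (simp add: harm2_Suc)
    have "1 / (real n + 1)^2 \<le> 1 / (real n * (real n + 1))"
      using n by (intro divide_left_mono) (auto simp: power2_eq_square)
    also have "\<dots> = 1 / real n - 1 / (real n + 1)" using n by (simp add: field_simps)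
    finally show "- harm2 n - 1 / real n \<le> - harm2 (Suc n) - 1 / real (Suc n)"
      by (simp add: harm2_Suc add.commute)
  qed
  then have "(\<lambda>n. - (harm2 n - pi^2 / 6)) \<in> O(\<lambda>n. 1 / real n)" by (simp add: algebra_simps)
  then show ?thesis by (subst (asm) landau_o.big.uminus_in_iff)
qed

text \<open>
  Rational functions of \<open>n\<close> are written as functions of \<open>1 / n\<close>; their deviation from the limit
  is then of order \<open>1 / n\<close> because the derivative at \<open>0\<close> exists.
\<close>

lemma bigo_of_inverse_argument:
  fixes F :: "real \<Rightarrow> real"
  assumes "F differentiable (at 0)"
  shows "(\<lambda>n. F (1 / real n) - F 0) \<in> O(\<lambda>n. 1 / real n)"
proof -
  from assms obtain D where "(F has_real_derivative D) (at 0)" by (auto simp: real_differentiable_def)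
  then have "((\<lambda>y. (F y - F 0) / y) \<longlongrightarrow> D) (at 0)" by (simp add: has_field_derivative_iff)
  moreover have "filterlim (\<lambda>n. 1 / real n) (at 0) sequentially" by real_asymp
  ultimately have "(\<lambda>n. (F (1 / real n) - F 0) / (1 / real n)) \<longlonglongrightarrow> D"
    by (rule filterlim_compose)
  then show ?thesis
    by (rule bigoI_tendsto[rotated 2, OF _ ]) (auto intro: eventually_mono[OF eventually_gt_at_top[of 0]])
qed


lemma bigo_cmult: "f \<in> O[F](g) \<Longrightarrow> (\<lambda>x. c * f x :: real) \<in> O[F](g)" for f g :: "'a \<Rightarrow> real"
  by (cases "c = 0") simp_all

lemma rational_rate:
  fixes F :: "real \<Rightarrow> real"
  assumes "F differentiable (at 0)" "F 0 = c" "\<And>n. 0 < n \<Longrightarrow> f n = F (1 / real n)"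
  shows "(\<lambda>n. f n - c) \<in> O(\<lambda>n. 1 / real n)"
proof -
  have "\<forall>\<^sub>F n in sequentially. f n - c = F (1 / real n) - F 0"
    using eventually_gt_at_top[of 0] by eventually_elim (simp add: assms(2,3))
  then show ?thesis using bigo_of_inverse_argument[OF assms(1)] by (subst landau_o.big.in_cong) auto
qed

text \<open>
  The polynomial \<open>falling (n + 4 - x) 4 / n ^ 4\<close> in the variable \<open>y = 1 / n\<close>.
\<close>

definition falling_rev :: "real \<Rightarrow> real \<Rightarrow> real" where
  "falling_rev x y = (1 + (1 - x) * y) * (1 + (2 - x) * y) * (1 + (3 - x) * y) * (1 + (4 - x) * y)"

lemma falling_rev_eq: "m * y = 1 \<Longrightarrow> falling (m + 4 - x) 4 = m ^ 4 * falling_rev x y"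
  unfolding falling_4 falling_rev_def by algebra

lemma coefficient_rates:
  fixes x :: real
  shows "(\<lambda>n. 4 * x * (real n + 2) * (real n + 1)^2 * (real n * x + 2 + x) / falling (real n + 4 - x) 4 - 4 * x^2)
      \<in> O(\<lambda>n. 1 / real n)" (is ?alpha)
    and "(\<lambda>n. 4 * Psi3 (real n) x / falling (real n + 4 - x) 4 - 4 * (2 * x^2 - x)) \<in> O(\<lambda>n. 1 / real n)" (is ?psi3)
    and "(\<lambda>n. 2 * Psi4 (real n) x / falling (real n + 4 - x) 4 - 2 * (2 * x^2 - 5 * x - 3)) \<in> O(\<lambda>n. 1 / real n)" (is ?psi4)
    and "(\<lambda>n. 2 * x * (real n + 1)^2 / ((real n + 1 - x) * (real n + 2 - x)) - 2 * x) \<in> O(\<lambda>n. 1 / real n)" (is ?a1)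
    and "(\<lambda>n. (x + x ^ 2 + real n - 2 * real n * x + 2 * real n * x ^ 2 + real n ^ 2 - 2 * real n ^ 2 * x)
        / ((real n + 1 - x) * (real n + 2 - x)) - (1 - 2 * x)) \<in> O(\<lambda>n. 1 / real n)" (is ?a0)
    and "(\<lambda>n. (real n + 1) * x / (real n + 1 - x) - x) \<in> O(\<lambda>n. 1 / real n)" (is ?r)
proof -
  have my: "real n * (1 / real n) = 1" if "0 < n" for n using that by simp
  have cancel: "a / b = c / d" if "a = real n ^ k * c" "b = real n ^ k * d" "0 < n" for a b c d :: real and n k
    using that by simp
  show ?alpha
  proof (rule rational_rate[where F = "\<lambda>y. 4 * x * (1 + 2 * y) * (1 + y)^2 * (x + (2 + x) * y) / falling_rev x y"])
    fix n :: nat assume n: "0 < n"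
    define y where "y = 1 / real n"
    show "4 * x * (real n + 2) * (real n + 1)^2 * (real n * x + 2 + x) / falling (real n + 4 - x) 4
        = 4 * x * (1 + 2 * (1 / real n)) * (1 + 1 / real n)^2 * (x + (2 + x) * (1 / real n)) / falling_rev x (1 / real n)"
      using my[OF n] n unfolding y_def[symmetric] by (intro cancel[of _ n 4] falling_rev_eq) algebra+
  qed (auto simp: falling_rev_def power2_eq_square intro!: derivative_intros)
  show ?psi3
  proof (rule rational_rate[where F = "\<lambda>y. 4 * (2 * x ^ 2 - x + (- 2 * x ^ 3 + 7 * x ^ 2 + 6 * x - 4) * y + (- 6 * x ^ 3 - 4 * x ^ 2 + 41 * x - 16) * y ^ 2
    + (- 45 * x ^ 2 + 78 * x - 20) * y ^ 3 + (- 2 * x ^ 4 + 16 * x ^ 3 - 58 * x ^ 2 + 56 * x - 8) * y ^ 4) / falling_rev x y"])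
    fix n :: nat assume n: "0 < n"
    define y where "y = 1 / real n"
    have "4 * Psi3 (real n) x = real n ^ 4 * (4 * (2 * x ^ 2 - x + (- 2 * x ^ 3 + 7 * x ^ 2 + 6 * x - 4) * y + (- 6 * x ^ 3 - 4 * x ^ 2 + 41 * x - 16) * y ^ 2
    + (- 45 * x ^ 2 + 78 * x - 20) * y ^ 3 + (- 2 * x ^ 4 + 16 * x ^ 3 - 58 * x ^ 2 + 56 * x - 8) * y ^ 4))"
      using my[OF n] unfolding y_def[symmetric] Psi3_def by algebra
    then show "4 * Psi3 (real n) x / falling (real n + 4 - x) 4 = 4 * (2 * x ^ 2 - x + (- 2 * x ^ 3 + 7 * x ^ 2 + 6 * x - 4) * (1 / real n) + (- 6 * x ^ 3 - 4 * x ^ 2 + 41 * x - 16) * (1 / real n) ^ 2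
    + (- 45 * x ^ 2 + 78 * x - 20) * (1 / real n) ^ 3 + (- 2 * x ^ 4 + 16 * x ^ 3 - 58 * x ^ 2 + 56 * x - 8) * (1 / real n) ^ 4) / falling_rev x (1 / real n)"
      using my[OF n] n unfolding y_def by (intro cancel[of _ n 4] falling_rev_eq) auto
  qed (auto simp: falling_rev_def power2_eq_square intro!: derivative_intros)
  show ?psi4
  proof (rule rational_rate[where F = "\<lambda>y. 2 * (2 * x ^ 2 - 5 * x - 3 + (- 4 * x ^ 3 + 25 * x ^ 2 - 22 * x - 42) * y
    + (2 * x ^ 4 - 39 * x ^ 3 + 119 * x ^ 2 - 35 * x - 153) * y ^ 2
    + (25 * x ^ 4 - 152 * x ^ 3 + 250 * x ^ 2 + 10 * x - 234) * y ^ 3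
    + (- 6 * x ^ 5 + 58 * x ^ 4 - 173 * x ^ 3 + 155 * x ^ 2 + 78 * x - 144) * y ^ 4) / falling_rev x y"])
    fix n :: nat assume n: "0 < n"
    define y where "y = 1 / real n"
    have "2 * Psi4 (real n) x = real n ^ 4 * (2 * (2 * x ^ 2 - 5 * x - 3 + (- 4 * x ^ 3 + 25 * x ^ 2 - 22 * x - 42) * y
    + (2 * x ^ 4 - 39 * x ^ 3 + 119 * x ^ 2 - 35 * x - 153) * y ^ 2
    + (25 * x ^ 4 - 152 * x ^ 3 + 250 * x ^ 2 + 10 * x - 234) * y ^ 3
    + (- 6 * x ^ 5 + 58 * x ^ 4 - 173 * x ^ 3 + 155 * x ^ 2 + 78 * x - 144) * y ^ 4))"
      using my[OF n] unfolding y_def[symmetric] Psi4_def by algebra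
    then show "2 * Psi4 (real n) x / falling (real n + 4 - x) 4 = 2 * (2 * x ^ 2 - 5 * x - 3 + (- 4 * x ^ 3 + 25 * x ^ 2 - 22 * x - 42) * (1 / real n)
    + (2 * x ^ 4 - 39 * x ^ 3 + 119 * x ^ 2 - 35 * x - 153) * (1 / real n) ^ 2
    + (25 * x ^ 4 - 152 * x ^ 3 + 250 * x ^ 2 + 10 * x - 234) * (1 / real n) ^ 3
    + (- 6 * x ^ 5 + 58 * x ^ 4 - 173 * x ^ 3 + 155 * x ^ 2 + 78 * x - 144) * (1 / real n) ^ 4) / falling_rev x (1 / real n)"
      using my[OF n] n unfolding y_def by (intro cancel[of _ n 4] falling_rev_eq) auto
  qed (auto simp: falling_rev_def power2_eq_square intro!: derivative_intros)
  show ?a1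
  proof (rule rational_rate[where F = "\<lambda>y. 2 * x * (1 + y)^2 / ((1 + (1 - x) * y) * (1 + (2 - x) * y))"])
    fix n :: nat assume n: "0 < n"
    define y where "y = 1 / real n"
    show "2 * x * (real n + 1)^2 / ((real n + 1 - x) * (real n + 2 - x))
        = 2 * x * (1 + 1 / real n)^2 / ((1 + (1 - x) * (1 / real n)) * (1 + (2 - x) * (1 / real n)))"
      using my[OF n] n unfolding y_def[symmetric] by (intro cancel[of _ n 2]) algebra+
  qed (auto simp: power2_eq_square intro!: derivative_intros)
  show ?a0
  proof (rule rational_rate[where F = "\<lambda>y. ((x + x ^ 2) * y^2 + y - 2 * x * y + 2 * x ^ 2 * y + 1 - 2 * x)
      / ((1 + (1 - x) * y) * (1 + (2 - x) * y))"])
    fix n :: nat assume n: "0 < n"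
    define y where "y = 1 / real n"
    show "(x + x ^ 2 + real n - 2 * real n * x + 2 * real n * x ^ 2 + real n ^ 2 - 2 * real n ^ 2 * x)
        / ((real n + 1 - x) * (real n + 2 - x)) =
      ((x + x ^ 2) * (1 / real n)^2 + 1 / real n - 2 * x * (1 / real n) + 2 * x ^ 2 * (1 / real n) + 1 - 2 * x)
      / ((1 + (1 - x) * (1 / real n)) * (1 + (2 - x) * (1 / real n)))"
      using my[OF n] n unfolding y_def[symmetric] by (intro cancel[of _ n 2]) algebra+
  qed (auto simp: power2_eq_square intro!: derivative_intros)
  show ?r
  proof (rule rational_rate[where F = "\<lambda>y. (1 + y) * x / (1 + (1 - x) * y)"])
    fix n :: nat assume n: "0 < n"
    define y where "y = 1 / real n"
    show "(real n + 1) * x / (real n + 1 - x) = (1 + 1 / real n) * x / (1 + (1 - x) * (1 / real n))"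
      using my[OF n] n unfolding y_def[symmetric] by (intro cancel[of _ n 1]) algebra+
  qed (auto intro!: derivative_intros)
qed

lemma binomial_quotient_rate:
  assumes "k + 2 \<le> p"
  shows "(\<lambda>n. (real n + 1) * real (n choose k) / real (n choose p)) \<in> O(\<lambda>n. 1 / real n)"
proof (rule bigoI[where c = "2 * real p ^ p"])
  show "\<forall>\<^sub>F n in sequentially. norm ((real n + 1) * real (n choose k) / real (n choose p))
      \<le> 2 * real p ^ p * norm (1 / real n)"
    using eventually_ge_at_top[of p]
  proof eventually_elim
    case (elim n)
    have n: "real n \<ge> 1" and p: "p > 0" using elim assms by linarith+
    have "real (n choose k) \<le> real n ^ k"
      using binomial_le_pow[of k n] elim assms by (simp flip: of_nat_power)
    moreover have lower: "(real n / real p) ^ p \<le> real (n choose p)"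
      using binomial_ge_n_over_k_pow_k[of p n, where 'a = real] elim by simp
    moreover have "(real n / real p) ^ p > 0" using n p by simp
    ultimately have "(real n + 1) * real (n choose k) / real (n choose p)
        \<le> (2 * real n) * real n ^ k / (real n / real p) ^ p"
      using n by (intro frac_le mult_mono) auto
    also have "\<dots> = 2 * real p ^ p * (real n ^ (k + 1) / real n ^ p)"
      by (simp add: power_divide)
    also have "real n ^ (k + 1) / real n ^ p \<le> real n ^ (k + 1) / real n ^ (k + 2)"
      using n assms by (intro divide_left_mono power_increasing mult_pos_pos) auto
    also have "real n ^ (k + 1) / real n ^ (k + 2) = 1 / real n" using n by simp
    finally show ?case using n p by (simp add: mult_left_mono)
  qed
qed

text \<open>
  After division by \<open>n choose p\<close> only the last term \<open>k = p - 1\<close> of the initial segment survives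
  multiplication with \<open>n + 1\<close>; the other terms, and the complete sum, are smaller by a factor of order
  \<open>1 / n\<close>. The function \<open>L\<close> bounds the growth of the complete sum.
\<close>

lemma alt_tail_rate:
  assumes p: "2 \<le> p" and L: "(\<lambda>n. alt_tail j n 1) \<in> O(L)" "(\<lambda>n. 1) \<in> O(L)"
  shows "(\<lambda>n. (real n + 1) * (-1)^p / real (n choose p) * alt_tail j n p - real p / (real p - 1) ^ j)
    \<in> O(\<lambda>n. 1 / real n * L n)"
proof -
  obtain q where q: "p = Suc (Suc q)" using p by (metis le_Suc_ex numeral_2_eq_2 plus_nat.simps(2) add_0)
  define R where "R k n = (real n + 1) * real (n choose k) / real (n choose p)" for k n
  define s where "s = (-1 :: real) ^ p"
  have inv: "(\<lambda>n. 1 / real n) \<in> O(\<lambda>n. 1 / real n * L n)"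
    using landau_o.big.mult[OF landau_o.big_refl[of "\<lambda>n. 1 / real n"] L(2)] by simp
  have R: "R k \<in> O(\<lambda>n. 1 / real n)" if "k \<le> q" for k
    unfolding R_def using that q by (intro binomial_quotient_rate) simp
  have last: "(\<lambda>n. R (Suc q) n - real p) \<in> O(\<lambda>n. 1 / real n)"
  proof -
    have "\<forall>\<^sub>F n in sequentially. R (Suc q) n - real p = (real n + 1) * real p / (real n + 1 - real p) - real p"
      using eventually_ge_at_top[of p]
    proof eventually_elim
      case (elim n)
      have "(real n + 1 - real p) * real (n choose Suc q) = real p * real (n choose p)"
        using binomial_lower_lower[of n "Suc q"] q by (simp add: algebra_simps del: binomial_Suc_Suc)
      moreover have "real n + 1 - real p > 0" "real (n choose p) > 0" using elim by auto
      ultimately show ?case by (simp add: R_def field_simps del: binomial_Suc_Suc)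
    qed
    then show ?thesis using coefficient_rates(6)[of "real p"] by (subst landau_o.big.in_cong) auto
  qed
  have "\<forall>\<^sub>F n in sequentially. (real n + 1) * (-1)^p / real (n choose p) * alt_tail j n p - real p / (real p - 1) ^ j
      = s * (R 0 n * alt_tail j n 1) - (\<Sum>k=1..q. s * (-1) ^ k / real k ^ j * R k n)
        + 1 / (real p - 1) ^ j * (R (Suc q) n - real p)"
    using eventually_ge_at_top[of p]
  proof eventually_elim
    case (elim n)
    have ss: "s * (-1) ^ Suc q = -1" by (simp add: s_def q flip: power_add mult_2)
    have "(real n + 1) * (-1)^p / real (n choose p) * alt_tail j n p =
      s * (R 0 n * alt_tail j n 1) - (\<Sum>k=1..Suc q. s * (-1) ^ k / real k ^ j * R k n)"
      using alt_tail_split[of p n j] elim p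
      by (simp add: R_def s_def q right_diff_distrib sum_distrib_left del: binomial_Suc_Suc sum.cl_ivl_Suc)
         (simp add: algebra_simps sum_distrib_left del: binomial_Suc_Suc sum.cl_ivl_Suc)
    also have "(\<Sum>k=1..Suc q. s * (-1) ^ k / real k ^ j * R k n) =
        (\<Sum>k=1..q. s * (-1) ^ k / real k ^ j * R k n) + (s * (-1) ^ Suc q) / real (Suc q) ^ j * R (Suc q) n"
      by simp
    finally show ?case unfolding ss by (simp add: q algebra_simps diff_divide_distrib)
  qed
  moreover have "(\<lambda>n. s * (R 0 n * alt_tail j n 1) - (\<Sum>k=1..q. s * (-1) ^ k / real k ^ j * R k n)
        + 1 / (real p - 1) ^ j * (R (Suc q) n - real p)) \<in> O(\<lambda>n. 1 / real n * L n)"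
  proof -
    have 1: "(\<lambda>n. R 0 n * alt_tail j n 1) \<in> O(\<lambda>n. 1 / real n * L n)"
      by (rule landau_o.big.mult[OF R L(1)]) simp
    have 2: "(\<lambda>n. R k n) \<in> O(\<lambda>n. 1 / real n * L n)" if "k \<in> {1..q}" for k
      using landau_o.big_trans[OF R inv, of k] that by simp
    show ?thesis
      by (rule sum_in_bigo(1)[OF sum_in_bigo(2)[OF bigo_cmult[OF 1] big_sum_in_bigo[OF bigo_cmult[OF 2]]]
            bigo_cmult[OF landau_o.big_trans[OF last inv]]])
  qed
  ultimately show ?thesis by (subst landau_o.big.in_cong) auto
qed


text \<open>
  The variance minus its main terms is rearranged to a sum of products, each with one factor that is a
  deviation of a coefficient, a harmonic number or an alternating term from its limit. The deviation of
  the mean is at most of order \<open>ln n / n\<close>, so its product with the mean is still small enough.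
\<close>

lemma variance_asymptotics:
  assumes p: "2 \<le> p"
  shows "(\<lambda>n :: nat. VY n p -
            (2 * real p * ln (real n) - 2 * real p * (harm p - euler_mascheroni)
             - 4 * real p ^ 2 * (pi ^ 2 / 6 - harm2 p)
             + 2 * (- 2 + 7 * real p - 5 * real p ^ 2 + 2 * real p ^ 3) / (1 - real p)^2))
        \<in> O(\<lambda>n. ln (real n) ^ 2 / real n)"
proof -
  define x where "x = real p"
  have x: "x > 1" using p by (simp add: x_def)
  define l where "l = (\<lambda>n. ln (real n))"
  define h where "h = (\<lambda>n. harm n - harm p :: real)"
  define k where "k = (2 - 3 * x^2) / x"
  define T1 T2 where "T1 = x / (x - 1)" and "T2 = x / (x - 1)^2"
  define e where "e = 1 - 2 * x - 2 * x * T1 + (2 * x + 2)"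
  define al where "al = (\<lambda>n. 4 * x * (real n + 2) * (real n + 1)^2 * (real n * x + 2 + x) / falling (real n + 4 - x) 4)"
  define ps3 where "ps3 = (\<lambda>n. 4 * Psi3 (real n) x / falling (real n + 4 - x) 4)"
  define ps4 where "ps4 = (\<lambda>n. 2 * Psi4 (real n) x / falling (real n + 4 - x) 4)"
  define a1 where "a1 = (\<lambda>n. 2 * x * (real n + 1)^2 / ((real n + 1 - x) * (real n + 2 - x)))"
  define a0 where "a0 = (\<lambda>n. (x + x ^ 2 + real n - 2 * real n * x + 2 * real n * x ^ 2 + real n ^ 2 - 2 * real n ^ 2 * x)
        / ((real n + 1 - x) * (real n + 2 - x)))"
  define t where "t = (\<lambda>j n. (real n + 1) * (-1)^p / real (n choose p) * alt_tail j n p)"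
  define A where "A = (\<lambda>n. h n ^ 2 - (harm2 n - harm2 p))"
  \<comment> \<open>The mean is \<open>2 * x * h n + e + d n\<close>.\<close>
  define d where "d = (\<lambda>n. (a1 n - 2 * x) * h n + (a0 n - (1 - 2 * x)) - 2 * x * (t 1 n - T1))"

  have harm_l: "(\<lambda>n. harm n - l n - euler_mascheroni) \<in> O(\<lambda>n. 1 / real n)"
    unfolding l_def by (rule harm_rate)
  have small: "(\<lambda>n. 1 / real n) \<in> O(l)" "(\<lambda>n. 1 / real n) \<in> O(\<lambda>n. 1)" "(\<lambda>n. c) \<in> O(l)" for c :: real
    unfolding l_def by real_asymp+
  have small2: "(\<lambda>n. 1 / real n) \<in> O(\<lambda>n. l n ^ 2 / real n)" "(\<lambda>n. 1 / real n * l n) \<in> O(\<lambda>n. l n ^ 2 / real n)"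
    "(\<lambda>n. l n * (1 / real n)) \<in> O(\<lambda>n. l n ^ 2 / real n)"
    "(\<lambda>n. 1 / real n) \<in> O(\<lambda>n. 1 / real n * l n)" "(\<lambda>n. 1 / real n * l n) \<in> O(l)"
    "(\<lambda>n. 1) \<in> O(\<lambda>n. l n ^ 2)" "(\<lambda>n. 1 / real n) \<in> O(\<lambda>n. l n ^ 2)"
    unfolding l_def by real_asymp+
  have harm_O: "(\<lambda>n. harm n) \<in> O(l)"
  proof -
    have "(\<lambda>n. (harm n - l n - euler_mascheroni) + (l n + euler_mascheroni)) \<in> O(l)"
      by (intro sum_in_bigo(1) landau_o.big_trans[OF harm_l small(1)] landau_o.big_refl small(3))
    then show ?thesis by simp
  qed
  have h_O: "h \<in> O(l)" unfolding h_def by (intro sum_in_bigo(2) harm_O small(3))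
  have harm2_O: "(\<lambda>n. harm2 n) \<in> O(\<lambda>n. 1)"
  proof -
    have "(\<lambda>n. (harm2 n - pi^2 / 6) + pi^2 / 6) \<in> O(\<lambda>n. 1)"
      by (intro sum_in_bigo(1) landau_o.big_trans[OF harm2_rate small(2)]) simp
    then show ?thesis by simp
  qed
  have harm2_O': "(\<lambda>n. harm2 n) \<in> O(\<lambda>n. l n ^ 2)" by (rule landau_o.big_trans[OF harm2_O small2(6)])
  have const: "(\<lambda>n. c) \<in> O(\<lambda>n. l n ^ 2)" for c :: real
    using bigo_cmult[OF small2(6), of c] by simp
  have harm_sq: "(\<lambda>n. harm n ^ 2) \<in> O(\<lambda>n. l n ^ 2)" by (rule landau_o.big_power[OF harm_O])
  have A_O: "A \<in> O(\<lambda>n. l n ^ 2)"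
    unfolding A_def by (intro sum_in_bigo landau_o.big_power[OF h_O] harm2_O' const)
  have t1: "(\<lambda>n. t 1 n - T1) \<in> O(\<lambda>n. 1 / real n * l n)"
  proof -
    have "(\<lambda>n. alt_tail 1 n 1) \<in> O(l)" unfolding alt_tail_one using harm_O by simp
    from alt_tail_rate[OF p this small(3)] show ?thesis unfolding t_def T1_def x_def power_one_right .
  qed
  have t2: "(\<lambda>n. t 2 n - T2) \<in> O(\<lambda>n. 1 / real n * l n ^ 2)"
  proof -
    have "(\<lambda>n. (-1/2) * (harm n ^ 2 + harm2 n)) \<in> O(\<lambda>n. l n ^ 2)"
      by (intro bigo_cmult sum_in_bigo(1) harm_sq harm2_O')
    moreover have "alt_tail 2 n 1 = (-1/2) * (harm n ^ 2 + harm2 n)" for n unfolding alt_tail_one by (simp add: field_simps)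
    ultimately have "(\<lambda>n. alt_tail 2 n 1) \<in> O(\<lambda>n. l n ^ 2)" by (simp only:)
    from alt_tail_rate[OF p this small2(6)] show ?thesis unfolding t_def T2_def x_def .
  qed
  have rates: "(\<lambda>n. al n - 4 * x^2) \<in> O(\<lambda>n. 1 / real n)"
    "(\<lambda>n. ps3 n - 4 * (2 * x^2 - x)) \<in> O(\<lambda>n. 1 / real n)"
    "(\<lambda>n. ps4 n - 2 * (2 * x^2 - 5 * x - 3)) \<in> O(\<lambda>n. 1 / real n)"
    "(\<lambda>n. a1 n - 2 * x) \<in> O(\<lambda>n. 1 / real n)"
    "(\<lambda>n. a0 n - (1 - 2 * x)) \<in> O(\<lambda>n. 1 / real n)"
    unfolding al_def ps3_def ps4_def a1_def a0_def by (rule coefficient_rates)+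
  have d_O: "d \<in> O(\<lambda>n. 1 / real n * l n)"
    unfolding d_def
    by (rule sum_in_bigo(2)[OF sum_in_bigo(1)[OF landau_o.big.mult[OF rates(4) h_O]
            landau_o.big_trans[OF rates(5) small2(4)]] bigo_cmult[OF t1]])
  have d_l: "d \<in> O(l)" by (rule landau_o.big_trans[OF d_O small2(5)])

  define W where "W = (\<lambda>n. (al n - 4 * x^2) * A n + (- (4 * x^2)) * (harm2 n - pi^2 / 6)
      - (ps3 n - 4 * (2 * x^2 - x)) * h n + (ps4 n - 2 * (2 * x^2 - 5 * x - 3))
      - 8 * ((t 1 n - T1) * h n) - (4 * k) * (t 1 n - T1) + 8 * (t 2 n - T2)
      + d n - d n * (d n + 2 * (2 * x * h n + e))
      + 2 * x * (harm n - l n - euler_mascheroni))"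
  have "W \<in> O(\<lambda>n. l n ^ 2 / real n)"
  proof -
    have b: "(\<lambda>n. 1 / real n * l n ^ 2) = (\<lambda>n. l n ^ 2 / real n)" "(\<lambda>n. 1 / real n * l n * l n) = (\<lambda>n. l n ^ 2 / real n)"
      by (simp_all add: power2_eq_square)
    have de: "(\<lambda>n. d n + 2 * (2 * x * h n + e)) \<in> O(l)"
    proof -
      have "(\<lambda>n. d n + (2 * (2 * x)) * h n + 2 * e) \<in> O(l)"
        by (intro sum_in_bigo(1) d_l bigo_cmult h_O small(3))
      then show ?thesis by (simp add: algebra_simps)
    qed
    note m1 = landau_o.big.mult[OF rates(1) A_O, unfolded b]
      and m2 = landau_o.big_trans[OF harm2_rate small2(1)]
      and m3 = landau_o.big_trans[OF landau_o.big.mult[OF rates(2) h_O] small2(2)]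
      and m4 = landau_o.big_trans[OF rates(3) small2(1)]
      and m5 = landau_o.big.mult[OF t1 h_O, unfolded b]
      and m6 = landau_o.big_trans[OF t1 small2(2)]
      and m7 = t2[unfolded b]
      and m8 = landau_o.big_trans[OF d_O small2(2)]
      and m9 = landau_o.big.mult[OF d_O de, unfolded b]
      and m10 = landau_o.big_trans[OF harm_l small2(1)]
    show ?thesis unfolding W_def
      by (rule sum_in_bigo(1)[OF sum_in_bigo(2)[OF sum_in_bigo(1)[OF sum_in_bigo(1)[OF sum_in_bigo(2)[OF
          sum_in_bigo(2)[OF sum_in_bigo(1)[OF sum_in_bigo(2)[OF sum_in_bigo(1)[OF m1 bigo_cmult[OF m2]] m3] m4]
          bigo_cmult[OF m5]] bigo_cmult[OF m6]] bigo_cmult[OF m7]] m8] m9] bigo_cmult[OF m10]])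
  qed
  moreover have "\<forall>\<^sub>F n in sequentially. VY n p -
            (2 * real p * ln (real n) - 2 * real p * (harm p - euler_mascheroni)
             - 4 * real p ^ 2 * (pi ^ 2 / 6 - harm2 p)
             + 2 * (- 2 + 7 * real p - 5 * real p ^ 2 + 2 * real p ^ 3) / (1 - real p)^2) = W n"
    using eventually_ge_at_top[of p]
  proof eventually_elim
    case (elim n)
    define c where "c = 2 * (- 2 + 7 * x - 5 * x ^ 2 + 2 * x ^ 3) / (1 - x)^2"
    have E: "EY n p = 2 * x * h n + e + d n"
      unfolding EY_eq_tails[OF p elim] x_def[symmetric]
      unfolding d_def e_def
      by (simp add: a1_def a0_def t_def h_def algebra_simps)
    have V: "VY n p = al n * A n - ps3 n * h n + ps4 n - 4 * ((2 * h n + k) * t 1 n - 2 * t 2 n) + EY n p - (EY n p)^2"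
      unfolding VY_eq_tails[OF p elim] x_def[symmetric]
      by (simp add: al_def ps3_def ps4_def t_def h_def k_def A_def)
    have i: "x * inverse x = 1" "(x - 1) * inverse (x - 1) = 1" using x by auto
    have c': "c = 2 * (- 2 + 7 * x - 5 * x ^ 2 + 2 * x ^ 3) / (x - 1)^2"
      by (simp add: c_def power2_commute)
    \<comment> \<open>The coefficient of \<open>h n\<close> and the constant term of the limit expression.\<close>
    have lin: "- (4 * (2 * x^2 - x)) - 8 * T1 + 2 * x - 4 * x * e = 2 * x"
      unfolding e_def T1_def divide_inverse using i by algebra
    have con: "2 * (2 * x^2 - 5 * x - 3) - 4 * k * T1 + 8 * T2 + e - e^2 = c"
      unfolding c' e_def T1_def T2_def k_def divide_inverse power_inverse[symmetric] using i by algebra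
    have "VY n p - (2 * x * l n - 2 * x * (harm p - euler_mascheroni) - 4 * x ^ 2 * (pi ^ 2 / 6 - harm2 p) + c)
        = W n + (- (4 * (2 * x^2 - x)) - 8 * T1 + 2 * x - 4 * x * e - 2 * x) * h n
        + (2 * (2 * x^2 - 5 * x - 3) - 4 * k * T1 + 8 * T2 + e - e^2 - c)"
      unfolding V E W_def A_def h_def by (simp add: power2_eq_square algebra_simps)
    then show ?case unfolding lin con by (simp add: x_def l_def c_def)
  qed
  ultimately show ?thesis unfolding l_def by (subst landau_o.big.in_cong) auto
qed

theorem lemma2:
  shows
   "(\<forall>n p :: nat. 2 \<le> p \<and> p \<le> n \<longrightarrow>
      VY n p =
        4 * (-1)^p * (real n + 1) * (2 * real p * harm n - 2 * real p * harm p + 2 - 3 * real p ^ 2)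
          / (real p * real (n choose p))
          * (\<Sum>k=1..p-1. (-1)^k / real k * real (n choose k))
        - 8 * (-1)^p * (real n + 1) / real (n choose p)
          * (\<Sum>k=1..p-1. (-1)^k / real k ^ 2 * real (n choose k))
        + 4 * (-1)^p * (real n + 1) / real (n choose p)
          * (harm n ^ 2 - harm2 n - 2 * harm p * harm n)
        + 4 * (-1)^p * (2 - 3 * real p ^ 2) * (real n + 1) / (real p * real (n choose p)) * harm n
        - 4 * Psi3 (real n) (real p) / falling (real n + 4 - real p) 4 * (harm n - harm p)
        + 4 * real p * (real n + 2) * (real n + 1)^2 * (real n * real p + 2 + real p)
          / falling (real n + 4 - real p) 4
          * ((harm n - harm p)^2 - (harm2 n - harm2 p))
        + 2 * Psi4 (real n) (real p) / falling (real n + 4 - real p) 4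
        + EY n p - (EY n p)^2)
    \<and> (\<forall>n :: nat. 1 \<le> n \<longrightarrow> VY n 1 = 0)
    \<and> (\<forall>p :: nat. 2 \<le> p \<longrightarrow>
        (\<lambda>n :: nat. VY n p -
            (2 * real p * ln (real n) - 2 * real p * (harm p - euler_mascheroni)
             - 4 * real p ^ 2 * (pi ^ 2 / 6 - harm2 p)
             + 2 * (- 2 + 7 * real p - 5 * real p ^ 2 + 2 * real p ^ 3) / (1 - real p)^2))
        \<in> O(\<lambda>n. ln (real n) ^ 2 / real n))"
  using exact_variance VY_1 variance_asymptotics by (intro conjI allI impI) auto

end
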